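(* Consider the problem of minimizing $V=F+G$ over $\mathcal X$ under Assumptions A and B, and let $\{\mathbf x^k\}$ be a sequence generated by DAsyFLEXA under Assumptions C and D (problem, assumptions, algorithm and constants are all defined in the context). Suppose that $\gamma/\tau>0$ is sufficiently small (i.e. $\gamma/\tau\le\bar c$ for some threshold $\bar c>0$ determined by the problem data and the constants of the assumptions). Then there is $\mathbf x^\star\in\mathcal X^\star$ such that, with $V^\star\triangleq V(\mathbf x^\star)$, for each $t\in\{0,\dots,B-1\}$ the sequences $\{\mathbf x^{t+kB}\}_k$ and $\{V(\mathbf x^{t+kB})\}_k$ converge at least R-linearly to $\mathbf x^\star$ and $V^\star$, respectively; that is, as $k\to\infty$, $$V(\mathbf x^{t+kB})-V^\star=\mathcal O\big(\lambda^{t+kB}\big),\qquad \|\mathbf x^{t+kB}-\mathbf x^\star\|=\mathcal O\big(\sqrt{\lambda^{t+kB}}\big),$$ where $\lambda\in(0,1)$ is the constant $$\lambda\triangleq1-\frac{\gamma^2}{2}\cdot\frac{2\tau-\gamma L(BD\rho^2+2)}{2N\alpha_1+2(B-N)\alpha_2+\gamma(2-\gamma)\big(2\tau-\gamma L(BD\rho^2+2)\big)},$$ with $\alpha_1,\alpha_2$ the positive constants defined in the context.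
   Context: **Problem.** $\mathcal N=\{1,\dots,N\}$ is a set of agents; $\mathbf x=(\mathbf x_1,\dots,\mathbf x_N)\in\mathbb R^n$ with blocks $\mathbf x_i\in\mathbb R^{n_i}$, $\sum_i n_i=n$. For each $i$, $\mathcal N_i\subseteq\mathcal N$ contains $i$, and $j\in\mathcal N_i\iff i\in\mathcal N_j$; $\rho\triangleq\max_{i\in\mathcal N}|\mathcal N_i|$. Write $\mathbf x_{\mathcal N_i}=[\mathbf x_j]_{j\in\mathcal N_i}$, $\mathcal X=\prod_{i}\mathcal X_i$, $\mathcal X_{\mathcal N_i}=\prod_{j\in\mathcal N_i}\mathcal X_j$. The problem is $$\min_{\mathbf x\in\mathcal X}V(\mathbf x)=F(\mathbf x)+G(\mathbf x),\quad F(\mathbf x)=\sum_{i=1}^Nf_i(\mathbf x_{\mathcal N_i}),\quad G(\mathbf x)=\sum_{i=1}^Ng_i(\mathbf x_i).$$ "Differentiable on a set" means differentiable on an open set containing it. $f_i$ is block-$LC^1$ on a set if it is continuously differentiable there and its partial gradients $\nabla_{\mathbf x_j}f_i$ are locally Lipschitz there. **Stationarity.** $\mathcal X^\star$ is the set of stationary solutions: points $\mathbf x^\star\in\mathcal X$ with $\langle\nabla F(\mathbf x^\star),\mathbf y-\mathbf x^\star\rangle+G(\mathbf y)-G(\mathbf x^\star)\ge0$ for all $\mathbf y\in\mathcal X$. Let $d(\mathbf x,\mathcal X^\star)=\min_{\mathbf x^\star\in\mathcal X^\star}\|\mathbf x-\mathbf x^\star\|_2$ and $\mathrm{prox}_G(\mathbf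 z)=\arg\min_{\mathbf y\in\mathcal X}\{G(\mathbf y)+\frac12\|\mathbf y-\mathbf z\|_2^2\}$. **Assumption A.** (A1) Each $\mathcal X_i\subseteq\mathbb R^{n_i}$ is nonempty, closed, convex. (A2) At least one of: (a) $\mathcal L^0\triangleq\{\mathbf x\in\mathcal X:V(\mathbf x)\le V(\mathbf x^0)\}$ is compact and all $f_i$ are block-$LC^1$ on $\mathcal X_{\mathcal N_i}$; (b) all $f_i$ are $C^1$ and their gradients $\nabla_{\mathbf x_j}f_i$, $j\in\mathcal N_i$, are globally Lipschitz on $\mathcal X_{\mathcal N_i}$. (A3) Each $g_i:\mathcal X_i\to\mathbb R$ is convex. (A4) The problem has a solution. (A5) The communication graph of the agents (a graph with node set $\mathcal N$) is connected. **Assumption B (Luo–Tseng error bound).** (B1) For any $\eta>\min_{\mathbf x\in\mathcal X}V(\mathbf x)$ there exist $\epsilon,\kappa>0$ such that: $V(\mathbf x)\le\eta$ and $\|\mathbf x-\mathrm{prox}_G(\mathbf x-\nabla F(\mathbf x))\|_2\le\epsilon$ imply $d(\mathbf x,\mathcal X^\star)\le\kappa\|\mathbf x-\mathrm{prox}_G(\mathbf x-\nabla F(\mathbf x))\|_2$ (for $\mathbf x\in\mathcal X$). (B2) There exists $\delta>0$ such that $\mathbf x,\mathbf y\in\mathcal X^\star$, $V(\mathbf x)\ne V(\mathbf y)$ imply $\|\mathbf x-\mathbf y\|_2\ge\delta$. **Assumption C (surrogates).** Each $\tilde f_i:\mathcal X_i\times\mathcal X_{\mathcal N_i}\to\mathbb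 R$ satisfies, with $\nabla\tilde f_i$ the partial gradient in the first argument: (C1) $\tilde f_i(\cdot;\mathbf y)$ is $C^1$ and $\tau$-strongly convex on $\mathcal X_i$ for all $\mathbf y\in\mathcal X_{\mathcal N_i}$ ($\tau>0$); (C2) $\nabla\tilde f_i(\mathbf y_i;\mathbf y_{\mathcal N_i})=\nabla_{\mathbf y_i}f_i(\mathbf y_{\mathcal N_i})$ for all $\mathbf y\in\mathcal X$; (C3) $\nabla\tilde f_i(\mathbf y;\cdot)$ is $L_i$-Lipschitz on $\mathcal X_{\mathcal N_i}$ for all $\mathbf y\in\mathcal X_i$. Let $L_m=\max_{i\in\mathcal N}L_i$. **Best response.** For vectors $\mathbf w(j)\in\mathcal X$, $j\in\mathcal N_i$, put $\tilde{\mathbf w}(i)=[\mathbf w_{\mathcal N_j}(j)]_{j\in\mathcal N_i}$ and $$\widehat{\mathbf x}_i(\tilde{\mathbf w}(i))=\arg\min_{\mathbf x_i\in\mathcal X_i}\Big\{\tilde f_i(\mathbf x_i;\mathbf w_{\mathcal N_i}(i))+\sum_{j\in\mathcal N_i\setminus\{i\}}\langle\nabla_{\mathbf x_i}f_j(\mathbf w_{\mathcal N_j}(j)),\mathbf x_i-\mathbf w_i(i)\rangle+g_i(\mathbf x_i)\Big\}.$$ **Algorithm DAsyFLEXA.** Start from $\mathbf x^0\in\mathcal X$, set $\mathbf x^t=\mathbf x^0$ for $t<0$, and fix $\gamma\in(0,1]$. For each $k\ge0$ there are an active agent $i^k\in\mathcal N$ and delay vectors $\mathbf d^k(i,j)=[d^k_l(i,j)]_{l\in\mathcal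 N_j}$ of nonnegative integers, for $i\in\mathcal N$, $j\in\mathcal N_i$, with $d^k_i(i,i)=0$; write $\mathbf x_{\mathcal N_j}^{k-\mathbf d^k(i,j)}=[\mathbf x_l^{k-d_l^k(i,j)}]_{l\in\mathcal N_j}$. Let $\widehat{\mathbf x}_i^k=\widehat{\mathbf x}_i\big([\mathbf x_{\mathcal N_j}^{k-\mathbf d^k(i,j)}]_{j\in\mathcal N_i}\big)$, that is, $$\widehat{\mathbf x}_i^k=\arg\min_{\mathbf x_i\in\mathcal X_i}\Big\{\tilde f_i(\mathbf x_i;\mathbf x_{\mathcal N_i}^{k-\mathbf d^k(i,i)})+\sum_{j\in\mathcal N_i\setminus\{i\}}\langle\nabla_{\mathbf x_i}f_j(\mathbf x_{\mathcal N_j}^{k-\mathbf d^k(i,j)}),\mathbf x_i-\mathbf x_i^k\rangle+g_i(\mathbf x_i)\Big\}.$$ The update is $\mathbf x_{i^k}^{k+1}=\mathbf x_{i^k}^k+\gamma(\widehat{\mathbf x}_{i^k}^k-\mathbf x_{i^k}^k)$, all other blocks unchanged. **Assumption D.** (D1) There is an integer $B\ge N$ with $\bigcup_{t=k}^{k+B-1}\{i^t\}=\mathcal N$ for all $k$. (D2) There is an integer $D\in[0,B]$ such that every component of every $\mathbf d^k(i,j)$ ($i\in\mathcal N$, $j\in\mathcal N_i$, $k\ge0$) is at most $D$. **Constant $L>0$.** If (A2)(b) holds, $L$ is the largest of the global Lipschitz constants of the $\nabla_{\mathbf x_j}f_i$. If (A2)(a) holds: let $\mathtt{Cube}=\{\mathbf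 w\in\mathcal X:\|\mathbf w\|_\infty\le U\}$ with $U<\infty$ such that $\mathcal L^0\subseteq\mathtt{Cube}$; let $\psi=\max_{i\in\mathcal N}\max\{\|\widehat{\mathbf x}_i(\tilde{\mathbf w}(i))-\mathbf w_i(i)\|_2:\ \tilde{\mathbf w}(i)=[\mathbf w_{\mathcal N_j}(j)]_{j\in\mathcal N_i},\ \mathbf w(j)\in\mathtt{Cube}\}$; let $\bar{\mathcal L}^0=(\mathcal L^0+\psi\mathcal B)\cap\mathcal X$, with $\mathcal B$ the unit ball centered at the origin. Then $L$ is the maximum of the Lipschitz constants of all $\nabla_{\mathbf x_j}f_i$ over the sets $\{\mathbf x_{\mathcal N_i}:\mathbf x\in\bar{\mathcal L}^0\}$. **Constants in the rate.** $\kappa$ is the constant of (B1) corresponding to $\eta,\epsilon$ such that $V(\mathbf x^k)\le\eta$ and $\|\mathbf x^k-\mathrm{prox}_G(\mathbf x^k-\nabla F(\mathbf x^k))\|_2\le\epsilon$ for all $k\ge0$. With $K\triangleq\kappa^2(1+L+NL_m)^2$ and $C_2\triangleq3\gamma^2(B+2D-N+1)\rho(L_m^2+(\rho-1)L^2)/\tau^2$, - $\beta_1=C_2\big(K(2N+1)+N(1+\gamma^2)\big)+K+1+\gamma^2(B-N+2)$, - $\beta_2=C_2\big(3K(2N+1)+N(3+\gamma^2)\big)+6K+3+\frac{\gamma^2}{2}(3B-3N+5)$, - $\beta_3=2(L^2+L_m^2)(2NC_2+D\gamma^2+1)+\frac12$, - $\beta_4=2C_2\big(2K(2N+1)+N(L_m^2+L^2(\rho-1))\big)+2K+(L_m^2+L^2(\rho-1))(1+D\gamma^2)+2\gamma^2$,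 - $\beta_5=(L_m^2+L^2(\rho-1))(2NC_2+D\gamma^2+2)+\gamma^2$, - $\alpha_1=(1-\gamma)\big(\beta_3+\frac{L\gamma(\rho^2LD^2\gamma+1)+1}{2}\big)+\rho L\beta_1+\beta_4$, - $\alpha_2=(1-\gamma)\big(\beta_3+\frac{L\gamma(\rho^2LD^2\gamma+1)+1}{2}\big)+\rho L\beta_2+\beta_5$. *)

theory Defs
  imports "HOL-Analysis.Analysis" "HOL-Library.Landau_Symbols"
begin

text \<open>
  The agents are the elements of the finite type \<open>'a\<close> (so \<open>N = CARD('a)\<close>) and the ambient space is
  \<open>real ^ 'n\<close>. The map \<open>blk\<close> assigns to each coordinate the agent owning it, hence
  \<open>n\<^sub>i = card {c. blk c = i}\<close>; blocks may have different dimensions. For a set \<open>T\<close> of agents, the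
  space of the stacked blocks \<open>[x\<^sub>j]\<^sub>j\<^sub>\<in>\<^sub>T\<close> is identified with the coordinate subspace of vectors
  vanishing outside the blocks of \<open>T\<close> (\<open>blockspace\<close>), and \<open>restr\<close> maps \<open>x\<close> to \<open>x\<^sub>T\<close>.
  In particular \<open>Xset i\<close> is a subset of \<open>blockspace {i}\<close>, and \<open>floc i\<close> and \<open>greg i\<close> are only
  ever evaluated on the subspaces belonging to \<open>nbr i\<close> and \<open>{i}\<close>.
\<close>

record ('a, 'n::finite) problem =
  blk :: "'n \<Rightarrow> 'a"
  nbr :: "'a \<Rightarrow> 'a set"
  comm :: "('a \<times> 'a) set"
  Xset :: "'a \<Rightarrow> (real ^ 'n) set"
  floc :: "'a \<Rightarrow> real ^ 'n \<Rightarrow> real"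
  greg :: "'a \<Rightarrow> real ^ 'n \<Rightarrow> real"

definition blockspace :: "('a, 'n::finite) problem \<Rightarrow> 'a set \<Rightarrow> (real ^ 'n) set" where
  "blockspace P T = {x. \<forall>c. blk P c \<notin> T \<longrightarrow> x $ c = 0}"

definition restr :: "('a, 'n::finite) problem \<Rightarrow> 'a set \<Rightarrow> real ^ 'n \<Rightarrow> real ^ 'n" where
  "restr P T x = (\<chi> c. if blk P c \<in> T then x $ c else 0)"

text \<open>\<open>Xprod P UNIV\<close> is the feasible set, and \<open>Xprod P (nbr P i)\<close> the product over the neighbours of \<open>i\<close>.\<close>

definition Xprod :: "('a, 'n::finite) problem \<Rightarrow> 'a set \<Rightarrow> (real ^ 'n) set" where
  "Xprod P T = {x \<in> blockspace P T. \<forall>j\<in>T. restr P {j} x \<in> Xset P j}"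

definition F :: "('a::finite, 'n::finite) problem \<Rightarrow> real ^ 'n \<Rightarrow> real" where
  "F P x = (\<Sum>i\<in>UNIV. floc P i (restr P (nbr P i) x))"

definition G :: "('a::finite, 'n::finite) problem \<Rightarrow> real ^ 'n \<Rightarrow> real" where
  "G P x = (\<Sum>i\<in>UNIV. greg P i (restr P {i} x))"

definition V :: "('a::finite, 'n::finite) problem \<Rightarrow> real ^ 'n \<Rightarrow> real" where
  "V P x = F P x + G P x"

definition neighborhoods :: "('a, 'n::finite) problem \<Rightarrow> bool" where
  "neighborhoods P \<longleftrightarrow> (\<forall>i. i \<in> nbr P i) \<and> (\<forall>i j. j \<in> nbr P i \<longleftrightarrow> i \<in> nbr P j)"

definition rho :: "('a::finite, 'n::finite) problem \<Rightarrow> nat" where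
  "rho P = Max (range (\<lambda>i. card (nbr P i)))"

text \<open>
  Partial gradient with respect to the blocks in \<open>T\<close>, at \<open>z\<close>, of a function \<open>h\<close> on some \<open>blockspace P S\<close>
  with \<open>T \<subseteq> S\<close>; it lies in \<open>blockspace P T\<close>. Composing with \<open>restr\<close> means that
  only values of \<open>h\<close> on \<open>blockspace P S\<close> matter.
\<close>

definition pgrad :: "('a, 'n::finite) problem \<Rightarrow> 'a set \<Rightarrow> (real ^ 'n \<Rightarrow> real) \<Rightarrow> real ^ 'n \<Rightarrow> real ^ 'n" where
  "pgrad P T h z = (THE v. GDERIV (\<lambda>u. h (z + restr P T u)) 0 :> v)"

text \<open>Differentiability on a set is differentiability on a (relatively) open set containing it.\<close>

definition C1_on :: "('a, 'n::finite) problem \<Rightarrow> 'a set \<Rightarrow> (real ^ 'n) set \<Rightarrow> (real ^ 'n \<Rightarrow> real) \<Rightarrow> bool" where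
  "C1_on P T S h \<longleftrightarrow>
     (\<exists>U. openin (top_of_set (blockspace P T)) U \<and> S \<subseteq> U \<and> h differentiable_on U) \<and>
     continuous_on S (pgrad P T h)"

definition block_LC1_on ::
  "('a, 'n::finite) problem \<Rightarrow> 'a set \<Rightarrow> (real ^ 'n) set \<Rightarrow> (real ^ 'n \<Rightarrow> real) \<Rightarrow> bool" where
  "block_LC1_on P T S h \<longleftrightarrow>
     C1_on P T S h \<and> (\<forall>j\<in>T. local_lipschitz (UNIV :: real set) S (\<lambda>_. pgrad P {j} h))"

definition stationary :: "('a::finite, 'n::finite) problem \<Rightarrow> (real ^ 'n) set" where
  "stationary P = {x \<in> Xprod P UNIV. \<forall>y\<in>Xprod P UNIV.
     pgrad P UNIV (F P) x \<bullet> (y - x) + G P y - G P x \<ge> 0}"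

definition prox :: "('a::finite, 'n::finite) problem \<Rightarrow> real ^ 'n \<Rightarrow> real ^ 'n" where
  "prox P z = arg_min_on (\<lambda>y. G P y + 1/2 * (norm (y - z))\<^sup>2) (Xprod P UNIV)"

text \<open>
  A real-valued convex function on a closed convex set may jump upwards at the relative boundary, and
  then the minimum defining \<open>prox\<close> need not be attained. That it is attained is what the notation
  presupposes; it is automatic when \<open>G\<close> is lower semicontinuous on the feasible set.
\<close>

definition prox_well_defined :: "('a::finite, 'n::finite) problem \<Rightarrow> bool" where
  "prox_well_defined P \<longleftrightarrow>
     (\<forall>z. \<exists>p. is_arg_min (\<lambda>y. G P y + 1/2 * (norm (y - z))\<^sup>2) (\<lambda>y. y \<in> Xprod P UNIV) p)"

definition residual :: "('a::finite, 'n::finite) problem \<Rightarrow> real ^ 'n \<Rightarrow> real" where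
  "residual P x = norm (x - prox P (x - pgrad P UNIV (F P) x))"

definition level0 :: "('a::finite, 'n::finite) problem \<Rightarrow> real ^ 'n \<Rightarrow> (real ^ 'n) set" where
  "level0 P x0 = {x \<in> Xprod P UNIV. V P x \<le> V P x0}"

definition A2a :: "('a::finite, 'n::finite) problem \<Rightarrow> real ^ 'n \<Rightarrow> bool" where
  "A2a P x0 \<longleftrightarrow> compact (level0 P x0) \<and>
     (\<forall>i. block_LC1_on P (nbr P i) (Xprod P (nbr P i)) (floc P i))"

definition A2b :: "('a::finite, 'n::finite) problem \<Rightarrow> bool" where
  "A2b P \<longleftrightarrow> (\<forall>i. C1_on P (nbr P i) (Xprod P (nbr P i)) (floc P i) \<and>
     (\<forall>j\<in>nbr P i. \<exists>C. C-lipschitz_on (Xprod P (nbr P i)) (pgrad P {j} (floc P i))))"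

text \<open>
  The last conjunct is connectedness of the graph underlying the possibly directed \<open>comm\<close>,
  about which nothing else is required.
\<close>

definition assumption_A :: "('a::finite, 'n::finite) problem \<Rightarrow> real ^ 'n \<Rightarrow> bool" where
  "assumption_A P x0 \<longleftrightarrow>
     (\<forall>i. Xset P i \<subseteq> blockspace P {i} \<and> Xset P i \<noteq> {} \<and> closed (Xset P i) \<and> convex (Xset P i)) \<and>
     (A2a P x0 \<or> A2b P) \<and>
     (\<forall>i. convex_on (Xset P i) (greg P i)) \<and>
     (\<exists>x\<in>Xprod P UNIV. \<forall>y\<in>Xprod P UNIV. V P x \<le> V P y) \<and>
     (\<forall>i j. (i, j) \<in> (comm P \<union> (comm P)\<inverse>)\<^sup>*)"

definition error_bound ::
  "('a::finite, 'n::finite) problem \<Rightarrow> real \<Rightarrow> real \<Rightarrow> real \<Rightarrow> bool" where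
  "error_bound P \<eta> \<epsilon> \<kappa> \<longleftrightarrow> (\<forall>x\<in>Xprod P UNIV.
     V P x \<le> \<eta> \<and> residual P x \<le> \<epsilon> \<longrightarrow> infdist x (stationary P) \<le> \<kappa> * residual P x)"

definition assumption_B :: "('a::finite, 'n::finite) problem \<Rightarrow> bool" where
  "assumption_B P \<longleftrightarrow>
     (\<forall>\<eta> > (INF x\<in>Xprod P UNIV. V P x). \<exists>\<epsilon>>0. \<exists>\<kappa>>0. error_bound P \<eta> \<epsilon> \<kappa>) \<and>
     (\<exists>\<delta>>0. \<forall>x\<in>stationary P. \<forall>y\<in>stationary P. V P x \<noteq> V P y \<longrightarrow> norm (x - y) \<ge> \<delta>)"

definition strongly_convex_on :: "real \<Rightarrow> ('b::real_normed_vector) set \<Rightarrow> ('b \<Rightarrow> real) \<Rightarrow> bool" where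
  "strongly_convex_on \<tau> S h \<longleftrightarrow> convex S \<and>
     (\<forall>x\<in>S. \<forall>y\<in>S. \<forall>u\<ge>0. \<forall>v\<ge>0. u + v = 1 \<longrightarrow>
        h (u *\<^sub>R x + v *\<^sub>R y) \<le> u * h x + v * h y - \<tau> / 2 * u * v * (norm (x - y))\<^sup>2)"

text \<open>\<open>ft i y w\<close> stands for the surrogate \<open>ft\<^sub>i(y; w)\<close> with \<open>y\<close> in block \<open>i\<close> and \<open>w\<close> in the blocks \<open>nbr P i\<close>.\<close>

definition assumption_C :: "('a::finite, 'n::finite) problem \<Rightarrow>
    ('a \<Rightarrow> real ^ 'n \<Rightarrow> real ^ 'n \<Rightarrow> real) \<Rightarrow> real \<Rightarrow> ('a \<Rightarrow> real) \<Rightarrow> bool" where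
  "assumption_C P ft \<tau> Ls \<longleftrightarrow> \<tau> > 0 \<and> (\<forall>i.
     (\<forall>w\<in>Xprod P (nbr P i). C1_on P {i} (Xset P i) (\<lambda>y. ft i y w) \<and>
        strongly_convex_on \<tau> (Xset P i) (\<lambda>y. ft i y w)) \<and>
     (\<forall>y\<in>Xprod P UNIV. pgrad P {i} (\<lambda>v. ft i v (restr P (nbr P i) y)) (restr P {i} y)
        = pgrad P {i} (floc P i) (restr P (nbr P i) y)) \<and>
     (\<forall>y\<in>Xset P i. (Ls i)-lipschitz_on (Xprod P (nbr P i)) (\<lambda>w. pgrad P {i} (\<lambda>v. ft i v w) y)))"

text \<open>In \<open>best_response P ft i W y\<close> the argument \<open>W j\<close> is \<open>w\<close>(j) restricted to \<open>nbr P j\<close>.\<close>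

definition best_response :: "('a::finite, 'n::finite) problem \<Rightarrow>
    ('a \<Rightarrow> real ^ 'n \<Rightarrow> real ^ 'n \<Rightarrow> real) \<Rightarrow> 'a \<Rightarrow> ('a \<Rightarrow> real ^ 'n) \<Rightarrow> real ^ 'n \<Rightarrow> bool" where
  "best_response P ft i W y \<longleftrightarrow>
     is_arg_min (\<lambda>v. ft i v (W i)
         + (\<Sum>j\<in>nbr P i - {i}. pgrad P {i} (floc P j) (W j) \<bullet> (v - restr P {i} (W i)))
         + greg P i v)
       (\<lambda>v. v \<in> Xset P i) y"

text \<open>
  Truncated subtraction on \<open>nat\<close> implements the convention \<open>x\<^sup>t = x\<^sup>0\<close> for \<open>t < 0\<close>.
  \<open>d k i j l\<close> is the delay \<open>d\<^sup>k\<^sub>l(i,j)\<close>.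
\<close>

definition delayed :: "('a::finite, 'n::finite) problem \<Rightarrow> (nat \<Rightarrow> real ^ 'n) \<Rightarrow>
    (nat \<Rightarrow> 'a \<Rightarrow> 'a \<Rightarrow> 'a \<Rightarrow> nat) \<Rightarrow> nat \<Rightarrow> 'a \<Rightarrow> 'a \<Rightarrow> real ^ 'n" where
  "delayed P x d k i j =
     (\<chi> c. if blk P c \<in> nbr P j then x (k - d k i j (blk P c)) $ c else 0)"

text \<open>
  Block \<open>i\<close> of \<open>delayed P x d k i i\<close> is that of \<open>x k\<close>, because \<open>d k i i i = 0\<close>.
\<close>

definition DAsyFLEXA :: "('a::finite, 'n::finite) problem \<Rightarrow>
    ('a \<Rightarrow> real ^ 'n \<Rightarrow> real ^ 'n \<Rightarrow> real) \<Rightarrow> real ^ 'n \<Rightarrow> real \<Rightarrow> (nat \<Rightarrow> 'a) \<Rightarrow>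
    (nat \<Rightarrow> 'a \<Rightarrow> 'a \<Rightarrow> 'a \<Rightarrow> nat) \<Rightarrow> (nat \<Rightarrow> real ^ 'n) \<Rightarrow> bool" where
  "DAsyFLEXA P ft x0 \<gamma> act d x \<longleftrightarrow>
     x0 \<in> Xprod P UNIV \<and> 0 < \<gamma> \<and> \<gamma> \<le> 1 \<and> x 0 = x0 \<and> (\<forall>k i. d k i i i = 0) \<and>
     (\<forall>k. \<exists>y. best_response P ft (act k) (\<lambda>j. delayed P x d k (act k) j) y \<and>
        x (Suc k) = x k + \<gamma> *\<^sub>R (y - restr P {act k} (x k)))"

definition assumption_D :: "('a::finite, 'n::finite) problem \<Rightarrow> nat \<Rightarrow> nat \<Rightarrow> (nat \<Rightarrow> 'a) \<Rightarrow>
    (nat \<Rightarrow> 'a \<Rightarrow> 'a \<Rightarrow> 'a \<Rightarrow> nat) \<Rightarrow> bool" where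
  "assumption_D P B D act d \<longleftrightarrow>
     CARD('a) \<le> B \<and> (\<forall>k. act ` {k..<k + B} = UNIV) \<and>
     D \<le> B \<and> (\<forall>k i. \<forall>j\<in>nbr P i. \<forall>l\<in>nbr P j. d k i j l \<le> D)"

text \<open>\<open>L\<close> is the largest of (some choice of) Lipschitz constants of the partial gradients of \<open>floc P i\<close> on \<open>S i\<close>.\<close>

definition max_lipschitz ::
  "('a::finite, 'n::finite) problem \<Rightarrow> ('a \<Rightarrow> (real ^ 'n) set) \<Rightarrow> real \<Rightarrow> bool" where
  "max_lipschitz P S L \<longleftrightarrow> (\<exists>\<Lambda>.
     (\<forall>i. \<forall>j\<in>nbr P i. (\<Lambda> i j)-lipschitz_on (S i) (pgrad P {j} (floc P i))) \<and>
     L = Max {\<Lambda> i j |i j. j \<in> nbr P i})"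

definition Cube :: "('a, 'n::finite) problem \<Rightarrow> real \<Rightarrow> (real ^ 'n) set" where
  "Cube P U = {w \<in> Xprod P UNIV. infnorm w \<le> U}"

definition psi :: "('a::finite, 'n::finite) problem \<Rightarrow>
    ('a \<Rightarrow> real ^ 'n \<Rightarrow> real ^ 'n \<Rightarrow> real) \<Rightarrow> real \<Rightarrow> real" where
  "psi P ft U = Sup {norm (y - restr P {i} (w i)) |i w y.
     (\<forall>j\<in>nbr P i. w j \<in> Cube P U) \<and> best_response P ft i (\<lambda>j. restr P (nbr P j) (w j)) y}"

definition level0_bar :: "('a::finite, 'n::finite) problem \<Rightarrow>
    ('a \<Rightarrow> real ^ 'n \<Rightarrow> real ^ 'n \<Rightarrow> real) \<Rightarrow> real ^ 'n \<Rightarrow> real \<Rightarrow> (real ^ 'n) set" where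
  "level0_bar P ft x0 U =
     {x + psi P ft U *\<^sub>R b |x b. x \<in> level0 P x0 \<and> b \<in> cball 0 1} \<inter> Xprod P UNIV"

definition L_const :: "('a::finite, 'n::finite) problem \<Rightarrow>
    ('a \<Rightarrow> real ^ 'n \<Rightarrow> real ^ 'n \<Rightarrow> real) \<Rightarrow> real ^ 'n \<Rightarrow> real \<Rightarrow> bool" where
  "L_const P ft x0 L \<longleftrightarrow> L > 0 \<and>
     (A2b P \<and> max_lipschitz P (\<lambda>i. Xprod P (nbr P i)) L \<or>
      A2a P x0 \<and> (\<exists>U. level0 P x0 \<subseteq> Cube P U \<and>
        max_lipschitz P (\<lambda>i. restr P (nbr P i) ` level0_bar P ft x0 U) L))"

context
  fixes N \<rho> B D L Lm \<kappa> \<tau> \<gamma> :: real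
begin

definition rK :: real where
  "rK = \<kappa>\<^sup>2 * (1 + L + N * Lm)\<^sup>2"

definition rC2 :: real where
  "rC2 = 3 * \<gamma>\<^sup>2 * (B + 2 * D - N + 1) * \<rho> * (Lm\<^sup>2 + (\<rho> - 1) * L\<^sup>2) / \<tau>\<^sup>2"

definition beta1 :: real where
  "beta1 = rC2 * (rK * (2 * N + 1) + N * (1 + \<gamma>\<^sup>2)) + rK + 1 + \<gamma>\<^sup>2 * (B - N + 2)"

definition beta2 :: real where
  "beta2 = rC2 * (3 * rK * (2 * N + 1) + N * (3 + \<gamma>\<^sup>2)) + 6 * rK + 3
     + \<gamma>\<^sup>2 / 2 * (3 * B - 3 * N + 5)"

definition beta3 :: real where
  "beta3 = 2 * (L\<^sup>2 + Lm\<^sup>2) * (2 * N * rC2 + D * \<gamma>\<^sup>2 + 1) + 1 / 2"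

definition beta4 :: real where
  "beta4 = 2 * rC2 * (2 * rK * (2 * N + 1) + N * (Lm\<^sup>2 + L\<^sup>2 * (\<rho> - 1))) + 2 * rK
     + (Lm\<^sup>2 + L\<^sup>2 * (\<rho> - 1)) * (1 + D * \<gamma>\<^sup>2) + 2 * \<gamma>\<^sup>2"

definition beta5 :: real where
  "beta5 = (Lm\<^sup>2 + L\<^sup>2 * (\<rho> - 1)) * (2 * N * rC2 + D * \<gamma>\<^sup>2 + 2) + \<gamma>\<^sup>2"

definition alpha1 :: real where
  "alpha1 = (1 - \<gamma>) * (beta3 + (L * \<gamma> * (\<rho>\<^sup>2 * L * D\<^sup>2 * \<gamma> + 1) + 1) / 2)
     + \<rho> * L * beta1 + beta4"

definition alpha2 :: real where
  "alpha2 = (1 - \<gamma>) * (beta3 + (L * \<gamma> * (\<rho>\<^sup>2 * L * D\<^sup>2 * \<gamma> + 1) + 1) / 2)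
     + \<rho> * L * beta2 + beta5"

definition rate :: real where
  "rate = 1 - \<gamma>\<^sup>2 / 2 * ((2 * \<tau> - \<gamma> * L * (B * D * \<rho>\<^sup>2 + 2)) /
     (2 * N * alpha1 + 2 * (B - N) * alpha2
       + \<gamma> * (2 - \<gamma>) * (2 * \<tau> - \<gamma> * L * (B * D * \<rho>\<^sup>2 + 2))))"

end

end

theory Submission
  imports Defs
begin

text \<open>
  For small \<open>\<gamma> / \<tau>\<close> the method is a perturbed block descent method, and the proof is Luo and Tseng's
  argument for such methods: sufficient decrease, an error bound measured by the same displacements,
  and a gap estimate, combined into a contraction.

  Write \<open>m k\<close> for the distance between the active block and its best response at step \<open>k\<close>.
  Strong convexity of the surrogate makes the step decrease \<open>V\<close> by about \<open>\<gamma> * \<tau> * (m k)\<^sup>2\<close>, up to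
  terms of order \<open>\<gamma>\<^sup>2\<close> in the last \<open>D\<close> displacements that stem from stale data. Adding to \<open>V\<close>
  a weighted sum of the squares of these displacements gives a function \<open>\<Phi>\<close> that decreases by
  \<open>\<gamma> * \<tau> / 2 * (m k)\<^sup>2\<close> in every step (\<open>Phi_step\<close>).

  In a window of \<open>B\<close> steps every agent is active, so all blocks are compared with their best
  responses, and the proximal residual is at most a constant times the sum of the displacements
  in the window (\<open>residual_le\<close>). The error bound turns this into a bound on the distance to the
  stationary set. Linearising \<open>F\<close> and using the optimality of the best responses, the gap between \<open>\<Phi>\<close>
  and the value at the nearest stationary point is at most a constant times the squared displacements
  plus \<open>1 / \<gamma>\<close> times the decrease of \<open>\<Phi>\<close> (\<open>gap_le\<close>). By the separation of stationary values, the
  values at the nearest stationary points are eventually all equal to one number \<open>V\<^sup>\<star>\<close>. Since the squared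
  displacements are themselves controlled by the decrease of \<open>\<Phi>\<close>, the quantity \<open>\<Phi> k - V\<^sup>\<star>\<close>
  contracts by \<open>1 / (1 + \<gamma> * \<tau> / C)\<close> over \<open>2 * B\<close> steps, where \<open>C\<close> depends on neither \<open>\<gamma>\<close> nor \<open>\<tau>\<close>
  (\<open>linear_convergence\<close>). Displacements then decay geometrically, so that the iterates converge.

  The asserted rate satisfies \<open>1 - rate \<le> \<gamma>\<^sup>2 * \<tau> / (2 * N * \<rho> * L)\<close>. It carries one more factor
  \<open>\<gamma>\<close> than the contraction just described, so for small \<open>\<gamma>\<close> the contraction is the
  stronger statement (\<open>contraction_le_rate_power\<close>).

  That \<open>\<gamma>\<close> is small follows from \<open>\<gamma> / \<tau>\<close> being small: if the run moves at all, strong convexity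
  and the Lipschitz conditions force \<open>\<tau> \<le> L + Lm\<close> (\<open>tau_le\<close>). A run that never moves starts at
  a stationary point.

  If \<open>L\<close> is only a Lipschitz constant near the initial level set, one has to know that all points at which
  gradients are compared are near that set. This is proved by induction along the descent of \<open>\<Phi>\<close>
  (\<open>stays_in_level0\<close>).
\<close>

section \<open>Blocks\<close>

lemma restr_nth: "restr P T x $ c = (if blk P c \<in> T then x $ c else 0)"
  by (simp add: restr_def)

lemma restr_add: "restr P T (x + y) = restr P T x + restr P T y"
  by (simp add: vec_eq_iff restr_nth)

lemma restr_diff: "restr P T (x - y) = restr P T x - restr P T y"
  by (simp add: vec_eq_iff restr_nth)

lemma restr_scaleR: "restr P T (a *\<^sub>R x) = a *\<^sub>R restr P T x"
  by (simp add: vec_eq_iff restr_nth)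

lemma restr_zero [simp]: "restr P T 0 = 0"
  by (simp add: vec_eq_iff restr_nth)

lemma restr_sum: "restr P T (sum f S) = (\<Sum>s\<in>S. restr P T (f s))"
  by (simp add: vec_eq_iff restr_nth)

lemma restr_restr: "restr P S (restr P T x) = restr P (S \<inter> T) x"
  by (simp add: vec_eq_iff restr_nth)

lemma restr_restr_subset: "S \<subseteq> T \<Longrightarrow> restr P S (restr P T x) = restr P S x"
  by (simp add: restr_restr Int_absorb2)

lemma restr_empty [simp]: "restr P {} x = 0"
  by (simp add: vec_eq_iff restr_nth)

lemma restr_UNIV [simp]: "restr P UNIV x = x"
  by (simp add: vec_eq_iff restr_nth)

lemma norm_restr_le: "norm (restr P T x) \<le> norm x"
  by (rule norm_le_componentwise_cart) (simp add: restr_nth)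

lemma bounded_linear_restr: "bounded_linear (restr P T)"
  by (rule bounded_linear_intro[where K = 1]) (simp_all add: restr_add restr_scaleR norm_restr_le)

lemma inner_restr_left: "restr P T x \<bullet> y = x \<bullet> restr P T y"
  by (auto simp: inner_vec_def restr_nth intro!: sum.cong)

lemma inner_restr_both: "restr P T x \<bullet> restr P T y = restr P T x \<bullet> y"
  by (metis inner_restr_left order_refl restr_restr_subset)

lemma sum_restr_singletons: "(\<Sum>i\<in>UNIV. restr P {i::'a::finite} x) = x"
  by (auto simp: vec_eq_iff restr_nth sum.delta)

lemma sum_inner_restr: "(\<Sum>i\<in>UNIV. restr P {i::'a::finite} x \<bullet> restr P {i} y) = x \<bullet> y"
  by (simp add: inner_restr_both flip: inner_sum_left) (simp add: sum_restr_singletons)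

lemma norm_le_sum_restr: "norm x \<le> (\<Sum>i\<in>UNIV. norm (restr P {i::'a::finite} x))"
  using norm_sum[of "\<lambda>i. restr P {i} x" UNIV] by (simp add: sum_restr_singletons)

lemma mem_blockspace_iff: "x \<in> blockspace P T \<longleftrightarrow> restr P T x = x"
  by (auto simp: blockspace_def vec_eq_iff restr_nth)

lemma restr_mem_blockspace: "restr P T x \<in> blockspace P T"
  by (simp add: mem_blockspace_iff restr_restr)

lemma blockspace_add: "x \<in> blockspace P T \<Longrightarrow> y \<in> blockspace P T \<Longrightarrow> x + y \<in> blockspace P T"
  by (simp add: mem_blockspace_iff restr_add)

lemma restr_singleton_blockspace:
  assumes "y \<in> blockspace P {i}"
  shows "restr P T y = (if i \<in> T then y else 0)"
  using assms by (auto simp: blockspace_def vec_eq_iff restr_nth)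

lemma Xprod_subset_blockspace: "Xprod P T \<subseteq> blockspace P T"
  by (auto simp: Xprod_def)

lemma restr_Xprod: "x \<in> Xprod P T \<Longrightarrow> S \<subseteq> T \<Longrightarrow> restr P S x \<in> Xprod P S"
  by (auto simp: Xprod_def restr_mem_blockspace restr_restr_subset)


section \<open>Partial gradients\<close>

lemma has_derivative_imp_GDERIV:
  fixes h :: "'b::euclidean_space \<Rightarrow> real"
  assumes "(h has_derivative h') (at z)"
  shows "GDERIV h z :> adjoint h' 1"
proof -
  have "linear h'"
    using assms has_derivative_linear by blast
  then have "h' = (\<lambda>u. u \<bullet> adjoint h' 1)"
    by (simp add: adjoint_works)
  then show ?thesis
    using assms by (simp add: gderiv_def)
qed

lemma GDERIV_unique:
  assumes "GDERIV h z :> v" "GDERIV h z :> w"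
  shows "v = w"
proof -
  have "(\<lambda>u. u \<bullet> v) = (\<lambda>u. u \<bullet> w)"
    using assms has_derivative_unique unfolding gderiv_def by blast
  then have "(v - w) \<bullet> v = (v - w) \<bullet> w"
    by metis
  then have "(v - w) \<bullet> (v - w) = 0"
    by (simp add: inner_diff_right)
  then show ?thesis
    by simp
qed

lemma pgrad_eqI: "GDERIV (\<lambda>u. h (z + restr P T u)) 0 :> v \<Longrightarrow> pgrad P T h z = v"
  unfolding pgrad_def by (rule the_equality) (auto intro: GDERIV_unique)

lemma GDERIV_sum:
  assumes "\<And>i. i \<in> I \<Longrightarrow> GDERIV (f i) z :> v i"
  shows "GDERIV (\<lambda>u. \<Sum>i\<in>I. f i u) z :> (\<Sum>i\<in>I. v i)"
  using assms unfolding gderiv_def inner_sum_right by (rule has_derivative_sum)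

text \<open>
  A point of \<open>blockspace P T\<close> moved by \<open>restr P T u\<close> stays in that subspace, so differentiability
  relative to the subspace is differentiability of the composed map in the ordinary sense.
\<close>

lemma C1_on_GDERIV:
  assumes h: "C1_on P T S h" and z: "z \<in> S" and S: "S \<subseteq> blockspace P T"
  shows "GDERIV (\<lambda>u. h (z + restr P T u)) 0 :> pgrad P T h z"
proof -
  obtain U where U: "openin (top_of_set (blockspace P T)) U" "S \<subseteq> U" "h differentiable_on U"
    using h by (auto simp: C1_on_def)
  obtain W where W: "open W" "U = blockspace P T \<inter> W"
    using U(1) by (auto simp: openin_open)
  have zU: "z \<in> U" "z \<in> W"
    using z U W by auto
  obtain h' where h': "(h has_derivative h') (at z within U)"
    using U(3) zU unfolding differentiable_on_def differentiable_def by blast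
  define N where "N = {u. z + restr P T u \<in> W}"
  have "continuous_on UNIV (\<lambda>u. z + restr P T u)"
    by (intro continuous_intros linear_continuous_on bounded_linear_restr)
  then have N: "open N" "0 \<in> N"
    unfolding N_def using W(1) zU by (auto simp: continuous_on_open_vimage vimage_def)
  have r: "((\<lambda>u. z + restr P T u) has_derivative restr P T) (at 0 within N)"
    using has_derivative_add[OF has_derivative_const[of z "at 0 within N"]
        bounded_linear_imp_has_derivative[OF bounded_linear_restr, of P T "at 0 within N"]]
    by (simp only: add_0_left)
  have im: "(\<lambda>u. z + restr P T u) ` N \<subseteq> U"
    using z S W by (auto simp: N_def intro!: blockspace_add restr_mem_blockspace)
  have "(h has_derivative h') (at (z + restr P T 0) within (\<lambda>u. z + restr P T u) ` N)"
    using has_derivative_subset[OF h' im] by simp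
  from has_derivative_in_compose[OF r this]
  have "((\<lambda>u. h (z + restr P T u)) has_derivative (\<lambda>u. h' (restr P T u))) (at 0)"
    by (simp only: at_within_open[OF N(2) N(1)])
  note g = has_derivative_imp_GDERIV[OF this]
  show ?thesis
    using g pgrad_eqI[OF g] by simp
qed

lemma GDERIV_restr:
  assumes "GDERIV h 0 :> v"
  shows "GDERIV (\<lambda>u. h (restr P T u)) 0 :> restr P T v"
proof -
  have r: "(restr P T has_derivative restr P T) (at 0)"
    by (rule bounded_linear_imp_has_derivative[OF bounded_linear_restr])
  have "(h has_derivative (\<lambda>u. u \<bullet> v)) (at (restr P T 0))"
    using assms by (simp add: gderiv_def)
  from has_derivative_compose[OF r this] show ?thesis
    by (simp add: gderiv_def inner_restr_left)
qed

lemma pgrad_mem_blockspace: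
  assumes "GDERIV (\<lambda>u. h (z + restr P T u)) 0 :> pgrad P T h z"
  shows "restr P T (pgrad P T h z) = pgrad P T h z"
  using GDERIV_restr[OF assms, of P T] assms by (simp add: restr_restr GDERIV_unique)

lemma pgrad_subset:
  assumes "GDERIV (\<lambda>u. h (z + restr P T u)) 0 :> pgrad P T h z" and "S \<subseteq> T"
  shows "pgrad P S h z = restr P S (pgrad P T h z)"
  using GDERIV_restr[OF assms(1), of P S] assms(2)
  by (intro pgrad_eqI) (simp add: restr_restr Int_absorb1)

lemma pgrad_line_derivative:
  assumes "GDERIV (\<lambda>u. h (z + t *\<^sub>R v + restr P T u)) 0 :> p" and v: "restr P T v = v"
  shows "((\<lambda>s. h (z + s *\<^sub>R v)) has_real_derivative p \<bullet> v) (at t)"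
proof -
  have lin: "((\<lambda>s. (s - t) *\<^sub>R v) has_derivative (\<lambda>s. s *\<^sub>R v)) (at t)"
    by (auto intro!: derivative_eq_intros)
  have "((\<lambda>u. h (z + t *\<^sub>R v + restr P T u)) has_derivative (\<lambda>u. u \<bullet> p)) (at ((t - t) *\<^sub>R v))"
    using assms(1) by (simp add: gderiv_def)
  from has_derivative_compose[OF lin this]
  have "((\<lambda>s. h (z + t *\<^sub>R v + restr P T ((s - t) *\<^sub>R v))) has_derivative (\<lambda>s. (s *\<^sub>R v) \<bullet> p)) (at t)" .
  moreover have "z + t *\<^sub>R v + restr P T ((s - t) *\<^sub>R v) = z + s *\<^sub>R v" for s
    by (simp only: restr_scaleR v) (simp add: scaleR_diff_left)
  ultimately show ?thesis
    by (simp add: has_field_derivative_def inner_commute mult.commute mult_commute_abs)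
qed


section \<open>First-order conditions for convex composite minimisation\<close>

text \<open>
  Comparing a minimiser with points slightly moved towards \<open>v\<close> and letting the step tend to zero
  turns minimality of \<open>h + g\<close> into a variational inequality; convexity replaces a derivative of \<open>g\<close>.
\<close>

lemma minimizer_variational_inequality:
  fixes h g :: "'b::real_vector \<Rightarrow> real"
  assumes cvx: "convex_on S g" and y: "y \<in> S" and v: "v \<in> S"
    and min: "\<And>u. u \<in> S \<Longrightarrow> h y + g y \<le> h u + g u"
    and deriv: "((\<lambda>t. h (y + t *\<^sub>R (v - y))) has_real_derivative m) (at 0)"
  shows "m + g v - g y \<ge> 0"
proof -
  let ?q = "\<lambda>t. (h (y + t *\<^sub>R (v - y)) - h y) / t"
  have "((\<lambda>t. ?q t) \<longlongrightarrow> m) (at 0)"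
    using deriv by (simp add: has_field_derivative_iff)
  then have lim: "(?q \<longlongrightarrow> m) (at_right 0)"
    by (rule filterlim_mono) (auto simp: at_le)
  have "eventually (\<lambda>t. 0 < t \<and> t < (1::real)) (at_right 0)"
    by (auto simp: eventually_at intro!: exI[of _ 1])
  then have "eventually (\<lambda>t. g y - g v \<le> ?q t) (at_right 0)"
  proof eventually_elim
    fix t :: real assume t: "0 < t \<and> t < 1"
    have eq: "y + t *\<^sub>R (v - y) = (1 - t) *\<^sub>R y + t *\<^sub>R v"
      by (simp add: algebra_simps)
    have "convex S"
      using cvx by (simp add: convex_on_def)
    then have "y + t *\<^sub>R (v - y) \<in> S"
      unfolding eq using y v t by (intro convexD) auto
    then have "h y + g y \<le> h (y + t *\<^sub>R (v - y)) + g (y + t *\<^sub>R (v - y))"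
      by (rule min)
    moreover have "g (y + t *\<^sub>R (v - y)) \<le> (1 - t) * g y + t * g v"
      unfolding eq using convex_onD[OF cvx, of t y v] t y v by simp
    ultimately have "t * (g y - g v) \<le> h (y + t *\<^sub>R (v - y)) - h y"
      by (simp add: algebra_simps)
    then show "g y - g v \<le> ?q t"
      using t by (simp add: field_simps)
  qed
  then have "g y - g v \<le> m"
    using lim by (intro tendsto_lowerbound[OF lim]) auto
  then show ?thesis
    by simp
qed

lemma strongly_convex_gradient_inequality:
  fixes h :: "'b::real_normed_vector \<Rightarrow> real"
  assumes sc: "strongly_convex_on \<tau> S h" and y: "y \<in> S" and v: "v \<in> S"
    and deriv: "((\<lambda>t. h (y + t *\<^sub>R (v - y))) has_real_derivative m) (at 0)"
  shows "h v \<ge> h y + m + \<tau> / 2 * (norm (v - y))\<^sup>2"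
proof -
  let ?q = "\<lambda>t. (h (y + t *\<^sub>R (v - y)) - h y) / t"
  have "((\<lambda>t. ?q t) \<longlongrightarrow> m) (at 0)"
    using deriv by (simp add: has_field_derivative_iff)
  then have "(?q \<longlongrightarrow> m) (at_right 0)"
    by (rule filterlim_mono) (auto simp: at_le)
  then have lim: "((\<lambda>t. ?q t + \<tau> / 2 * (1 - t) * (norm (v - y))\<^sup>2) \<longlongrightarrow> m + \<tau> / 2 * (1 - 0) * (norm (v - y))\<^sup>2) (at_right 0)"
    by (intro tendsto_intros)
  have "eventually (\<lambda>t. 0 < t \<and> t < (1::real)) (at_right 0)"
    by (auto simp: eventually_at intro!: exI[of _ 1])
  then have "eventually (\<lambda>t. ?q t + \<tau> / 2 * (1 - t) * (norm (v - y))\<^sup>2 \<le> h v - h y) (at_right 0)"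
  proof eventually_elim
    fix t :: real assume t: "0 < t \<and> t < 1"
    have eq: "y + t *\<^sub>R (v - y) = (1 - t) *\<^sub>R y + t *\<^sub>R v"
      by (simp add: algebra_simps)
    have "h (y + t *\<^sub>R (v - y)) \<le> (1 - t) * h y + t * h v - \<tau> / 2 * (1 - t) * t * (norm (y - v))\<^sup>2"
      unfolding eq using sc y v t by (auto simp: strongly_convex_on_def)
    then have "h (y + t *\<^sub>R (v - y)) - h y \<le> t * (h v - h y - \<tau> / 2 * (1 - t) * (norm (v - y))\<^sup>2)"
      by (simp add: algebra_simps norm_minus_commute)
    then have "?q t \<le> h v - h y - \<tau> / 2 * (1 - t) * (norm (v - y))\<^sup>2"
      using t by (simp add: pos_divide_le_eq mult.commute)
    then show "?q t + \<tau> / 2 * (1 - t) * (norm (v - y))\<^sup>2 \<le> h v - h y"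
      by simp
  qed
  then have "m + \<tau> / 2 * (1 - 0) * (norm (v - y))\<^sup>2 \<le> h v - h y"
    by (intro tendsto_upperbound[OF lim]) auto
  then show ?thesis
    by simp
qed


section \<open>The composite problem\<close>

locale composite_problem =
  fixes P :: "('a::finite, 'n::finite) problem"
  assumes nbhds: "neighborhoods P"
    and Xset_blockspace: "Xset P i \<subseteq> blockspace P {i}"
    and Xset_nonempty: "Xset P i \<noteq> {}"
    and Xset_closed: "closed (Xset P i)"
    and Xset_convex: "convex (Xset P i)"
    and greg_convex: "convex_on (Xset P i) (greg P i)"
    and floc_C1: "C1_on P (nbr P i) (Xprod P (nbr P i)) (floc P i)"
    and prox_wd: "prox_well_defined P"
begin

abbreviation "X \<equiv> Xprod P UNIV"

definition gradF :: "real ^ 'n \<Rightarrow> real ^ 'n" where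
  "gradF x = (\<Sum>i\<in>UNIV. pgrad P (nbr P i) (floc P i) (restr P (nbr P i) x))"

lemma nbr_refl [simp]: "i \<in> nbr P i"
  using nbhds by (simp add: neighborhoods_def)

lemma nbr_sym: "j \<in> nbr P i \<longleftrightarrow> i \<in> nbr P j"
  using nbhds by (auto simp: neighborhoods_def)

lemma card_nbr_le: "card (nbr P i) \<le> rho P"
  unfolding rho_def by (rule Max_ge) auto

lemma rho_ge_1: "1 \<le> rho P"
proof -
  have "card {undefined::'a} \<le> card (nbr P undefined)"
    by (rule card_mono) auto
  then show ?thesis
    using card_nbr_le[of undefined] by simp
qed

lemma mem_X_iff: "x \<in> X \<longleftrightarrow> (\<forall>i. restr P {i} x \<in> Xset P i)"
  by (simp add: Xprod_def mem_blockspace_iff)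

lemma restr_block_mem: "x \<in> X \<Longrightarrow> restr P {i} x \<in> Xset P i"
  by (simp add: mem_X_iff)

lemma restr_nbr_mem: "x \<in> X \<Longrightarrow> restr P (nbr P i) x \<in> Xprod P (nbr P i)"
  by (rule restr_Xprod) auto

lemma convex_X: "convex X"
  unfolding convex_def
  by (auto simp: mem_X_iff[of "_ + _"] restr_add restr_scaleR
      intro!: convexD[OF Xset_convex] restr_block_mem)

lemma closed_X: "closed X"
proof -
  have "X = (\<Inter>i. restr P {i} -` Xset P i)"
    by (auto simp: mem_X_iff)
  moreover have "closed (restr P {i} -` Xset P i)" for i
    by (intro continuous_closed_vimage Xset_closed linear_continuous_at bounded_linear_restr)
  ultimately show ?thesis
    by (simp add: closed_INT)
qed

lemma segment_mem_X:
  assumes "x \<in> X" "y \<in> X" "0 \<le> t" "t \<le> 1"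
  shows "x + t *\<^sub>R (y - x) \<in> X"
proof -
  have "x + t *\<^sub>R (y - x) = (1 - t) *\<^sub>R x + t *\<^sub>R y"
    by (simp add: algebra_simps)
  then show ?thesis
    using convexD[OF convex_X] assms by simp
qed

lemma restr_Xset: "y \<in> Xset P i \<Longrightarrow> restr P T y = (if i \<in> T then y else 0)"
  by (rule restr_singleton_blockspace[OF subsetD[OF Xset_blockspace]])

lemma restr_replace_block:
  assumes "y \<in> Xset P i"
  shows "restr P {j} (x + (y - restr P {i} x)) = (if j = i then y else restr P {j} x)"
  using assms by (auto simp: restr_add restr_diff restr_restr restr_Xset)

lemma replace_block_mem_X:
  assumes "x \<in> X" "y \<in> Xset P i"
  shows "x + (y - restr P {i} x) \<in> X"
  unfolding mem_X_iff restr_replace_block[OF assms(2)] using assms by (auto simp: mem_X_iff)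

lemma G_replace_block:
  assumes "y \<in> Xset P i"
  shows "G P (x + (y - restr P {i} x)) = G P x + greg P i y - greg P i (restr P {i} x)"
proof -
  have "G P z = greg P i (restr P {i} z) + (\<Sum>j\<in>UNIV - {i}. greg P j (restr P {j} z))" for z
    unfolding G_def by (subst sum.remove[of _ i]) auto
  from this[of x] this[of "x + (y - restr P {i} x)"] show ?thesis
    by (simp add: restr_replace_block[OF assms] restr_replace_block[OF assms, of i])
qed

lemma G_convex: "convex_on X (G P)"
proof (rule convex_onI)
  fix t :: real and x y assume t: "0 < t" "t < 1" and xy: "x \<in> X" "y \<in> X"
  have "greg P i (restr P {i} ((1 - t) *\<^sub>R x + t *\<^sub>R y))
      \<le> (1 - t) * greg P i (restr P {i} x) + t * greg P i (restr P {i} y)" for i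
    unfolding restr_add restr_scaleR
    using t xy by (intro convex_onD[OF greg_convex]) (auto intro: restr_block_mem)
  then show "G P ((1 - t) *\<^sub>R x + t *\<^sub>R y) \<le> (1 - t) * G P x + t * G P y"
    unfolding G_def sum_distrib_left sum.distrib[symmetric] by (intro sum_mono) auto
qed (rule convex_X)


subsection \<open>The gradient of the smooth part\<close>

lemma floc_GDERIV:
  assumes "z \<in> Xprod P (nbr P i)"
  shows "GDERIV (\<lambda>u. floc P i (z + restr P (nbr P i) u)) 0 :> pgrad P (nbr P i) (floc P i) z"
  by (rule C1_on_GDERIV[OF floc_C1 assms Xprod_subset_blockspace])

lemma floc_pgrad_block:
  assumes "z \<in> Xprod P (nbr P i)" "j \<in> nbr P i"
  shows "pgrad P {j} (floc P i) z = restr P {j} (pgrad P (nbr P i) (floc P i) z)"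
  using assms by (intro pgrad_subset floc_GDERIV) auto

lemma F_GDERIV:
  assumes "x \<in> X"
  shows "GDERIV (\<lambda>u. F P (x + u)) 0 :> gradF x"
  unfolding F_def gradF_def restr_add
  by (intro GDERIV_sum floc_GDERIV restr_nbr_mem assms)

lemma pgrad_F: "x \<in> X \<Longrightarrow> pgrad P UNIV (F P) x = gradF x"
  by (rule pgrad_eqI) (simp add: F_GDERIV)

lemma restr_gradF:
  assumes "x \<in> X"
  shows "restr P {i} (gradF x) = (\<Sum>j\<in>nbr P i. pgrad P {i} (floc P j) (restr P (nbr P j) x))"
proof -
  let ?p = "\<lambda>j. pgrad P (nbr P j) (floc P j) (restr P (nbr P j) x)"
  have p: "restr P (nbr P j) (?p j) = ?p j" for j
    by (intro pgrad_mem_blockspace floc_GDERIV restr_nbr_mem assms)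
  have "restr P {i} (?p j) = (if j \<in> nbr P i then pgrad P {i} (floc P j) (restr P (nbr P j) x) else 0)" for j
  proof (cases "j \<in> nbr P i")
    case True
    then show ?thesis
      using floc_pgrad_block[OF restr_nbr_mem[OF assms], of i j] nbr_sym[of j i] by simp
  next
    case False
    then have "{i} \<inter> nbr P j = {}"
      using nbr_sym by auto
    then have "restr P {i} (restr P (nbr P j) (?p j)) = 0"
      by (simp only: restr_restr restr_empty)
    then show ?thesis
      using False p by simp
  qed
  then show ?thesis
    unfolding gradF_def restr_sum by (simp add: sum.If_cases)
qed

lemma F_line_derivative:
  assumes "x + t *\<^sub>R d \<in> X"
  shows "((\<lambda>s. F P (x + s *\<^sub>R d)) has_real_derivative gradF (x + t *\<^sub>R d) \<bullet> d) (at t)"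
  by (rule pgrad_line_derivative[where T = UNIV]) (simp_all add: F_GDERIV assms)

lemma F_mean_value:
  assumes "\<And>t. 0 \<le> t \<Longrightarrow> t \<le> 1 \<Longrightarrow> x + t *\<^sub>R d \<in> X"
  shows "\<exists>t. 0 < t \<and> t < 1 \<and> F P (x + d) - F P x = gradF (x + t *\<^sub>R d) \<bullet> d"
proof -
  have "\<exists>t>0. t < 1 \<and> F P (x + 1 *\<^sub>R d) - F P (x + 0 *\<^sub>R d) = (1 - 0) * (gradF (x + t *\<^sub>R d) \<bullet> d)"
    using MVT2[of 0 1 "\<lambda>s. F P (x + s *\<^sub>R d)" "\<lambda>t. gradF (x + t *\<^sub>R d) \<bullet> d"]
    by (auto intro!: F_line_derivative assms)
  then show ?thesis
    by auto
qed

lemma continuous_on_gradF: "continuous_on X gradF"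
proof -
  have "continuous_on X (\<lambda>x. pgrad P (nbr P i) (floc P i) (restr P (nbr P i) x))" for i
  proof -
    have "continuous_on (Xprod P (nbr P i)) (pgrad P (nbr P i) (floc P i))"
      using floc_C1 by (simp add: C1_on_def)
    moreover have "continuous_on X (restr P (nbr P i))"
      by (intro linear_continuous_on bounded_linear_restr)
    ultimately show ?thesis
      by (rule continuous_on_compose2) (auto intro: restr_nbr_mem)
  qed
  then show ?thesis
    unfolding gradF_def by (intro continuous_on_sum) auto
qed

text \<open>
  Lipschitz continuity is only available on a region \<open>S\<close>: the whole feasible set if the gradients are
  globally Lipschitz, and a neighbourhood of the initial level set otherwise.
\<close>

definition block_lipschitz :: "(real ^ 'n) set \<Rightarrow> real \<Rightarrow> bool" where
  "block_lipschitz S L \<longleftrightarrow> 0 \<le> L \<and> S \<subseteq> X \<and> (\<forall>i. \<forall>j\<in>nbr P i. \<forall>u\<in>S. \<forall>v\<in>S.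
     norm (pgrad P {j} (floc P i) (restr P (nbr P i) u) - pgrad P {j} (floc P i) (restr P (nbr P i) v))
       \<le> L * norm (u - v))"

lemma restr_gradF_lipschitz:
  assumes S: "block_lipschitz S L" and uv: "u \<in> S" "v \<in> S"
  shows "norm (restr P {i} (gradF u) - restr P {i} (gradF v)) \<le> real (rho P) * L * norm (u - v)"
proof -
  have X: "u \<in> X" "v \<in> X" and L: "0 \<le> L"
    using S uv by (auto simp: block_lipschitz_def)
  have "norm (restr P {i} (gradF u) - restr P {i} (gradF v)) \<le> (\<Sum>j\<in>nbr P i. L * norm (u - v))"
    unfolding restr_gradF[OF X(1)] restr_gradF[OF X(2)] sum_subtractf[symmetric]
    using S uv nbr_sym[of _ i] by (intro sum_norm_le) (auto simp: block_lipschitz_def)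
  also have "\<dots> = real (card (nbr P i)) * (L * norm (u - v))"
    by simp
  also have "\<dots> \<le> real (rho P) * (L * norm (u - v))"
    using L card_nbr_le by (intro mult_right_mono) auto
  finally show ?thesis
    by (simp add: mult.assoc)
qed

lemma gradF_lipschitz:
  assumes S: "block_lipschitz S L" and uv: "u \<in> S" "v \<in> S"
  shows "norm (gradF u - gradF v) \<le> CARD('a) * (real (rho P) * L) * norm (u - v)"
proof -
  have "norm (gradF u - gradF v) \<le> (\<Sum>i\<in>UNIV. norm (restr P {i} (gradF u - gradF v)))"
    by (rule norm_le_sum_restr)
  also have "\<dots> \<le> (\<Sum>i\<in>(UNIV::'a set). real (rho P) * L * norm (u - v))"
    unfolding restr_diff using assms by (intro sum_mono restr_gradF_lipschitz)
  finally show ?thesis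
    by simp
qed

text \<open>
  The mean value theorem in place of an integral along the segment loses the usual factor \<open>1 / 2\<close>,
  which the later estimates can afford.
\<close>

lemma F_linearization_error:
  assumes S: "block_lipschitz S L" and seg: "\<And>t. 0 \<le> t \<Longrightarrow> t \<le> 1 \<Longrightarrow> x + t *\<^sub>R d \<in> S"
  shows "\<bar>F P (x + d) - F P x - gradF x \<bullet> d\<bar> \<le> CARD('a) * (real (rho P) * L) * (norm d)\<^sup>2"
proof -
  have SX: "S \<subseteq> X" and L: "0 \<le> L"
    using S by (auto simp: block_lipschitz_def)
  obtain t where t: "0 < t" "t < 1" "F P (x + d) - F P x = gradF (x + t *\<^sub>R d) \<bullet> d"
    using F_mean_value[of x d] seg SX by blast
  have mem: "x \<in> S" "x + t *\<^sub>R d \<in> S"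
    using seg[of 0] seg[of t] t by auto
  have "\<bar>F P (x + d) - F P x - gradF x \<bullet> d\<bar> = \<bar>(gradF (x + t *\<^sub>R d) - gradF x) \<bullet> d\<bar>"
    using t by (simp add: inner_diff_left)
  also have "\<dots> \<le> norm (gradF (x + t *\<^sub>R d) - gradF x) * norm d"
    by (rule Cauchy_Schwarz_ineq2)
  also have "\<dots> \<le> CARD('a) * (real (rho P) * L) * norm (t *\<^sub>R d) * norm d"
    using gradF_lipschitz[OF S mem(2) mem(1)] by (intro mult_right_mono) auto
  also have "\<dots> \<le> CARD('a) * (real (rho P) * L) * norm d * norm d"
    using t L by (intro mult_right_mono mult_left_mono) (auto simp: mult_left_le_one_le)
  finally show ?thesis
    by (simp add: power2_eq_square mult.assoc)
qed

text \<open>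
  A move within one block only sees that block of the gradient, whose Lipschitz constant counts
  neighbours instead of all agents.
\<close>

lemma F_block_upper_bound:
  assumes S: "block_lipschitz S L" and seg: "\<And>t. 0 \<le> t \<Longrightarrow> t \<le> 1 \<Longrightarrow> x + t *\<^sub>R d \<in> S"
    and d: "restr P {i} d = d"
  shows "F P (x + d) \<le> F P x + gradF x \<bullet> d + real (rho P) * L * (norm d)\<^sup>2"
proof -
  have SX: "S \<subseteq> X" and L: "0 \<le> L"
    using S by (auto simp: block_lipschitz_def)
  obtain t where t: "0 < t" "t < 1" "F P (x + d) - F P x = gradF (x + t *\<^sub>R d) \<bullet> d"
    using F_mean_value[of x d] seg SX by blast
  have mem: "x \<in> S" "x + t *\<^sub>R d \<in> S"
    using seg[of 0] seg[of t] t by auto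
  have "F P (x + d) - F P x - gradF x \<bullet> d = (gradF (x + t *\<^sub>R d) - gradF x) \<bullet> restr P {i} d"
    using t d by (simp add: inner_diff_left)
  also have "\<dots> = (restr P {i} (gradF (x + t *\<^sub>R d)) - restr P {i} (gradF x)) \<bullet> d"
    by (simp add: inner_restr_left flip: restr_diff)
  also have "\<dots> \<le> norm (restr P {i} (gradF (x + t *\<^sub>R d)) - restr P {i} (gradF x)) * norm d"
    by (rule norm_cauchy_schwarz)
  also have "\<dots> \<le> real (rho P) * L * norm (t *\<^sub>R d) * norm d"
    using restr_gradF_lipschitz[OF S mem(2) mem(1), of i] by (intro mult_right_mono) auto
  also have "\<dots> \<le> real (rho P) * L * norm d * norm d"
    using t L by (intro mult_right_mono mult_left_mono) (auto simp: mult_left_le_one_le)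
  finally show ?thesis
    by (simp add: power2_eq_square mult.assoc)
qed


subsection \<open>Proximal points and stationary points\<close>

lemma prox_minimizes:
  "prox P z \<in> X"
  "y \<in> X \<Longrightarrow> G P (prox P z) + 1/2 * (norm (prox P z - z))\<^sup>2 \<le> G P y + 1/2 * (norm (y - z))\<^sup>2"
proof -
  obtain p where p: "is_arg_min (\<lambda>y. G P y + 1/2 * (norm (y - z))\<^sup>2) (\<lambda>y. y \<in> X) p"
    using prox_wd unfolding prox_well_defined_def by blast
  then have "is_arg_min (\<lambda>y. G P y + 1/2 * (norm (y - z))\<^sup>2) (\<lambda>y. y \<in> X) (prox P z)"
    unfolding prox_def arg_min_on_def arg_min_def by (rule someI)
  then show "prox P z \<in> X"
    "y \<in> X \<Longrightarrow> G P (prox P z) + 1/2 * (norm (prox P z - z))\<^sup>2 \<le> G P y + 1/2 * (norm (y - z))\<^sup>2"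
    unfolding is_arg_min_linorder by auto
qed

lemma prox_variational_inequality:
  assumes "v \<in> X"
  shows "(prox P z - z) \<bullet> (v - prox P z) + G P v - G P (prox P z) \<ge> 0"
proof (rule minimizer_variational_inequality[OF G_convex])
  let ?p = "prox P z"
  have eq: "1/2 * (norm (?p + t *\<^sub>R (v - ?p) - z))\<^sup>2
      = 1/2 * (norm (?p - z))\<^sup>2 + t * ((?p - z) \<bullet> (v - ?p)) + t\<^sup>2 * (1/2 * (norm (v - ?p))\<^sup>2)" for t
  proof -
    have "?p + t *\<^sub>R (v - ?p) - z = (?p - z) + t *\<^sub>R (v - ?p)"
      by simp
    then show ?thesis
      unfolding power2_norm_eq_inner
      by (simp only: inner_simps) (simp add: inner_commute power2_eq_square algebra_simps)
  qed
  show "((\<lambda>t. 1/2 * (norm (?p + t *\<^sub>R (v - ?p) - z))\<^sup>2) has_real_derivative (?p - z) \<bullet> (v - ?p)) (at 0)"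
    unfolding eq by (auto intro!: derivative_eq_intros)
qed (use prox_minimizes assms in \<open>auto simp: add.commute\<close>)

text \<open>Varying a single block shows that the proximal map separates over the agents.\<close>

lemma prox_block_variational_inequality:
  assumes "y \<in> Xset P i"
  shows "(restr P {i} (prox P z) - restr P {i} z) \<bullet> (y - restr P {i} (prox P z))
    + greg P i y - greg P i (restr P {i} (prox P z)) \<ge> 0"
proof -
  let ?p = "prox P z"
  have "restr P {i} (y - restr P {i} ?p) = y - restr P {i} ?p"
    by (simp add: restr_diff restr_restr restr_Xset[OF assms])
  then have "(?p - z) \<bullet> (y - restr P {i} ?p) = restr P {i} (?p - z) \<bullet> (y - restr P {i} ?p)"
    by (simp only: inner_restr_left)
  then show ?thesis
    using prox_variational_inequality[OF replace_block_mem_X[OF prox_minimizes(1) assms], of z z]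
      G_replace_block[OF assms, of ?p] by (simp add: restr_diff)
qed

lemma stationaryI:
  assumes "x \<in> X" "\<And>y. y \<in> X \<Longrightarrow> gradF x \<bullet> (y - x) + G P y - G P x \<ge> 0"
  shows "x \<in> stationary P"
  using assms by (simp add: stationary_def pgrad_F)

lemma stationaryD:
  assumes "x \<in> stationary P"
  shows "x \<in> X" "y \<in> X \<Longrightarrow> gradF x \<bullet> (y - x) + G P y - G P x \<ge> 0"
  using assms by (auto simp: stationary_def pgrad_F)

lemma minimizer_stationary:
  assumes "x \<in> X" "\<And>y. y \<in> X \<Longrightarrow> V P x \<le> V P y"
  shows "x \<in> stationary P"
proof (rule stationaryI)
  fix y assume y: "y \<in> X"
  have "((\<lambda>t. F P (x + t *\<^sub>R (y - x))) has_real_derivative gradF x \<bullet> (y - x)) (at 0)"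
    using F_line_derivative[of x 0 "y - x"] assms(1) by simp
  then show "gradF x \<bullet> (y - x) + G P y - G P x \<ge> 0"
    using assms y by (intro minimizer_variational_inequality[OF G_convex]) (auto simp: V_def)
qed fact

lemma residual_zero_stationary:
  assumes x: "x \<in> X" and r: "residual P x = 0"
  shows "x \<in> stationary P"
proof (rule stationaryI[OF x])
  fix y assume "y \<in> X"
  have "prox P (x - gradF x) = x"
    using r x by (simp add: residual_def pgrad_F)
  then show "gradF x \<bullet> (y - x) + G P y - G P x \<ge> 0"
    using prox_variational_inequality[OF \<open>y \<in> X\<close>, of "x - gradF x"] by simp
qed

text \<open>
  \<open>G\<close> need not be lower semicontinuous, so one cannot pass to the limit in the variational
  inequality directly. Instead the limit is compared with the proximal point \<open>p\<close> that it should be: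
  adding the two variational inequalities removes \<open>G\<close>, as in the proof that the
  proximal map is nonexpansive.
\<close>

lemma closed_stationary: "closed (stationary P)"
  unfolding closed_sequential_limits
proof (intro allI impI, elim conjE)
  fix xs x assume st: "\<forall>n. xs n \<in> stationary P" and lim: "xs \<longlonglongrightarrow> x"
  have X: "xs n \<in> X" for n
    using st stationaryD by blast
  have x: "x \<in> X"
    using closed_X X lim closed_sequentially by blast
  define p where "p = prox P (x - gradF x)"
  have p: "p \<in> X"
    by (simp add: p_def prox_minimizes)
  have bound: "norm (xs n - p) \<le> norm (xs n - x + gradF x - gradF (xs n))" for n
  proof -
    have 1: "gradF (xs n) \<bullet> (p - xs n) + G P p - G P (xs n) \<ge> 0"
      using st p stationaryD by blast
    have 2: "(p - (x - gradF x)) \<bullet> (xs n - p) + G P (xs n) - G P p \<ge> 0"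
      unfolding p_def by (rule prox_variational_inequality[OF X])
    have "(xs n - p) \<bullet> (xs n - p) \<le> (xs n - x + gradF x - gradF (xs n)) \<bullet> (xs n - p)"
      using 1 2 by (simp add: inner_simps inner_commute)
    also have "\<dots> \<le> norm (xs n - x + gradF x - gradF (xs n)) * norm (xs n - p)"
      by (rule norm_cauchy_schwarz)
    finally have "norm (xs n - p) * norm (xs n - p)
        \<le> norm (xs n - x + gradF x - gradF (xs n)) * norm (xs n - p)"
      by (simp add: power2_norm_eq_inner flip: power2_eq_square)
    then show ?thesis
      by (cases "norm (xs n - p) = 0") (auto simp: mult_le_cancel_right)
  qed
  have "(\<lambda>n. gradF (xs n)) \<longlonglongrightarrow> gradF x"
    using continuous_on_tendsto_compose[OF continuous_on_gradF lim x] X by simp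
  then have "(\<lambda>n. norm (xs n - x + gradF x - gradF (xs n))) \<longlonglongrightarrow> norm (x - x + gradF x - gradF x)"
    by (intro tendsto_intros lim)
  then have null: "(\<lambda>n. norm (xs n - x + gradF x - gradF (xs n))) \<longlonglongrightarrow> 0"
    by simp
  have "(\<lambda>n. norm (xs n - p)) \<longlonglongrightarrow> 0"
    by (rule Lim_null_comparison[OF always_eventually null]) (simp only: real_norm_def abs_norm_cancel bound simp_thms)
  then have "xs \<longlonglongrightarrow> p"
    by (rule LIM_zero_cancel[OF tendsto_norm_zero_cancel])
  then have "x = p"
    by (rule LIMSEQ_unique[OF lim])
  then show "x \<in> stationary P"
    using x by (intro residual_zero_stationary) (simp_all add: residual_def pgrad_F p_def)
qed

end


section \<open>Surrogates and best responses\<close>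

locale surrogate_problem = composite_problem P
  for P :: "('a::finite, 'n::finite) problem" +
  fixes ft :: "'a \<Rightarrow> real ^ 'n \<Rightarrow> real ^ 'n \<Rightarrow> real" and \<tau> :: real and Ls :: "'a \<Rightarrow> real"
  assumes surrogates: "assumption_C P ft \<tau> Ls"
begin

definition Lm :: real where
  "Lm = Max (range Ls)"

definition surrogate_grad :: "'a \<Rightarrow> real ^ 'n \<Rightarrow> real ^ 'n \<Rightarrow> real ^ 'n" where
  "surrogate_grad i v w = pgrad P {i} (\<lambda>v. ft i v w) v"

lemma tau_pos: "0 < \<tau>"
  using surrogates by (simp add: assumption_C_def)

lemma surrogate_grad_consistent:
  assumes "z \<in> X"
  shows "surrogate_grad i (restr P {i} z) (restr P (nbr P i) z) = pgrad P {i} (floc P i) (restr P (nbr P i) z)"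
  using surrogates assms by (simp add: assumption_C_def surrogate_grad_def)

lemma Ls_nonneg: "0 \<le> Ls i"
proof -
  obtain y where "y \<in> Xset P i"
    using Xset_nonempty by blast
  then have "(Ls i)-lipschitz_on (Xprod P (nbr P i)) (\<lambda>w. pgrad P {i} (\<lambda>v. ft i v w) y)"
    using surrogates by (simp add: assumption_C_def)
  then show ?thesis
    by (rule lipschitz_on_nonneg)
qed

lemma Ls_le_Lm: "Ls i \<le> Lm"
  unfolding Lm_def by (rule Max_ge) auto

lemma Lm_nonneg: "0 \<le> Lm"
  using Ls_nonneg Ls_le_Lm order_trans by blast

lemma surrogate_grad_lipschitz:
  assumes "v \<in> Xset P i" "z \<in> X" "z' \<in> X"
  shows "norm (surrogate_grad i v (restr P (nbr P i) z) - surrogate_grad i v (restr P (nbr P i) z')) \<le> Lm * norm (z - z')"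
proof -
  have "(Ls i)-lipschitz_on (Xprod P (nbr P i)) (\<lambda>w. surrogate_grad i v w)"
    using surrogates assms(1) by (simp add: assumption_C_def surrogate_grad_def)
  then have "norm (surrogate_grad i v (restr P (nbr P i) z) - surrogate_grad i v (restr P (nbr P i) z'))
      \<le> Ls i * norm (restr P (nbr P i) z - restr P (nbr P i) z')"
    using lipschitz_onD restr_nbr_mem assms(2,3) by (metis dist_norm)
  also have "\<dots> \<le> Lm * norm (z - z')"
    using Ls_le_Lm Ls_nonneg Lm_nonneg norm_restr_le[of P "nbr P i" "z - z'"]
    by (intro mult_mono) (auto simp: restr_diff)
  finally show ?thesis .
qed

lemma surrogate_line_derivative:
  assumes "v \<in> Xset P i" "u \<in> Xset P i" "w \<in> Xprod P (nbr P i)"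
  shows "((\<lambda>t. ft i (v + t *\<^sub>R (u - v)) w) has_real_derivative surrogate_grad i v w \<bullet> (u - v)) (at 0)"
proof -
  have "C1_on P {i} (Xset P i) (\<lambda>v. ft i v w)"
    using surrogates assms(3) by (simp add: assumption_C_def)
  from C1_on_GDERIV[OF this assms(1) Xset_blockspace]
  have "GDERIV (\<lambda>s. ft i (v + 0 *\<^sub>R (u - v) + restr P {i} s) w) 0 :> surrogate_grad i v w"
    by (simp add: surrogate_grad_def)
  then show ?thesis
    by (rule pgrad_line_derivative) (simp add: restr_diff restr_Xset[OF assms(1)] restr_Xset[OF assms(2)])
qed

lemma surrogate_grad_strongly_monotone:
  assumes "v \<in> Xset P i" "u \<in> Xset P i" "w \<in> Xprod P (nbr P i)"
  shows "\<tau> * (norm (u - v))\<^sup>2 \<le> (surrogate_grad i u w - surrogate_grad i v w) \<bullet> (u - v)"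
proof -
  have sc: "strongly_convex_on \<tau> (Xset P i) (\<lambda>v. ft i v w)"
    using surrogates assms(3) by (simp add: assumption_C_def)
  have "ft i u w \<ge> ft i v w + surrogate_grad i v w \<bullet> (u - v) + \<tau> / 2 * (norm (u - v))\<^sup>2"
    by (rule strongly_convex_gradient_inequality[OF sc]) (intro assms surrogate_line_derivative)+
  moreover have "ft i v w \<ge> ft i u w + surrogate_grad i u w \<bullet> (v - u) + \<tau> / 2 * (norm (v - u))\<^sup>2"
    by (rule strongly_convex_gradient_inequality[OF sc]) (intro assms surrogate_line_derivative)+
  ultimately show ?thesis
    by (simp add: inner_simps norm_minus_commute)
qed

text \<open>The gradient of the model minimised by agent \<open>i\<close>, at its best response \<open>y\<close>.\<close>

definition model_grad :: "'a \<Rightarrow> ('a \<Rightarrow> real ^ 'n) \<Rightarrow> real ^ 'n \<Rightarrow> real ^ 'n" where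
  "model_grad i W y = surrogate_grad i y (W i) + (\<Sum>j\<in>nbr P i - {i}. pgrad P {i} (floc P j) (W j))"

lemma best_response_mem: "best_response P ft i W y \<Longrightarrow> y \<in> Xset P i"
  by (simp add: best_response_def is_arg_min_def)

lemma best_response_variational_inequality:
  assumes br: "best_response P ft i W y" and W: "W i \<in> Xprod P (nbr P i)" and v: "v \<in> Xset P i"
  shows "model_grad i W y \<bullet> (v - y) + greg P i v - greg P i y \<ge> 0"
proof -
  note y = best_response_mem[OF br]
  let ?s = "\<Sum>j\<in>nbr P i - {i}. pgrad P {i} (floc P j) (W j)"
  let ?h = "\<lambda>u. ft i u (W i) + ?s \<bullet> (u - restr P {i} (W i))"
  have min: "?h y + greg P i y \<le> ?h u + greg P i u" if "u \<in> Xset P i" for u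
    using br that by (simp add: best_response_def is_arg_min_linorder inner_sum_left)
  have "((\<lambda>t. ?s \<bullet> (y + t *\<^sub>R (v - y) - restr P {i} (W i))) has_real_derivative ?s \<bullet> (v - y)) (at 0)"
    unfolding inner_diff_right inner_add_right inner_scaleR_right
    by (auto intro!: derivative_eq_intros)
  from DERIV_add[OF surrogate_line_derivative[OF y v W] this]
  have "((\<lambda>t. ?h (y + t *\<^sub>R (v - y))) has_real_derivative model_grad i W y \<bullet> (v - y)) (at 0)"
    by (simp add: model_grad_def inner_add_left)
  then show ?thesis
    by (intro minimizer_variational_inequality[OF greg_convex y v min]) auto
qed

lemma continuous_on_floc_pgrad:
  assumes "i \<in> nbr P j"
  shows "continuous_on X (\<lambda>w. pgrad P {i} (floc P j) (restr P (nbr P j) w))"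
proof -
  have "continuous_on (Xprod P (nbr P j)) (pgrad P (nbr P j) (floc P j))"
    using floc_C1 by (simp add: C1_on_def)
  moreover have "continuous_on X (restr P (nbr P j))"
    by (intro linear_continuous_on bounded_linear_restr)
  ultimately have "continuous_on X (\<lambda>w. pgrad P (nbr P j) (floc P j) (restr P (nbr P j) w))"
    by (rule continuous_on_compose2) (auto intro: restr_nbr_mem)
  then have "continuous_on X (\<lambda>w. restr P {i} (pgrad P (nbr P j) (floc P j) (restr P (nbr P j) w)))"
    by (rule bounded_linear.continuous_on[OF bounded_linear_restr])
  then show ?thesis
    by (rule continuous_on_eq) (simp add: floc_pgrad_block restr_nbr_mem assms)
qed

text \<open>
  Strong convexity pulls a best response towards the block of the proximal point of \<open>0\<close>, whose
  variational inequality supplies an affine minorant of \<open>greg P i\<close>; the pull is balanced by gradients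
  that are bounded because the data vary in a compact set.
\<close>

lemma best_responses_bounded:
  "bdd_above {norm (y - restr P {i} (w i)) |i w y.
     (\<forall>j\<in>nbr P i. w j \<in> Cube P U) \<and> best_response P ft i (\<lambda>j. restr P (nbr P j) (w j)) y}"
proof -
  let ?p = "prox P 0"
  define r where "r = max (norm ?p) (sqrt (DIM(real ^ 'n)) * U)"
  define K where "K = X \<inter> cball 0 r"
  have r: "0 \<le> r"
    unfolding r_def by (rule max.coboundedI1) simp
  have p: "?p \<in> X" "?p \<in> K"
    using prox_minimizes by (auto simp: K_def r_def)
  have cubeK: "w \<in> K" if "w \<in> Cube P U" for w
  proof -
    have "norm w \<le> sqrt (DIM(real ^ 'n)) * infnorm w"
      by (rule norm_le_infnorm)
    also have "\<dots> \<le> sqrt (DIM(real ^ 'n)) * U"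
      using that by (intro mult_left_mono) (auto simp: Cube_def)
    finally show ?thesis
      using that by (auto simp: Cube_def K_def r_def)
  qed
  have "compact K"
    unfolding K_def by (rule closed_Int_compact[OF closed_X compact_cball])
  then have "bounded ((\<lambda>w. pgrad P {i} (floc P j) (restr P (nbr P j) w)) ` K)" if "i \<in> nbr P j" for i j
    using continuous_on_subset[OF continuous_on_floc_pgrad[OF that], of K]
    by (intro compact_imp_bounded compact_continuous_image) (auto simp: K_def)
  then have "bounded (\<Union>i. \<Union>j\<in>nbr P i. (\<lambda>w. pgrad P {i} (floc P j) (restr P (nbr P j) w)) ` K)"
    using nbr_sym by (intro bounded_UN finite ballI) auto
  then obtain C where C: "\<And>i j w. j \<in> nbr P i \<Longrightarrow> w \<in> K \<Longrightarrow>
      norm (pgrad P {i} (floc P j) (restr P (nbr P j) w)) \<le> C"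
    unfolding bounded_iff by (elim exE) (auto simp: Bex_def)
  have C0: "0 \<le> C"
    by (rule order_trans[OF norm_ge_zero C[OF nbr_refl p(2)]])
  define E where "E = C + Lm * (2 * r) + CARD('a) * C + r"
  show ?thesis
  proof (rule bdd_aboveI, clarify)
    fix i w y
    assume w: "\<forall>j\<in>nbr P i. w j \<in> Cube P U"
      and br: "best_response P ft i (\<lambda>j. restr P (nbr P j) (w j)) y"
    let ?W = "\<lambda>j. restr P (nbr P j) (w j)"
    let ?pi = "restr P {i} ?p"
    let ?s = "\<Sum>j\<in>nbr P i - {i}. pgrad P {i} (floc P j) (?W j)"
    have wK: "w j \<in> K" if "j \<in> nbr P i" for j
      using w cubeK that by blast
    then have wi: "w i \<in> X" "norm (w i) \<le> r"
      by (auto simp: K_def)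
    note y = best_response_mem[OF br]
    have pi: "?pi \<in> Xset P i"
      by (rule restr_block_mem[OF p(1)])
    have "norm ?s \<le> (\<Sum>j\<in>nbr P i - {i}. C)"
      using C wK by (intro sum_norm_le) auto
    also have "\<dots> \<le> CARD('a) * C"
      unfolding sum_constant by (intro mult_right_mono of_nat_mono card_mono C0) auto
    finally have s: "norm ?s \<le> CARD('a) * C" .
    have "norm (surrogate_grad i ?pi (?W i) - surrogate_grad i ?pi (restr P (nbr P i) ?p)) \<le> Lm * norm (w i - ?p)"
      by (intro surrogate_grad_lipschitz pi wi p)
    also have "\<dots> \<le> Lm * (2 * r)"
      using norm_triangle_ineq4[of "w i" ?p] wi Lm_nonneg p(2) by (intro mult_left_mono) (auto simp: K_def)
    finally have "norm (surrogate_grad i ?pi (?W i)) \<le> C + Lm * (2 * r)"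
      using C[OF nbr_refl p(2), of i] norm_triangle_sub[of "surrogate_grad i ?pi (?W i)" "surrogate_grad i ?pi (restr P (nbr P i) ?p)"]
      by (simp add: surrogate_grad_consistent p)
    then have m: "norm (surrogate_grad i ?pi (?W i) + ?s + - ?pi) \<le> E"
      using s p(2) norm_restr_le[of P "{i}" ?p] unfolding E_def
      by (intro norm_triangle_le add_mono) (auto simp: K_def)
    have "model_grad i ?W y \<bullet> (?pi - y) + greg P i ?pi - greg P i y \<ge> 0"
      by (rule best_response_variational_inequality[OF br restr_nbr_mem[OF wi(1)] pi])
    moreover have "?pi \<bullet> (y - ?pi) + greg P i y - greg P i ?pi \<ge> 0"
      using prox_block_variational_inequality[OF y, of 0] by simp
    moreover have "\<tau> * (norm (y - ?pi))\<^sup>2 \<le> (surrogate_grad i y (?W i) - surrogate_grad i ?pi (?W i)) \<bullet> (y - ?pi)"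
      by (rule surrogate_grad_strongly_monotone[OF pi y restr_nbr_mem[OF wi(1)]])
    ultimately have "\<tau> * (norm (y - ?pi))\<^sup>2 \<le> - ((surrogate_grad i ?pi (?W i) + ?s + - ?pi) \<bullet> (y - ?pi))"
      by (simp add: model_grad_def inner_simps)
    also have "\<dots> \<le> norm (surrogate_grad i ?pi (?W i) + ?s + - ?pi) * norm (y - ?pi)"
      using Cauchy_Schwarz_ineq2[of "surrogate_grad i ?pi (?W i) + ?s + - ?pi" "y - ?pi"] by linarith
    also have "\<dots> \<le> E * norm (y - ?pi)"
      using m by (rule mult_right_mono) simp
    finally have "\<tau> * norm (y - ?pi) * norm (y - ?pi) \<le> E * norm (y - ?pi)"
      by (simp add: power2_eq_square mult.assoc)
    then have "\<tau> * norm (y - ?pi) \<le> E"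
      using order_trans[OF norm_ge_zero m] by (cases "norm (y - ?pi) = 0") (auto simp: mult_le_cancel_right)
    then have "norm (y - ?pi) \<le> E / \<tau>"
      using tau_pos by (simp add: field_simps)
    moreover have "norm (?pi - restr P {i} (w i)) \<le> 2 * r"
      using norm_restr_le[of P "{i}" "?p - w i"] norm_triangle_ineq4[of ?p "w i"] wi p(2)
      by (auto simp: K_def restr_diff)
    ultimately show "norm (y - restr P {i} (w i)) \<le> E / \<tau> + 2 * r"
      using norm_triangle_ineq[of "y - ?pi" "?pi - restr P {i} (w i)"] by simp
  qed
qed

end


section \<open>One step of the algorithm\<close>

locale asynchronous_run = surrogate_problem P ft \<tau> Ls
  for P :: "('a::finite, 'n::finite) problem" and ft \<tau> Ls +
  fixes \<gamma> :: real and B D :: nat and act :: "nat \<Rightarrow> 'a" and d :: "nat \<Rightarrow> 'a \<Rightarrow> 'a \<Rightarrow> 'a \<Rightarrow> nat"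
    and x0 :: "real ^ 'n" and x :: "nat \<Rightarrow> real ^ 'n"
  assumes algorithm: "DAsyFLEXA P ft x0 \<gamma> act d x"
    and schedule: "assumption_D P B D act d"
begin

lemma gamma_bounds: "0 < \<gamma>" "\<gamma> \<le> 1"
  using algorithm by (auto simp: DAsyFLEXA_def)

definition y :: "nat \<Rightarrow> real ^ 'n" where
  "y k = (SOME y. best_response P ft (act k) (\<lambda>j. delayed P x d k (act k) j) y \<and>
     x (Suc k) = x k + \<gamma> *\<^sub>R (y - restr P {act k} (x k)))"

text \<open>The move that the active agent would make without relaxation.\<close>

definition \<delta> :: "nat \<Rightarrow> real ^ 'n" where
  "\<delta> k = y k - restr P {act k} (x k)"

definition m :: "nat \<Rightarrow> real" where
  "m k = norm (\<delta> k)"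

lemma step_properties:
  "best_response P ft (act k) (\<lambda>j. delayed P x d k (act k) j) (y k)"
  "x (Suc k) = x k + \<gamma> *\<^sub>R \<delta> k"
proof -
  have "\<exists>y. best_response P ft (act k) (\<lambda>j. delayed P x d k (act k) j) y \<and>
     x (Suc k) = x k + \<gamma> *\<^sub>R (y - restr P {act k} (x k))"
    using algorithm by (simp add: DAsyFLEXA_def)
  from someI_ex[OF this, folded y_def] show "best_response P ft (act k) (\<lambda>j. delayed P x d k (act k) j) (y k)"
    "x (Suc k) = x k + \<gamma> *\<^sub>R \<delta> k"
    by (simp_all add: \<delta>_def)
qed

lemma y_mem: "y k \<in> Xset P (act k)"
  by (rule best_response_mem[OF step_properties(1)])

lemma m_nonneg: "0 \<le> m k"
  by (simp add: m_def)

lemma restr_delta: "restr P {act k} (\<delta> k) = \<delta> k"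
  by (simp add: \<delta>_def restr_diff restr_restr restr_Xset[OF y_mem])

lemma step_mem_X:
  assumes "x k \<in> X" "0 \<le> t" "t \<le> 1"
  shows "x k + t *\<^sub>R \<delta> k \<in> X"
  using segment_mem_X[OF assms(1) replace_block_mem_X[OF assms(1) y_mem] assms(2,3)]
  by (simp add: \<delta>_def)

lemma x_mem: "x k \<in> X"
proof (induction k)
  case 0
  then show ?case
    using algorithm by (simp add: DAsyFLEXA_def)
next
  case (Suc k)
  then show ?case
    using step_mem_X[of k \<gamma>] gamma_bounds by (simp add: step_properties(2))
qed

lemma x_diff: "j \<le> k \<Longrightarrow> x k - x j = (\<Sum>s\<in>{j..<k}. \<gamma> *\<^sub>R \<delta> s)"
proof (induction k)
  case (Suc k)
  then show ?case
    by (cases "j \<le> k") (auto simp: step_properties(2) le_Suc_eq algebra_simps)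
qed simp

lemma norm_x_diff_le:
  assumes "j \<le> k"
  shows "norm (x k - x j) \<le> \<gamma> * (\<Sum>s\<in>{j..<k}. m s)"
proof -
  have "norm (x k - x j) \<le> (\<Sum>s\<in>{j..<k}. norm (\<gamma> *\<^sub>R \<delta> s))"
    unfolding x_diff[OF assms] by (rule norm_sum)
  then show ?thesis
    using gamma_bounds by (simp add: m_def sum_distrib_left)
qed

text \<open>
  The delayed information used by the active agent, completed by the current blocks of the agents
  outside \<open>nbr P j\<close> to a feasible point, at which gradients can be compared.
\<close>

definition stale :: "nat \<Rightarrow> 'a \<Rightarrow> real ^ 'n" where
  "stale k j = (\<chi> c. if blk P c \<in> nbr P j then x (k - d k (act k) j (blk P c)) $ c else x k $ c)"

lemma restr_stale: "restr P (nbr P j) (stale k j) = delayed P x d k (act k) j"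
  by (simp add: vec_eq_iff restr_nth stale_def delayed_def)

lemma restr_stale_block:
  "restr P {i} (stale k j) = restr P {i} (if i \<in> nbr P j then x (k - d k (act k) j i) else x k)"
  by (simp add: vec_eq_iff restr_nth stale_def)

lemma stale_mem_X: "stale k j \<in> X"
  unfolding mem_X_iff restr_stale_block by (simp add: restr_block_mem x_mem)

lemma restr_stale_active: "restr P {act k} (stale k (act k)) = restr P {act k} (x k)"
  using algorithm by (simp add: restr_stale_block DAsyFLEXA_def)

definition lag :: "nat \<Rightarrow> real" where
  "lag k = (\<Sum>s\<in>{k - D..<k}. m s)"

lemma lag_nonneg: "0 \<le> lag k"
  by (simp add: lag_def sum_nonneg m_nonneg)

text \<open>
  Different blocks may be delayed differently. Bounding every coordinate by the total of its
  absolute changes over the last \<open>D\<close> steps covers all choices of delays at once.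
\<close>

lemma norm_stale_diff_le:
  assumes "j \<in> nbr P (act k)"
  shows "norm (stale k j - x k) \<le> \<gamma> * lag k"
proof -
  let ?a = "\<lambda>s. \<chi> c. \<bar>\<delta> s $ c\<bar>"
  have na: "norm (?a s) = m s" for s
    by (simp add: m_def norm_vec_def L2_set_def)
  have "norm (stale k j - x k) \<le> norm (\<Sum>s\<in>{k - D..<k}. \<gamma> *\<^sub>R ?a s)"
  proof (rule norm_le_componentwise_cart)
    fix c
    let ?e = "d k (act k) j (blk P c)"
    have nn: "0 \<le> (\<Sum>s\<in>{k - D..<k}. \<gamma> * \<bar>\<delta> s $ c\<bar>)"
      using gamma_bounds by (intro sum_nonneg) auto
    have "\<bar>(stale k j - x k) $ c\<bar> \<le> (\<Sum>s\<in>{k - D..<k}. \<gamma> * \<bar>\<delta> s $ c\<bar>)"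
    proof (cases "blk P c \<in> nbr P j")
      case True
      then have e: "?e \<le> D"
        using schedule assms by (simp add: assumption_D_def)
      have "\<bar>(stale k j - x k) $ c\<bar> = \<bar>(x k - x (k - ?e)) $ c\<bar>"
        using True by (simp add: stale_def)
      also have "\<dots> = \<bar>\<Sum>s\<in>{k - ?e..<k}. \<gamma> * \<delta> s $ c\<bar>"
        by (simp only: x_diff[OF diff_le_self]) simp
      also have "\<dots> \<le> (\<Sum>s\<in>{k - ?e..<k}. \<gamma> * \<bar>\<delta> s $ c\<bar>)"
        using gamma_bounds by (intro order_trans[OF sum_abs]) (simp add: abs_mult)
      also have "\<dots> \<le> (\<Sum>s\<in>{k - D..<k}. \<gamma> * \<bar>\<delta> s $ c\<bar>)"
        using gamma_bounds e by (intro sum_mono2) auto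
      finally show ?thesis .
    qed (use nn in \<open>simp add: stale_def\<close>)
    then show "norm ((stale k j - x k) $ c) \<le> norm ((\<Sum>s\<in>{k - D..<k}. \<gamma> *\<^sub>R ?a s) $ c)"
      using nn by simp
  qed
  also have "\<dots> \<le> (\<Sum>s\<in>{k - D..<k}. norm (\<gamma> *\<^sub>R ?a s))"
    by (rule norm_sum)
  also have "\<dots> = \<gamma> * lag k"
    using gamma_bounds by (simp add: na lag_def sum_distrib_left)
  finally show ?thesis .
qed

text \<open>All points at which step \<open>k\<close> compares gradients lie in \<open>S\<close>.\<close>

definition step_within :: "(real ^ 'n) set \<Rightarrow> nat \<Rightarrow> bool" where
  "step_within S k \<longleftrightarrow> (\<forall>j\<in>nbr P (act k). stale k j \<in> S) \<and>
     (\<forall>t. 0 \<le> t \<longrightarrow> t \<le> 1 \<longrightarrow> x k + t *\<^sub>R \<delta> k \<in> S)"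

end


locale lipschitz_run = asynchronous_run P ft \<tau> Ls \<gamma> B D act d x0 x
  for P :: "('a::finite, 'n::finite) problem" and ft \<tau> Ls \<gamma> B D act d x0 x +
  fixes S :: "(real ^ 'n) set" and L :: real
  assumes region: "block_lipschitz S L"
begin

text \<open>A Lipschitz constant of a single block of \<open>gradF\<close>.\<close>

definition A :: real where
  "A = rho P * L"

abbreviation "compared_in_region \<equiv> step_within S"

lemma compared_in_regionD:
  assumes "compared_in_region k"
  shows "x k \<in> S" "x k + \<delta> k \<in> S" "j \<in> nbr P (act k) \<Longrightarrow> stale k j \<in> S"
    "0 \<le> t \<Longrightarrow> t \<le> 1 \<Longrightarrow> x k + t *\<^sub>R \<delta> k \<in> S"
proof -
  have seg: "x k + t *\<^sub>R \<delta> k \<in> S" if "0 \<le> t" "t \<le> 1" for t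
    using assms that by (simp add: step_within_def)
  show "x k \<in> S" "x k + \<delta> k \<in> S" "0 \<le> t \<Longrightarrow> t \<le> 1 \<Longrightarrow> x k + t *\<^sub>R \<delta> k \<in> S"
    using seg[of 0] seg[of 1] seg[of t] by auto
  show "j \<in> nbr P (act k) \<Longrightarrow> stale k j \<in> S"
    using assms by (simp add: step_within_def)
qed

lemma L_nonneg: "0 \<le> L"
  using region by (simp add: block_lipschitz_def)

lemma L_le_A: "L \<le> A"
  unfolding A_def using L_nonneg rho_ge_1 by (simp add: mult_le_cancel_right1)

lemma A_nonneg: "0 \<le> A"
  using L_nonneg L_le_A by simp

lemma floc_pgrad_lipschitz:
  assumes "j \<in> nbr P i" "u \<in> S" "v \<in> S"
  shows "norm (pgrad P {i} (floc P j) (restr P (nbr P j) u) - pgrad P {i} (floc P j) (restr P (nbr P j) v))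
    \<le> L * norm (u - v)"
  using region assms nbr_sym[of j i] by (auto simp: block_lipschitz_def)

definition q :: "nat \<Rightarrow> real ^ 'n" where
  "q k = model_grad (act k) (\<lambda>j. delayed P x d k (act k) j) (y k)"

lemma q_variational_inequality:
  assumes "v \<in> Xset P (act k)"
  shows "q k \<bullet> (v - y k) + greg P (act k) v - greg P (act k) (y k) \<ge> 0"
  unfolding q_def
  by (rule best_response_variational_inequality[OF step_properties(1) _ assms])
    (simp add: restr_nbr_mem[OF stale_mem_X] flip: restr_stale)

lemma q_eq:
  "q k = surrogate_grad (act k) (y k) (restr P (nbr P (act k)) (stale k (act k)))
    + (\<Sum>j\<in>nbr P (act k) - {act k}. pgrad P {act k} (floc P j) (restr P (nbr P j) (stale k j)))"
  by (simp add: q_def model_grad_def restr_stale)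

lemma gradF_inner_delta:
  "gradF z \<bullet> \<delta> k = restr P {act k} (gradF z) \<bullet> \<delta> k"
  by (simp add: inner_restr_left restr_delta)

text \<open>
  The best response is a descent direction up to the staleness of the data: at the current block the
  surrogate has the stale gradient of \<open>F\<close>, and strong convexity gains \<open>\<tau> * (m k)\<^sup>2\<close>.
\<close>

lemma best_response_descent:
  assumes "compared_in_region k"
  shows "gradF (x k) \<bullet> \<delta> k + greg P (act k) (y k) - greg P (act k) (restr P {act k} (x k))
    \<le> - \<tau> * (m k)\<^sup>2 + A * \<gamma> * lag k * m k"
proof -
  let ?i = "act k"
  let ?xi = "restr P {?i} (x k)"
  let ?w = "restr P (nbr P ?i) (stale k ?i)"
  define q0 where "q0 = (\<Sum>j\<in>nbr P ?i. pgrad P {?i} (floc P j) (restr P (nbr P j) (stale k j)))"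
  note mem = compared_in_regionD[OF assms]
  have xi: "?xi \<in> Xset P ?i"
    by (rule restr_block_mem[OF x_mem])
  have sm: "\<tau> * (m k)\<^sup>2 \<le> (surrogate_grad ?i (y k) ?w - surrogate_grad ?i ?xi ?w) \<bullet> \<delta> k"
    using surrogate_grad_strongly_monotone[OF xi y_mem restr_nbr_mem[OF stale_mem_X]]
    by (simp add: m_def \<delta>_def)
  have "surrogate_grad ?i ?xi ?w = pgrad P {?i} (floc P ?i) ?w"
    using surrogate_grad_consistent[OF stale_mem_X[of k ?i], of ?i] by (simp add: restr_stale_active)
  then have "q k - q0 = surrogate_grad ?i (y k) ?w - surrogate_grad ?i ?xi ?w"
    unfolding q_eq q0_def by (subst sum.remove[of _ ?i]) simp_all
  with sm have "\<tau> * (m k)\<^sup>2 \<le> (q k - q0) \<bullet> \<delta> k"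
    by (simp only:)
  then have 1: "q0 \<bullet> \<delta> k \<le> q k \<bullet> \<delta> k - \<tau> * (m k)\<^sup>2"
    by (simp add: inner_diff_left)
  have 2: "q k \<bullet> \<delta> k + greg P ?i (y k) - greg P ?i ?xi \<le> 0"
    using q_variational_inequality[OF xi] by (simp add: \<delta>_def inner_diff_right)
  have "norm (restr P {?i} (gradF (x k)) - q0) \<le> (\<Sum>j\<in>nbr P ?i. L * (\<gamma> * lag k))"
    unfolding restr_gradF[OF x_mem] q0_def sum_subtractf[symmetric]
  proof (intro sum_norm_le)
    fix j assume j: "j \<in> nbr P ?i"
    have "norm (pgrad P {?i} (floc P j) (restr P (nbr P j) (x k)) - pgrad P {?i} (floc P j) (restr P (nbr P j) (stale k j)))
        \<le> L * norm (x k - stale k j)"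
      by (intro floc_pgrad_lipschitz j mem)
    also have "\<dots> \<le> L * (\<gamma> * lag k)"
      using norm_stale_diff_le[OF j] L_nonneg by (intro mult_left_mono) (auto simp: norm_minus_commute)
    finally show "norm (pgrad P {?i} (floc P j) (restr P (nbr P j) (x k)) - pgrad P {?i} (floc P j) (restr P (nbr P j) (stale k j)))
        \<le> L * (\<gamma> * lag k)" .
  qed
  also have "\<dots> \<le> rho P * (L * (\<gamma> * lag k))"
    unfolding sum_constant using card_nbr_le L_nonneg lag_nonneg gamma_bounds
    by (intro mult_right_mono of_nat_mono) auto
  finally have "norm (restr P {?i} (gradF (x k)) - q0) \<le> A * \<gamma> * lag k"
    by (simp add: A_def mult.assoc)
  then have "(restr P {?i} (gradF (x k)) - q0) \<bullet> \<delta> k \<le> A * \<gamma> * lag k * m k"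
    unfolding m_def by (intro order_trans[OF norm_cauchy_schwarz] mult_right_mono) auto
  then show ?thesis
    using 1 2 gradF_inner_delta[of "x k" k] by (simp add: inner_diff_left)
qed

text \<open>
  Moving the surrogate's base point along with its argument keeps it consistent with \<open>f\<close>; this
  replaces Lipschitz continuity of \<open>surrogate_grad i\<close> in its first argument.
\<close>

lemma model_grad_error:
  assumes "compared_in_region k"
  shows "norm (q k - restr P {act k} (gradF (x k))) \<le> (A + Lm) * (lag k + m k)"
proof -
  let ?i = "act k"
  let ?r = "restr P (nbr P ?i)"
  let ?g = "\<lambda>j z. pgrad P {?i} (floc P j) (restr P (nbr P j) z)"
  note mem = compared_in_regionD[OF assms]
  have nb: "?i \<in> nbr P ?i"
    by simp
  have glag: "\<gamma> * lag k \<le> lag k"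
    using gamma_bounds lag_nonneg by (simp add: mult_left_le_one_le)
  have stale: "norm (stale k j - x k) \<le> lag k" if "j \<in> nbr P ?i" for j
    using norm_stale_diff_le[OF that] glag by simp
  have X: "x k + \<delta> k \<in> X"
    using step_mem_X[OF x_mem, of 1 k] by simp
  have "restr P {?i} (x k + \<delta> k) = y k"
    using restr_replace_block[OF y_mem, of ?i "x k"] by (simp add: \<delta>_def)
  then have cons: "surrogate_grad ?i (y k) (?r (x k + \<delta> k)) = ?g ?i (x k + \<delta> k)"
    using surrogate_grad_consistent[OF X, of ?i] by simp
  have "norm (surrogate_grad ?i (y k) (?r (stale k ?i)) - surrogate_grad ?i (y k) (?r (x k))) \<le> Lm * norm (stale k ?i - x k)"
    by (intro surrogate_grad_lipschitz y_mem stale_mem_X x_mem)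
  also have "\<dots> \<le> Lm * lag k"
    by (intro mult_left_mono stale Lm_nonneg nb)
  finally have 1: "norm (surrogate_grad ?i (y k) (?r (stale k ?i)) - surrogate_grad ?i (y k) (?r (x k))) \<le> Lm * lag k" .
  have 2: "norm (surrogate_grad ?i (y k) (?r (x k)) - ?g ?i (x k + \<delta> k)) \<le> Lm * m k"
    using surrogate_grad_lipschitz[OF y_mem[of k] x_mem[of k] X] by (simp add: cons m_def)
  have "norm (?g ?i (x k + \<delta> k) - ?g ?i (x k)) \<le> L * m k"
    using floc_pgrad_lipschitz[OF nb mem(2) mem(1)] by (simp add: m_def)
  also have "\<dots> \<le> A * m k"
    by (intro mult_right_mono L_le_A m_nonneg)
  finally have 3: "norm (?g ?i (x k + \<delta> k) - ?g ?i (x k)) \<le> A * m k" .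
  have "norm (\<Sum>j\<in>nbr P ?i - {?i}. ?g j (stale k j) - ?g j (x k)) \<le> (\<Sum>j\<in>nbr P ?i - {?i}. L * lag k)"
  proof (intro sum_norm_le)
    fix j assume "j \<in> nbr P ?i - {?i}"
    then have j: "j \<in> nbr P ?i"
      by simp
    have "norm (?g j (stale k j) - ?g j (x k)) \<le> L * norm (stale k j - x k)"
      by (intro floc_pgrad_lipschitz j mem)
    also have "\<dots> \<le> L * lag k"
      by (intro mult_left_mono stale j L_nonneg)
    finally show "norm (?g j (stale k j) - ?g j (x k)) \<le> L * lag k" .
  qed
  also have "\<dots> \<le> rho P * (L * lag k)"
    unfolding sum_constant using card_nbr_le[of ?i] L_nonneg lag_nonneg card_mono[of "nbr P ?i" "nbr P ?i - {?i}"]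
    by (intro mult_right_mono of_nat_mono) auto
  finally have 4: "norm (\<Sum>j\<in>nbr P ?i - {?i}. ?g j (stale k j) - ?g j (x k)) \<le> A * lag k"
    by (simp add: A_def mult.assoc)
  have split: "restr P {?i} (gradF (x k)) = ?g ?i (x k) + (\<Sum>j\<in>nbr P ?i - {?i}. ?g j (x k))"
    unfolding restr_gradF[OF x_mem] by (rule sum.remove[OF finite nb])
  have decomp: "q k - restr P {?i} (gradF (x k)) =
      (surrogate_grad ?i (y k) (?r (stale k ?i)) - surrogate_grad ?i (y k) (?r (x k)))
      + (surrogate_grad ?i (y k) (?r (x k)) - ?g ?i (x k + \<delta> k))
      + (?g ?i (x k + \<delta> k) - ?g ?i (x k)) + (\<Sum>j\<in>nbr P ?i - {?i}. ?g j (stale k j) - ?g j (x k))"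
    unfolding q_eq split sum_subtractf by (simp only: algebra_simps)
  have "norm (q k - restr P {?i} (gradF (x k))) \<le> Lm * lag k + Lm * m k + A * m k + A * lag k"
    unfolding decomp by (rule norm_triangle_mono[OF norm_triangle_mono[OF norm_triangle_mono[OF 1 2] 3] 4])
  also have "\<dots> = (A + Lm) * (lag k + m k)"
    by (simp only: algebra_simps)
  finally show ?thesis .
qed

text \<open>
  Strong convexity of the surrogate and Lipschitz continuity pull in opposite directions: a
  step that moves at all limits how large \<open>\<tau>\<close> can be.
\<close>

lemma tau_le:
  assumes "x k \<in> S" "x k + \<delta> k \<in> S" "\<delta> k \<noteq> 0"
  shows "\<tau> \<le> L + Lm"
proof -
  let ?i = "act k"
  let ?r = "restr P (nbr P ?i)"
  let ?xi = "restr P {?i} (x k)"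
  have X: "x k + \<delta> k \<in> X"
    using step_mem_X[OF x_mem, of 1 k] by simp
  have "restr P {?i} (x k + \<delta> k) = y k"
    using restr_replace_block[OF y_mem, of ?i "x k"] by (simp add: \<delta>_def)
  then have cons: "surrogate_grad ?i (y k) (?r (x k + \<delta> k)) = pgrad P {?i} (floc P ?i) (?r (x k + \<delta> k))"
    using surrogate_grad_consistent[OF X, of ?i] by simp
  have 1: "norm (surrogate_grad ?i (y k) (?r (x k)) - surrogate_grad ?i (y k) (?r (x k + \<delta> k))) \<le> Lm * m k"
    using surrogate_grad_lipschitz[OF y_mem[of k] x_mem[of k] X] by (simp add: m_def)
  have 2: "norm (surrogate_grad ?i (y k) (?r (x k + \<delta> k)) - surrogate_grad ?i ?xi (?r (x k))) \<le> L * m k"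
    using floc_pgrad_lipschitz[of ?i ?i "x k + \<delta> k" "x k"] assms
    by (simp add: cons surrogate_grad_consistent[OF x_mem] m_def)
  have "\<tau> * (m k)\<^sup>2 \<le> (surrogate_grad ?i (y k) (?r (x k)) - surrogate_grad ?i ?xi (?r (x k))) \<bullet> \<delta> k"
    using surrogate_grad_strongly_monotone[OF restr_block_mem[OF x_mem] y_mem restr_nbr_mem[OF x_mem]]
    by (simp add: m_def \<delta>_def)
  also have "\<dots> \<le> norm (surrogate_grad ?i (y k) (?r (x k)) - surrogate_grad ?i ?xi (?r (x k))) * m k"
    unfolding m_def by (rule norm_cauchy_schwarz)
  also have "\<dots> \<le> (Lm * m k + L * m k) * m k"
    using norm_triangle_le[OF add_mono[OF 1 2]] m_nonneg by (intro mult_right_mono) auto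
  finally have "\<tau> * (m k)\<^sup>2 \<le> (L + Lm) * (m k)\<^sup>2"
    by (simp add: power2_eq_square algebra_simps)
  then show ?thesis
    using assms(3) by (simp add: m_def mult_le_cancel_right)
qed

text \<open>
  By convexity of \<open>g\<close>, the relaxed step achieves at least the fraction \<open>\<gamma>\<close> of the first-order
  decrease that the full best response promises.
\<close>

lemma V_step:
  assumes "compared_in_region k"
  shows "V P (x (Suc k)) \<le> V P (x k)
    + \<gamma> * (gradF (x k) \<bullet> \<delta> k + greg P (act k) (y k) - greg P (act k) (restr P {act k} (x k)))
    + A * \<gamma>\<^sup>2 * (m k)\<^sup>2"
proof -
  let ?i = "act k"
  let ?xi = "restr P {?i} (x k)"
  note mem = compared_in_regionD[OF assms]
  have xi: "?xi \<in> Xset P ?i"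
    by (rule restr_block_mem[OF x_mem])
  have conv: "?xi + \<gamma> *\<^sub>R \<delta> k = (1 - \<gamma>) *\<^sub>R ?xi + \<gamma> *\<^sub>R y k"
    by (simp add: \<delta>_def algebra_simps)
  have xi': "?xi + \<gamma> *\<^sub>R \<delta> k \<in> Xset P ?i"
    unfolding conv using gamma_bounds by (intro convexD[OF Xset_convex] xi y_mem) auto
  have "G P (x (Suc k)) = G P (x k) + greg P ?i (?xi + \<gamma> *\<^sub>R \<delta> k) - greg P ?i ?xi"
    using G_replace_block[OF xi', of "x k"] by (simp add: step_properties(2))
  moreover have "greg P ?i (?xi + \<gamma> *\<^sub>R \<delta> k) \<le> (1 - \<gamma>) * greg P ?i ?xi + \<gamma> * greg P ?i (y k)"
    unfolding conv using gamma_bounds by (intro convex_onD[OF greg_convex] xi y_mem) auto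
  moreover have "F P (x (Suc k)) \<le> F P (x k) + gradF (x k) \<bullet> (\<gamma> *\<^sub>R \<delta> k) + A * (norm (\<gamma> *\<^sub>R \<delta> k))\<^sup>2"
    unfolding step_properties(2) A_def
  proof (rule F_block_upper_bound[OF region, where i = ?i])
    fix t :: real assume "0 \<le> t" "t \<le> 1"
    then show "x k + t *\<^sub>R \<gamma> *\<^sub>R \<delta> k \<in> S"
      using mem(4)[of "t * \<gamma>"] gamma_bounds by (simp add: mult_le_one)
  qed (simp add: restr_scaleR restr_delta)
  ultimately show ?thesis
    by (simp add: V_def m_def power_mult_distrib algebra_simps)
qed


section \<open>A Lyapunov function for the delayed iteration\<close>

text \<open>
  The stale terms in the descent of step \<open>k\<close> are squares of the last \<open>D\<close> displacements. The weight of
  a displacement starts at \<open>D\<close> and drops by one in each of the following \<open>D\<close> steps; truncated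
  subtraction makes it vanish afterwards.
\<close>

definition lag_energy :: "nat \<Rightarrow> real" where
  "lag_energy k = (\<Sum>s<k. real (D + s + 1 - k) * (m s)\<^sup>2)"

definition \<Phi> :: "nat \<Rightarrow> real" where
  "\<Phi> k = V P (x k) + \<gamma>\<^sup>2 * A / 2 * lag_energy k"

lemma lag_energy_nonneg: "0 \<le> lag_energy k"
  by (simp add: lag_energy_def sum_nonneg)

lemma V_le_Phi: "V P (x k) \<le> \<Phi> k"
  by (simp add: \<Phi>_def lag_energy_nonneg A_nonneg)

lemma Phi_0: "\<Phi> 0 = V P (x 0)"
  by (simp add: \<Phi>_def lag_energy_def)

lemma lag_energy_Suc:
  "lag_energy (Suc k) = lag_energy k + D * (m k)\<^sup>2 - (\<Sum>s\<in>{k - D..<k}. (m s)\<^sup>2)"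
proof -
  have "(\<Sum>s\<in>{k - D..<k}. (m s)\<^sup>2) = (\<Sum>s<k. if k \<le> D + s then (m s)\<^sup>2 else 0)"
    by (rule sum.mono_neutral_cong_left) auto
  moreover have "(\<Sum>s<k. real (D + s + 1 - Suc k) * (m s)\<^sup>2)
      = (\<Sum>s<k. real (D + s + 1 - k) * (m s)\<^sup>2 - (if k \<le> D + s then (m s)\<^sup>2 else 0))"
    by (rule sum.cong) (auto simp: of_nat_diff algebra_simps)
  ultimately show ?thesis
    by (simp add: lag_energy_def sum_subtractf)
qed

lemma lag_energy_le: "lag_energy k \<le> D * (\<Sum>s\<in>{k - D..<k}. (m s)\<^sup>2)"
proof -
  have "lag_energy k = (\<Sum>s\<in>{k - D..<k}. real (D + s + 1 - k) * (m s)\<^sup>2)"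
    unfolding lag_energy_def by (rule sum.mono_neutral_right) auto
  also have "\<dots> \<le> (\<Sum>s\<in>{k - D..<k}. real D * (m s)\<^sup>2)"
    by (intro sum_mono mult_right_mono) auto
  finally show ?thesis
    by (simp add: sum_distrib_left)
qed

lemma lag_times_m_le:
  "lag k * m k \<le> 1/2 * (\<Sum>s\<in>{k - D..<k}. (m s)\<^sup>2) + D / 2 * (m k)\<^sup>2"
proof -
  have "lag k * m k = (\<Sum>s\<in>{k - D..<k}. m s * m k)"
    by (simp add: lag_def sum_distrib_right)
  also have "\<dots> \<le> (\<Sum>s\<in>{k - D..<k}. 1/2 * (m s)\<^sup>2 + 1/2 * (m k)\<^sup>2)"
  proof (rule sum_mono)
    fix s
    show "m s * m k \<le> 1/2 * (m s)\<^sup>2 + 1/2 * (m k)\<^sup>2"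
      using sum_squares_bound[of "m s" "m k"] by simp
  qed
  also have "\<dots> = 1/2 * (\<Sum>s\<in>{k - D..<k}. (m s)\<^sup>2) + real (card {k - D..<k}) * (1/2 * (m k)\<^sup>2)"
    by (simp add: sum.distrib sum_distrib_left)
  also have "real (card {k - D..<k}) * (1/2 * (m k)\<^sup>2) \<le> real D * (1/2 * (m k)\<^sup>2)"
    by (intro mult_right_mono) auto
  finally show ?thesis
    by simp
qed

text \<open>
  Splitting \<open>lag k * m k\<close> into squares, the part from earlier steps is paid for by the decay of the
  weights, and the parts in \<open>(m k)\<^sup>2\<close> take at most half of the decrease if \<open>\<gamma> / \<tau>\<close> is small.
\<close>

lemma Phi_step:
  assumes good: "compared_in_region k" and small: "\<gamma> * A * (D + 1) \<le> \<tau> / 2"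
  shows "\<Phi> (Suc k) \<le> \<Phi> k - \<gamma> * \<tau> / 2 * (m k)\<^sup>2"
proof -
  let ?s = "\<Sum>s\<in>{k - D..<k}. (m s)\<^sup>2"
  have "\<gamma> * (gradF (x k) \<bullet> \<delta> k + greg P (act k) (y k) - greg P (act k) (restr P {act k} (x k)))
      \<le> \<gamma> * (- \<tau> * (m k)\<^sup>2 + A * \<gamma> * lag k * m k)"
    using best_response_descent[OF good] gamma_bounds by (intro mult_left_mono) auto
  moreover have "A * \<gamma>\<^sup>2 * (lag k * m k) \<le> A * \<gamma>\<^sup>2 * (1/2 * ?s + D / 2 * (m k)\<^sup>2)"
    using lag_times_m_le A_nonneg by (intro mult_left_mono) auto
  moreover have "\<gamma> * (\<gamma> * A * (D + 1)) * (m k)\<^sup>2 \<le> \<gamma> * (\<tau> / 2) * (m k)\<^sup>2"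
    using small gamma_bounds by (intro mult_right_mono mult_left_mono) auto
  ultimately show ?thesis
    using V_step[OF good]
    by (simp add: \<Phi>_def lag_energy_Suc algebra_simps power2_eq_square)
qed

end


section \<open>Residual and optimality gap over a window of updates\<close>

context lipschitz_run
begin

text \<open>
  Every agent is active in \<open>{k..<k + B}\<close>; the window also reaches back \<open>B\<close> steps, because the
  data used from \<open>k\<close> on can be up to \<open>D \<le> B\<close> steps old.
\<close>

definition M :: "nat \<Rightarrow> real" where
  "M k = (\<Sum>s\<in>{k - B..<k + B}. m s)"

definition E :: "nat \<Rightarrow> real" where
  "E k = (\<Sum>s\<in>{k - B..<k + B}. (m s)\<^sup>2)"

lemma D_le_B: "D \<le> B" and card_le_B: "CARD('a) \<le> B"
  using schedule by (auto simp: assumption_D_def)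

lemma M_nonneg: "0 \<le> M k"
  by (simp add: M_def sum_nonneg m_nonneg)

lemma M_squared_le: "(M k)\<^sup>2 \<le> 2 * B * E k"
proof -
  have "(M k)\<^sup>2 \<le> E k * card {k - B..<k + B}"
    unfolding M_def E_def by (rule sum_squared_le_sum_of_squares)
  also have "\<dots> \<le> E k * (2 * B)"
    by (intro mult_left_mono) (auto simp: E_def sum_nonneg)
  finally show ?thesis
    by (simp add: mult.commute)
qed

lemma window_sum_le_M:
  assumes "I \<subseteq> {k - B..<k + B}"
  shows "(\<Sum>s\<in>I. m s) \<le> M k"
  unfolding M_def using assms by (intro sum_mono2) (auto simp: m_nonneg)

lemma lag_plus_m_le_M:
  assumes "k \<le> t" "t < k + B"
  shows "lag t + m t \<le> M k"
proof -
  have "lag t + m t = (\<Sum>s\<in>{t - D..<Suc t}. m s)"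
    by (simp add: lag_def)
  also have "\<dots> \<le> M k"
    using assms D_le_B by (intro window_sum_le_M) auto
  finally show ?thesis .
qed

lemma m_le_M: "k \<le> t \<Longrightarrow> t < k + B \<Longrightarrow> m t \<le> M k"
  using lag_plus_m_le_M[of k t] lag_nonneg[of t] by simp

lemma norm_x_diff_le_M:
  assumes "k \<le> t" "t \<le> k + B"
  shows "norm (x t - x k) \<le> M k"
proof -
  have "norm (x t - x k) \<le> \<gamma> * (\<Sum>s\<in>{k..<t}. m s)"
    by (rule norm_x_diff_le) fact
  also have "\<dots> \<le> (\<Sum>s\<in>{k..<t}. m s)"
    using gamma_bounds by (intro mult_left_le_one_le) (auto simp: sum_nonneg m_nonneg)
  also have "\<dots> \<le> M k"
    using assms by (intro window_sum_le_M) auto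
  finally show ?thesis .
qed

text \<open>Taking the first activation in the window lets the best response be compared with the block at the
  beginning of the window.\<close>

lemma first_activation:
  obtains t where "k \<le> t" "t < k + B" "act t = i" "restr P {i} (x t) = restr P {i} (x k)"
proof -
  have "i \<in> act ` {k..<k + B}"
    using schedule by (simp add: assumption_D_def)
  then have ex: "\<exists>t. k \<le> t \<and> t < k + B \<and> act t = i"
    by auto
  define t where "t = (LEAST t. k \<le> t \<and> t < k + B \<and> act t = i)"
  have t: "k \<le> t" "t < k + B" "act t = i"
    using LeastI_ex[OF ex] by (simp_all add: t_def)
  have "restr P {i} (\<delta> s) = 0" if s: "s \<in> {k..<t}" for s
  proof -
    have "act s \<noteq> i"
      using s t not_less_Least[of s "\<lambda>t. k \<le> t \<and> t < k + B \<and> act t = i"] by (auto simp: t_def)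
    then have "restr P {i} (restr P {act s} (\<delta> s)) = 0"
      by (simp add: restr_restr)
    then show ?thesis
      by (simp add: restr_delta)
  qed
  then have "restr P {i} (x t - x k) = 0"
    unfolding x_diff[OF t(1)] restr_sum restr_scaleR by (intro sum.neutral) auto
  then show ?thesis
    using t that by (simp add: restr_diff)
qed

text \<open>
  In units of \<open>M k\<close>, \<open>Q\<close> is the error of replacing a model gradient used in the window by the true
  gradient at its beginning.
\<close>

definition Q :: real where
  "Q = 2 * A + Lm"

lemma Q_nonneg: "0 \<le> Q"
  using A_nonneg Lm_nonneg by (simp add: Q_def)

lemma restr_gradF_window:
  assumes good: "\<And>k. compared_in_region k" and t: "k \<le> t" "t \<le> k + B"
  shows "norm (restr P {i} (gradF (x t)) - restr P {i} (gradF (x k))) \<le> A * M k"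
proof -
  have "norm (restr P {i} (gradF (x t)) - restr P {i} (gradF (x k))) \<le> A * norm (x t - x k)"
    unfolding A_def by (intro restr_gradF_lipschitz[OF region] compared_in_regionD good)
  also have "\<dots> \<le> A * M k"
    by (intro mult_left_mono norm_x_diff_le_M t A_nonneg)
  finally show ?thesis .
qed

lemma model_grad_window:
  assumes good: "\<And>k. compared_in_region k" and t: "k \<le> t" "t < k + B" "act t = i"
  shows "norm (q t - restr P {i} (gradF (x k))) \<le> Q * M k"
proof -
  have "norm (q t - restr P {i} (gradF (x t))) \<le> (A + Lm) * (lag t + m t)"
    using model_grad_error[OF good, of t] t by simp
  also have "\<dots> \<le> (A + Lm) * M k"
    using A_nonneg Lm_nonneg by (intro mult_left_mono lag_plus_m_le_M t) auto
  finally have "norm (q t - restr P {i} (gradF (x t))) \<le> (A + Lm) * M k" .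
  moreover have "norm (restr P {i} (gradF (x t)) - restr P {i} (gradF (x k))) \<le> A * M k"
    using t by (intro restr_gradF_window good) auto
  ultimately show ?thesis
    using norm_triangle_ineq[of "q t - restr P {i} (gradF (x t))" "restr P {i} (gradF (x t)) - restr P {i} (gradF (x k))"]
    by (simp add: Q_def algebra_simps)
qed

text \<open>
  The best response and the proximal point solve variational inequalities with the same \<open>greg P i\<close>;
  adding them bounds their distance by the displacement of the block and the difference of the
  gradients used.
\<close>

lemma residual_le:
  assumes good: "\<And>k. compared_in_region k"
  shows "residual P (x k) \<le> CARD('a) * (2 + Q) * M k"
proof -
  let ?p = "prox P (x k - gradF (x k))"
  have block: "norm (restr P {i} (x k - ?p)) \<le> (2 + Q) * M k" for i
  proof -
    obtain t where t: "k \<le> t" "t < k + B" "act t = i" "restr P {i} (x t) = restr P {i} (x k)"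
      by (rule first_activation)
    let ?pi = "restr P {i} ?p" and ?xi = "restr P {i} (x k)" and ?a = "restr P {i} (gradF (x k))"
    have y: "y t \<in> Xset P i" "norm (y t - ?xi) \<le> M k"
      using y_mem[of t] m_le_M[OF t(1,2)] t by (simp_all add: m_def \<delta>_def)
    have "(?pi - (?xi - ?a)) \<bullet> (y t - ?pi) + greg P i (y t) - greg P i ?pi \<ge> 0"
      using prox_block_variational_inequality[OF y(1), of "x k - gradF (x k)"] by (simp add: restr_diff)
    moreover have "q t \<bullet> (?pi - y t) + greg P i ?pi - greg P i (y t) \<ge> 0"
      using q_variational_inequality[of ?pi t] t by (simp add: restr_block_mem prox_minimizes)
    ultimately have "(y t - ?pi) \<bullet> (y t - ?pi) \<le> ((y t - ?xi) - (q t - ?a)) \<bullet> (y t - ?pi)"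
      by (simp add: inner_simps inner_commute)
    also have "\<dots> \<le> norm ((y t - ?xi) - (q t - ?a)) * norm (y t - ?pi)"
      by (rule norm_cauchy_schwarz)
    also have "\<dots> \<le> (M k + Q * M k) * norm (y t - ?pi)"
      using norm_triangle_ineq4[of "y t - ?xi" "q t - ?a"] y(2) model_grad_window[OF good t(1-3)]
      by (intro mult_right_mono) auto
    finally have "norm (y t - ?pi) * norm (y t - ?pi) \<le> (M k + Q * M k) * norm (y t - ?pi)"
      by (simp add: power2_norm_eq_inner flip: power2_eq_square)
    then have "norm (y t - ?pi) \<le> M k + Q * M k"
      using M_nonneg Q_nonneg by (cases "norm (y t - ?pi) = 0") (auto simp: mult_le_cancel_right)
    then have "norm (?xi - ?pi) \<le> M k + (M k + Q * M k)"
      using y(2) norm_triangle_ineq[of "?xi - y t" "y t - ?pi"] by (simp add: norm_minus_commute)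
    then show ?thesis
      by (simp add: restr_diff algebra_simps)
  qed
  have "residual P (x k) = norm (x k - ?p)"
    by (simp add: residual_def pgrad_F x_mem)
  also have "\<dots> \<le> (\<Sum>i\<in>UNIV. norm (restr P {i} (x k - ?p)))"
    by (rule norm_le_sum_restr)
  also have "\<dots> \<le> (\<Sum>i\<in>(UNIV::'a set). (2 + Q) * M k)"
    by (intro sum_mono block)
  finally show ?thesis
    by simp
qed

lemma Phi_decreasing:
  assumes good: "\<And>k. compared_in_region k" and small: "\<gamma> * A * (D + 1) \<le> \<tau> / 2"
  shows "j \<le> k \<Longrightarrow> \<Phi> k \<le> \<Phi> j"
proof (induction rule: dec_induct)
  case (step n)
  have "0 \<le> \<gamma> * \<tau> / 2 * (m n)\<^sup>2"
    using gamma_bounds tau_pos by simp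
  then show ?case
    using Phi_step[OF good small, of n] step by simp
qed simp

lemma sum_squares_le_Phi_diff:
  assumes good: "\<And>k. compared_in_region k" and small: "\<gamma> * A * (D + 1) \<le> \<tau> / 2"
  shows "j \<le> k \<Longrightarrow> \<gamma> * \<tau> / 2 * (\<Sum>s\<in>{j..<k}. (m s)\<^sup>2) \<le> \<Phi> j - \<Phi> k"
proof (induction rule: dec_induct)
  case (step n)
  then show ?case
    using Phi_step[OF good small, of n] by (simp add: distrib_left)
qed simp

lemma lag_energy_le_E:
  assumes "k \<le> t" "t \<le> k + B"
  shows "lag_energy t \<le> D * E k"
proof -
  have "(\<Sum>s\<in>{t - D..<t}. (m s)\<^sup>2) \<le> E k"
    unfolding E_def using assms D_le_B by (intro sum_mono2) auto
  then have "D * (\<Sum>s\<in>{t - D..<t}. (m s)\<^sup>2) \<le> D * E k"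
    by (rule mult_left_mono) simp
  then show ?thesis
    using lag_energy_le[of t] by simp
qed

text \<open>
  Since \<open>g\<close> has no Lipschitz constant, the change of \<open>greg P i\<close> between the current block and its best
  response is read off from the decrease of the objective in the step. A relaxed step realises only
  the fraction \<open>\<gamma>\<close> of that change, hence the factor \<open>1 / \<gamma>\<close>.
\<close>

lemma block_gap_le:
  assumes good: "\<And>k. compared_in_region k" and small: "\<gamma> * A * (D + 1) \<le> \<tau> / 2"
    and xb: "xb \<in> X" "norm (x k - xb) \<le> R * M k" and R: "0 \<le> R"
  shows "greg P i (restr P {i} (x k)) - greg P i (restr P {i} xb)
    \<le> restr P {i} (gradF (x k)) \<bullet> restr P {i} (xb - x k) + (Q * (R + 1) + 2 * A) * (M k)\<^sup>2
      + A * D * E k + (\<Phi> k - \<Phi> (k + B)) / \<gamma>"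
proof -
  obtain t where t: "k \<le> t" "t < k + B" "act t = i" "restr P {i} (x t) = restr P {i} (x k)"
    by (rule first_activation)
  let ?xi = "restr P {i} (x k)" and ?bi = "restr P {i} xb"
  let ?a = "restr P {i} (gradF (x k))" and ?b = "restr P {i} (gradF (x t))"
  have delta: "\<delta> t = y t - ?xi"
    using t by (simp add: \<delta>_def)
  have mt: "norm (\<delta> t) \<le> M k"
    using m_le_M[OF t(1,2)] by (simp add: m_def)
  have "norm (?bi - y t) \<le> norm (?bi - ?xi) + norm (\<delta> t)"
    using norm_triangle_ineq4[of "?bi - ?xi" "\<delta> t"] by (simp add: delta)
  also have "norm (?bi - ?xi) \<le> R * M k"
    using norm_restr_le[of P "{i}" "xb - x k"] xb(2) by (simp add: restr_diff norm_minus_commute)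
  finally have by_le: "norm (?bi - y t) \<le> (R + 1) * M k"
    using mt by (simp add: algebra_simps)
  have 1: "greg P i (y t) - greg P i ?bi \<le> q t \<bullet> (?bi - y t)"
    using q_variational_inequality[of ?bi t] t restr_block_mem[OF xb(1), of i] by simp
  have "V P (x (Suc t)) \<le> V P (x t) + \<gamma> * (gradF (x t) \<bullet> \<delta> t + greg P i (y t) - greg P i ?xi)
      + A * \<gamma>\<^sup>2 * (m t)\<^sup>2"
    using V_step[OF good, of t] t by simp
  moreover have "V P (x t) - V P (x (Suc t)) \<le> (\<Phi> k - \<Phi> (k + B)) + \<gamma>\<^sup>2 * A / 2 * (D * E k)"
  proof -
    have "\<gamma>\<^sup>2 * A / 2 * lag_energy (Suc t) \<le> \<gamma>\<^sup>2 * A / 2 * (D * E k)"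
      using t A_nonneg by (intro mult_left_mono lag_energy_le_E) auto
    moreover have "\<Phi> t \<le> \<Phi> k" "\<Phi> (k + B) \<le> \<Phi> (Suc t)"
      using t by (auto intro!: Phi_decreasing[OF good small])
    ultimately show ?thesis
      using V_le_Phi[of t] by (simp add: \<Phi>_def)
  qed
  ultimately have "\<gamma> * (greg P i ?xi - greg P i (y t)) \<le> \<gamma> * (gradF (x t) \<bullet> \<delta> t) + A * \<gamma>\<^sup>2 * (m t)\<^sup>2
      + \<gamma>\<^sup>2 * A / 2 * (D * E k) + (\<Phi> k - \<Phi> (k + B))"
    by (simp add: algebra_simps)
  also have "\<dots> = \<gamma> * (gradF (x t) \<bullet> \<delta> t + \<gamma> * (A * (m t)\<^sup>2) + \<gamma> * (A / 2 * (D * E k)) + (\<Phi> k - \<Phi> (k + B)) / \<gamma>)"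
    using gamma_bounds by (simp add: field_simps power2_eq_square)
  finally have "greg P i ?xi - greg P i (y t) \<le> gradF (x t) \<bullet> \<delta> t + \<gamma> * (A * (m t)\<^sup>2)
      + \<gamma> * (A / 2 * (D * E k)) + (\<Phi> k - \<Phi> (k + B)) / \<gamma>"
    using gamma_bounds by (simp only: mult_le_cancel_left_pos)
  moreover have "gradF (x t) \<bullet> \<delta> t = ?b \<bullet> \<delta> t"
    using gradF_inner_delta[of "x t" t] t by simp
  moreover have "\<gamma> * (A * (m t)\<^sup>2) \<le> A * (M k)\<^sup>2"
  proof -
    have "\<gamma> * (A * (m t)\<^sup>2) \<le> A * (m t)\<^sup>2"
      using gamma_bounds A_nonneg by (intro mult_left_le_one_le) auto
    also have "\<dots> \<le> A * (M k)\<^sup>2"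
      using A_nonneg m_nonneg by (intro mult_left_mono power_mono m_le_M t) auto
    finally show ?thesis .
  qed
  moreover have "\<gamma> * (A / 2 * (D * E k)) \<le> A * D * E k"
  proof -
    have "\<gamma> * (A / 2 * (D * E k)) \<le> A / 2 * (D * E k)"
      using gamma_bounds A_nonneg by (intro mult_left_le_one_le) (auto simp: E_def sum_nonneg)
    moreover have "0 \<le> A * D * E k"
      using A_nonneg by (simp add: E_def sum_nonneg)
    ultimately show ?thesis
      by simp
  qed
  moreover have "q t \<bullet> (?bi - y t) + ?b \<bullet> \<delta> t
      = ?a \<bullet> (?bi - ?xi) + (q t - ?a) \<bullet> (?bi - y t) + (?b - ?a) \<bullet> \<delta> t"
    unfolding delta by (simp add: inner_simps)
  moreover have "(q t - ?a) \<bullet> (?bi - y t) \<le> (Q * M k) * ((R + 1) * M k)"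
    using model_grad_window[OF good t(1-3)] by_le M_nonneg Q_nonneg R
    by (intro order_trans[OF norm_cauchy_schwarz] mult_mono) auto
  moreover have "(?b - ?a) \<bullet> \<delta> t \<le> (A * M k) * M k"
    using restr_gradF_window[OF good, of k t i] t mt M_nonneg A_nonneg
    by (intro order_trans[OF norm_cauchy_schwarz] mult_mono) auto
  ultimately show ?thesis
    using 1 by (simp add: restr_diff power2_eq_square algebra_simps)
qed

text \<open>
  Neither \<open>\<gamma>\<close> nor \<open>\<tau>\<close> occurs in this constant, so that the threshold for \<open>\<gamma> / \<tau>\<close> can be chosen
  in terms of it.
\<close>

definition C_gap :: "real \<Rightarrow> real" where
  "C_gap R = CARD('a) * (A * R\<^sup>2 + Q * (R + 1) + 2 * A) * (2 * B) + CARD('a) * (A * D) + A * D"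

text \<open>
  The linear terms of \<open>F\<close> and of the blocks of \<open>G\<close> at \<open>x k\<close> cancel. What remains is of second order
  in the displacements, apart from the decrease of \<open>\<Phi>\<close> counted once for each agent.
\<close>

lemma gap_le:
  assumes good: "\<And>k. compared_in_region k" and small: "\<gamma> * A * (D + 1) \<le> \<tau> / 2"
    and xb: "xb \<in> X" "norm (x k - xb) \<le> R * M k" and R: "0 \<le> R"
    and seg: "\<And>t. 0 \<le> t \<Longrightarrow> t \<le> 1 \<Longrightarrow> x k + t *\<^sub>R (xb - x k) \<in> S"
  shows "\<Phi> k - V P xb \<le> C_gap R * E k + CARD('a) / \<gamma> * (\<Phi> k - \<Phi> (k + B))"
proof -
  let ?N = "real CARD('a)"
  have "(norm (xb - x k))\<^sup>2 \<le> (R * M k)\<^sup>2"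
    using xb(2) by (intro power_mono) (auto simp: norm_minus_commute)
  then have n: "?N * A * (norm (xb - x k))\<^sup>2 \<le> ?N * A * (R\<^sup>2 * (M k)\<^sup>2)"
    using A_nonneg by (intro mult_left_mono) (auto simp: power_mult_distrib)
  have "\<bar>F P xb - F P (x k) - gradF (x k) \<bullet> (xb - x k)\<bar> \<le> ?N * A * (norm (xb - x k))\<^sup>2"
    using F_linearization_error[OF region seg] by (simp add: A_def)
  then have "F P (x k) - F P xb \<le> ?N * A * (R\<^sup>2 * (M k)\<^sup>2) - gradF (x k) \<bullet> (xb - x k)"
    using n by linarith
  moreover have "G P (x k) - G P xb \<le> gradF (x k) \<bullet> (xb - x k) + ?N * ((Q * (R + 1) + 2 * A) * (M k)\<^sup>2)
      + ?N * (A * D * E k) + ?N * ((\<Phi> k - \<Phi> (k + B)) / \<gamma>)"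
  proof -
    have "G P (x k) - G P xb = (\<Sum>i\<in>UNIV. greg P i (restr P {i} (x k)) - greg P i (restr P {i} xb))"
      by (simp add: G_def sum_subtractf)
    also have "\<dots> \<le> (\<Sum>i\<in>UNIV. restr P {i} (gradF (x k)) \<bullet> restr P {i} (xb - x k)
        + (Q * (R + 1) + 2 * A) * (M k)\<^sup>2 + A * D * E k + (\<Phi> k - \<Phi> (k + B)) / \<gamma>)"
      by (intro sum_mono block_gap_le[OF good small xb R])
    finally show ?thesis
      by (simp only: sum.distrib sum_inner_restr sum_constant)
  qed
  moreover have "\<Phi> k - V P (x k) \<le> A * D * E k"
  proof -
    have "\<gamma>\<^sup>2 / 2 * (A * lag_energy k) \<le> A * lag_energy k"
      using gamma_bounds A_nonneg lag_energy_nonneg power_le_one[of \<gamma> 2]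
      by (intro mult_left_le_one_le) auto
    also have "\<dots> \<le> A * (D * E k)"
      using A_nonneg by (intro mult_left_mono lag_energy_le_E) auto
    finally show ?thesis
      by (simp add: \<Phi>_def mult.assoc)
  qed
  moreover have "?N * (A * R\<^sup>2 + Q * (R + 1) + 2 * A) * (M k)\<^sup>2 \<le> ?N * (A * R\<^sup>2 + Q * (R + 1) + 2 * A) * (2 * B * E k)"
    using A_nonneg Q_nonneg R by (intro mult_left_mono M_squared_le) auto
  ultimately show ?thesis
    by (simp add: V_def C_gap_def algebra_simps add_divide_distrib diff_divide_distrib)
qed

text \<open>
  The iterates can lie below a nearby stationary point only to second order, because the first-order
  change of the objective there is nonnegative in feasible directions.
\<close>

lemma gap_lower:
  assumes good: "\<And>k. compared_in_region k"
    and xb: "xb \<in> stationary P" "norm (x k - xb) \<le> R * M k"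
    and seg: "\<And>t. 0 \<le> t \<Longrightarrow> t \<le> 1 \<Longrightarrow> x k + t *\<^sub>R (xb - x k) \<in> S"
  shows "V P xb - V P (x k) \<le> CARD('a) * A * R\<^sup>2 * (M k)\<^sup>2"
proof -
  let ?N = "real CARD('a)"
  have "\<bar>F P (xb + (x k - xb)) - F P xb - gradF xb \<bullet> (x k - xb)\<bar> \<le> ?N * (rho P * L) * (norm (x k - xb))\<^sup>2"
  proof (rule F_linearization_error[OF region])
    fix t :: real assume "0 \<le> t" "t \<le> 1"
    moreover have "xb + t *\<^sub>R (x k - xb) = x k + (1 - t) *\<^sub>R (xb - x k)"
      by (simp add: algebra_simps)
    ultimately show "xb + t *\<^sub>R (x k - xb) \<in> S"
      using seg[of "1 - t"] by simp
  qed
  then have "\<bar>F P (x k) - F P xb - gradF xb \<bullet> (x k - xb)\<bar> \<le> ?N * A * (norm (x k - xb))\<^sup>2"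
    by (simp add: A_def)
  moreover have "gradF xb \<bullet> (x k - xb) + G P (x k) - G P xb \<ge> 0"
    by (rule stationaryD(2)[OF xb(1) x_mem])
  moreover have "?N * A * (norm (x k - xb))\<^sup>2 \<le> ?N * A * (R * M k)\<^sup>2"
    using A_nonneg by (intro mult_left_mono power_mono xb) auto
  moreover have "?N * A * (R * M k)\<^sup>2 = ?N * A * R\<^sup>2 * (M k)\<^sup>2"
    by (simp add: power_mult_distrib)
  ultimately show ?thesis
    unfolding V_def by linarith
qed

end


section \<open>Linear convergence\<close>

lemma geometric_decay:
  fixes a :: "nat \<Rightarrow> real"
  assumes dec: "\<And>k. a (Suc k) \<le> a k" and nonneg: "\<And>k. 0 \<le> a k" and lam: "0 < lam" "lam < 1"
    and contr: "\<And>k. K \<le> k \<Longrightarrow> a (k + p) \<le> lam ^ p * a k"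
    and p: "0 < p"
  obtains C where "0 \<le> C" "\<And>k. K \<le> k \<Longrightarrow> a k \<le> C * lam ^ k"
proof -
  define C where "C = a K / lam ^ (K + p)"
  have C0: "0 \<le> C"
    using nonneg lam by (simp add: C_def)
  have "a k \<le> C * lam ^ k" if "K \<le> k" for k
    using that
  proof (induction k rule: less_induct)
    case (less k)
    show ?case
    proof (cases "k < K + p")
      case True
      have "a k \<le> a K"
        using less.prems dec by (rule lift_Suc_antimono_le[rotated])
      also have "\<dots> = C * lam ^ (K + p)"
        using lam by (simp add: C_def)
      also have "\<dots> \<le> C * lam ^ k"
        using True lam C0 by (intro mult_left_mono power_decreasing) auto
      finally show ?thesis .
    next
      case False
      then have "a k \<le> lam ^ p * a (k - p)"
        using contr[of "k - p"] by simp
      also have "\<dots> \<le> lam ^ p * (C * lam ^ (k - p))"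
        using less.IH[of "k - p"] False p lam by (intro mult_left_mono) auto
      also have "\<dots> = C * lam ^ k"
        using False by (simp flip: power_add)
      finally show ?thesis .
    qed
  qed
  then show ?thesis
    using C0 that by blast
qed

lemma geometric_steps_converge:
  fixes x :: "nat \<Rightarrow> 'b::banach"
  assumes r: "0 \<le> r" "r < 1" and C: "0 \<le> C"
    and step: "\<And>k. K \<le> k \<Longrightarrow> norm (x (Suc k) - x k) \<le> C * r ^ k"
  obtains l where "x \<longlonglongrightarrow> l" "\<And>k. K \<le> k \<Longrightarrow> norm (x k - l) \<le> C / (1 - r) * r ^ k"
proof -
  have tail: "norm (x j - x k) \<le> C / (1 - r) * (r ^ k - r ^ j)" if "K \<le> k" "k \<le> j" for j k
    using that(2)
  proof (induction rule: dec_induct)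
    case (step n)
    have "norm (x (Suc n) - x k) \<le> norm (x (Suc n) - x n) + norm (x n - x k)"
      using norm_triangle_ineq[of "x (Suc n) - x n" "x n - x k"] by simp
    also have "\<dots> \<le> C * r ^ n + C / (1 - r) * (r ^ k - r ^ n)"
      using step that(1) assms(4)[of n] by (intro add_mono) auto
    also have "\<dots> = C / (1 - r) * (r ^ k - r ^ Suc n)"
      using r by (simp add: field_simps)
    finally show ?case .
  qed simp
  have bound: "norm (x j - x k) \<le> C / (1 - r) * r ^ k" if "K \<le> k" "k \<le> j" for j k
  proof -
    have "C / (1 - r) * (r ^ k - r ^ j) \<le> C / (1 - r) * r ^ k"
      using r C by (intro mult_left_mono) auto
    then show ?thesis
      using tail[OF that] by simp
  qed
  have lim0: "(\<lambda>k. C / (1 - r) * r ^ k) \<longlonglongrightarrow> 0"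
    using r by (intro tendsto_mult_right_zero LIMSEQ_power_zero) auto
  have "Cauchy x"
  proof (rule metric_CauchyI)
    fix e :: real assume "0 < e"
    then have "eventually (\<lambda>k. C / (1 - r) * r ^ k < e / 2) sequentially"
      using lim0 by (intro order_tendstoD) auto
    then obtain n where n: "C / (1 - r) * r ^ k < e / 2" if "n \<le> k" for k
      by (auto simp: eventually_sequentially)
    have "dist (x i) (x j) < e" if "max n K \<le> i" "max n K \<le> j" for i j
    proof -
      have "dist (x i') (x (max n K)) < e / 2" if "max n K \<le> i'" for i'
        unfolding dist_norm by (rule le_less_trans[OF bound n]) (use that in auto)
      from this[OF that(1)] this[OF that(2)]
      show ?thesis
        by (rule dist_triangle_half_l)
    qed
    then show "\<exists>n. \<forall>i\<ge>n. \<forall>j\<ge>n. dist (x i) (x j) < e"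
      by blast
  qed
  then obtain l where l: "x \<longlonglongrightarrow> l"
    using Cauchy_convergent convergent_def by blast
  moreover have "norm (x k - l) \<le> C / (1 - r) * r ^ k" if "K \<le> k" for k
  proof (rule Lim_bounded)
    show "(\<lambda>j. norm (x k - x j)) \<longlonglongrightarrow> norm (x k - l)"
      by (intro tendsto_intros l)
    show "\<forall>j\<ge>k. norm (x k - x j) \<le> C / (1 - r) * r ^ k"
      using bound[OF that] by (simp add: norm_minus_commute)
  qed
  ultimately show ?thesis
    using that by blast
qed

context lipschitz_run
begin

text \<open>In units of \<open>M k\<close>, a bound on the distance to the stationary set when the error bound has constant \<open>\<kappa>\<close>.\<close>

definition R :: "real \<Rightarrow> real" where
  "R \<kappa> = \<kappa> * (CARD('a) * (2 + Q))"

text \<open>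
  A run without moves escapes the bound on \<open>\<tau>\<close> in terms of the Lipschitz constants and is treated
  apart: the residual estimate then says that the residual vanishes.
\<close>

lemma zero_steps_stationary:
  assumes x0: "x0 \<in> S" and zero: "\<And>k. \<delta> k = 0"
  shows "x k = x0" and "x0 \<in> stationary P"
proof -
  have x_eq: "x k = x0" for k
    using algorithm by (induction k) (auto simp: step_properties(2) zero DAsyFLEXA_def)
  then show "x k = x0" .
  have "stale k j = x0" for k j
    by (simp add: vec_eq_iff stale_def x_eq)
  then have "compared_in_region k" for k
    by (simp add: step_within_def x_eq zero x0)
  then have "residual P (x 0) \<le> CARD('a) * (2 + Q) * M 0"
    by (rule residual_le)
  moreover have "M 0 = 0"
    by (simp add: M_def m_def zero)
  moreover have "0 \<le> residual P (x 0)"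
    by (simp add: residual_def)
  ultimately show "x0 \<in> stationary P"
    using residual_zero_stationary[OF x_mem[of 0]] by (simp add: x_eq)
qed

text \<open>
  The squared displacements in a window are at most \<open>2 / (\<gamma> * \<tau>)\<close> times the decrease of \<open>\<Phi>\<close> over
  \<open>2 * B\<close> steps. Inserted into the gap estimate this bounds the gap by a multiple of its own decrease,
  which is a contraction. The point \<open>xb k\<close> below is a nearest stationary point; its value
  stabilises because consecutive ones come closer than the separation \<open>\<epsilon>\<close> of different values.
\<close>

theorem linear_convergence:
  assumes good: "\<And>k. compared_in_region k" and small: "\<gamma> * A * (D + 1) \<le> \<tau> / 2"
    and tau: "\<tau> \<le> L + Lm" and kappa: "0 < \<kappa>"
    and eb: "\<forall>\<^sub>F k in sequentially. infdist (x k) (stationary P) \<le> \<kappa> * residual P (x k)"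
    and near: "0 < r" "\<And>k z. z \<in> X \<Longrightarrow> norm (z - x k) \<le> r \<Longrightarrow> z \<in> S"
    and separated: "0 < \<epsilon>" "\<And>u v. u \<in> stationary P \<Longrightarrow> v \<in> stationary P \<Longrightarrow> V P u \<noteq> V P v \<Longrightarrow> \<epsilon> \<le> norm (u - v)"
    and minimum: "x\<^sub>m \<in> X" "\<And>z. z \<in> X \<Longrightarrow> V P x\<^sub>m \<le> V P z"
    and lam: "0 < lam" "lam < 1"
    and rate: "1 / (1 + \<gamma> * \<tau> / (2 * C_gap (R \<kappa>) + CARD('a) * (L + Lm))) \<le> lam ^ (2 * B)"
  shows "\<exists>xs\<in>stationary P. \<exists>C K. \<forall>k\<ge>K. \<bar>V P (x k) - V P xs\<bar> \<le> C * lam ^ k \<and>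
    norm (x k - xs) \<le> C * sqrt (lam ^ k)"
proof -
  let ?N = "real CARD('a)"
  define C6 where "C6 = 2 * C_gap (R \<kappa>) + ?N * (L + Lm)"
  have gt: "0 < \<gamma> * \<tau>"
    using gamma_bounds tau_pos by simp
  have R0: "0 \<le> R \<kappa>"
    using kappa Q_nonneg by (simp add: R_def)
  have Cg0: "0 \<le> C_gap (R \<kappa>)"
    unfolding C_gap_def using R0 A_nonneg Q_nonneg by (intro add_nonneg_nonneg mult_nonneg_nonneg) auto
  have T0: "0 < ?N * (L + Lm)"
    using tau tau_pos by simp
  then have C6: "0 < C6"
    using Cg0 by (simp add: C6_def)
  have mono: "\<Phi> k \<le> \<Phi> j" if "j \<le> k" for j k
    by (rule Phi_decreasing[OF good small that])
  have bounded: "V P x\<^sub>m \<le> \<Phi> k" for k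
    using minimum(2)[OF x_mem] V_le_Phi[of k] by (rule order_trans)
  have "decseq \<Phi>"
    using mono by (simp add: decseq_def)
  then obtain l where l: "\<Phi> \<longlonglongrightarrow> l"
    using decseq_convergent[of \<Phi> "V P x\<^sub>m"] bounded by blast
  have E_le: "\<gamma> * \<tau> / 2 * E k \<le> \<Phi> (k - B) - \<Phi> (k + B)" for k
    unfolding E_def by (rule sum_squares_le_Phi_diff[OF good small]) simp
  have "(\<lambda>k. \<Phi> (k - B) - \<Phi> (k + B)) \<longlonglongrightarrow> l - l"
    by (intro tendsto_diff LIMSEQ_ignore_initial_segment l
        filterlim_compose[OF l filterlim_minus_const_nat_at_top])
  from tendsto_mult_left[OF this, of "2 / (\<gamma> * \<tau>)"]
  have null: "(\<lambda>k. 2 / (\<gamma> * \<tau>) * (\<Phi> (k - B) - \<Phi> (k + B))) \<longlonglongrightarrow> 0"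
    by simp
  have E_le': "E k \<le> 2 / (\<gamma> * \<tau>) * (\<Phi> (k - B) - \<Phi> (k + B))" for k
    using E_le[of k] gt by (simp add: field_simps)
  have E0: "0 \<le> E k" for k
    by (simp add: E_def sum_nonneg)
  have "norm (E k) \<le> 2 / (\<gamma> * \<tau>) * (\<Phi> (k - B) - \<Phi> (k + B))" for k
    using E_le'[of k] E0[of k] by (simp only: real_norm_def abs_of_nonneg)
  then have E_lim: "E \<longlonglongrightarrow> 0"
    by (intro Lim_null_comparison[OF always_eventually null] allI)
  have "norm ((M k)\<^sup>2) \<le> 2 * B * E k" for k
    using M_squared_le[of k] by simp
  then have M2_lim: "(\<lambda>k. (M k)\<^sup>2) \<longlonglongrightarrow> 0"
    by (intro Lim_null_comparison[OF always_eventually tendsto_mult_right_zero[OF E_lim]] allI)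
  then have M_lim: "M \<longlonglongrightarrow> 0"
    using tendsto_real_sqrt[OF M2_lim] M_nonneg by simp

  have ne: "stationary P \<noteq> {}"
    using minimizer_stationary[OF minimum] by blast
  have "\<exists>z\<in>stationary P. infdist (x k) (stationary P) = dist (x k) z" for k
    using infdist_attains_inf[OF closed_stationary ne, of "x k"] by auto
  then obtain xb where xb: "\<And>k. xb k \<in> stationary P"
    and xb_dist: "\<And>k. infdist (x k) (stationary P) = dist (x k) (xb k)"
    by metis
  have xb_near: "\<forall>\<^sub>F k in sequentially. norm (x k - xb k) \<le> R \<kappa> * M k"
    using eb
  proof eventually_elim
    case (elim k)
    have "\<kappa> * residual P (x k) \<le> \<kappa> * (?N * (2 + Q) * M k)"
      using residual_le[OF good] kappa by (intro mult_left_mono) auto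
    then show ?case
      using elim by (simp add: xb_dist dist_norm R_def mult.assoc)
  qed
  have RM_lim: "(\<lambda>k. R \<kappa> * M k) \<longlonglongrightarrow> 0"
    by (rule tendsto_mult_right_zero[OF M_lim])
  have xb_lim: "(\<lambda>k. x k - xb k) \<longlonglongrightarrow> 0"
    by (rule Lim_null_comparison[OF xb_near RM_lim])
  have m_lim: "(\<lambda>k. x (Suc k) - x k) \<longlonglongrightarrow> 0"
  proof (rule Lim_null_comparison[OF always_eventually M_lim], rule allI)
    fix k
    have "0 < B"
      using card_le_B zero_less_card_finite[where 'a = 'a] by linarith
    then show "norm (x (Suc k) - x k) \<le> M k"
      by (intro norm_x_diff_le_M) auto
  qed
  have "(\<lambda>k. (x (Suc k) - x k) + (x k - xb k) - (x (Suc k) - xb (Suc k))) \<longlonglongrightarrow> 0 + 0 - 0"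
    by (intro tendsto_intros m_lim xb_lim LIMSEQ_Suc)
  then have "(\<lambda>k. norm (xb (Suc k) - xb k)) \<longlonglongrightarrow> 0"
    by (intro tendsto_norm_zero) simp
  then have xb_close: "\<forall>\<^sub>F k in sequentially. norm (xb (Suc k) - xb k) < \<epsilon>"
    using separated(1) by (rule order_tendstoD)
  have "\<forall>\<^sub>F k in sequentially. R \<kappa> * M k < r"
    using RM_lim near(1) by (rule order_tendstoD)
  then obtain K where K: "\<And>k. K \<le> k \<Longrightarrow> norm (x k - xb k) \<le> R \<kappa> * M k"
      "\<And>k. K \<le> k \<Longrightarrow> norm (xb (Suc k) - xb k) < \<epsilon>" "\<And>k. K \<le> k \<Longrightarrow> R \<kappa> * M k < r"
    using eventually_conj[OF xb_near eventually_conj[OF xb_close]]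
    unfolding eventually_sequentially by (metis (no_types, lifting))
  define Vs where "Vs = V P (xb K)"
  have V_xb: "V P (xb k) = Vs" if "K \<le> k" for k
    using that
  proof (induction rule: dec_induct)
    case (step n)
    then show ?case
      using separated(2)[OF xb xb, of "Suc n" n] K(2)[of n] by force
  qed (simp add: Vs_def)
  have seg: "x k + t *\<^sub>R (xb k - x k) \<in> S" if "K \<le> k" "0 \<le> t" "t \<le> 1" for k t
  proof (rule near(2))
    show "x k + t *\<^sub>R (xb k - x k) \<in> X"
      using stationaryD(1)[OF xb] that by (intro segment_mem_X x_mem) auto
    have "t * norm (x k - xb k) \<le> norm (x k - xb k)"
      using that by (intro mult_left_le_one_le) auto
    then show "norm (x k + t *\<^sub>R (xb k - x k) - x k) \<le> r"
      using K(1,3)[OF that(1)] that by (simp add: norm_minus_commute)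
  qed

  \<comment> \<open>The gap decreases along the run, and its limit is nonnegative because \<open>gap_lower\<close> allows only
    vanishing negative values; hence it is nonnegative throughout.\<close>
  define a where "a k = \<Phi> k - Vs" for k
  have lower: "Vs - V P (x k) \<le> ?N * A * (R \<kappa>)\<^sup>2 * (M k)\<^sup>2" if "K \<le> k" for k
    using gap_lower[OF good xb K(1)[OF that] seg[OF that]] V_xb[OF that] by simp
  have "0 \<le> l - Vs"
  proof (rule LIMSEQ_le)
    show "(\<lambda>k. - (?N * A * (R \<kappa>)\<^sup>2 * (M k)\<^sup>2)) \<longlonglongrightarrow> 0"
      using tendsto_minus[OF tendsto_mult_right_zero[OF M2_lim]] by simp
    show "a \<longlonglongrightarrow> l - Vs"
      unfolding a_def by (intro tendsto_intros l)
    have "- (?N * A * (R \<kappa>)\<^sup>2 * (M k)\<^sup>2) \<le> a k" if "K \<le> k" for k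
      using lower[OF that] V_le_Phi[of k] by (simp add: a_def)
    then show "\<exists>K. \<forall>k\<ge>K. - (?N * A * (R \<kappa>)\<^sup>2 * (M k)\<^sup>2) \<le> a k"
      by blast
  qed
  moreover have "l \<le> \<Phi> k" for k
    using decseq_ge[OF _ l] mono by (simp add: decseq_def)
  ultimately have a0: "0 \<le> a k" for k
    by (smt (verit) a_def)
  have a_Suc: "a (Suc k) \<le> a k" for k
    using mono[of k "Suc k"] by (simp add: a_def)
  have contraction: "a (k + 2 * B) \<le> lam ^ (2 * B) * a k" if k: "K \<le> k" for k
  proof -
    let ?k = "k + B"
    have kK: "K \<le> ?k"
      using k by simp
    define b where "b = a k - a (k + 2 * B)"
    have idx: "?k - B = k" "?k + B = k + 2 * B"
      by simp_all
    have b_Phi: "\<Phi> k - \<Phi> (k + 2 * B) = b"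
      by (simp add: b_def a_def)
    have "a ?k \<le> C_gap (R \<kappa>) * E ?k + ?N / \<gamma> * (\<Phi> ?k - \<Phi> (?k + B))"
      using gap_le[OF good small stationaryD(1)[OF xb] K(1)[OF kK] R0 seg[OF kK]] V_xb[OF kK] by (simp add: a_def)
    moreover have "C_gap (R \<kappa>) * E ?k \<le> C_gap (R \<kappa>) * (2 / (\<gamma> * \<tau>) * b)"
      using E_le'[of ?k] unfolding idx b_Phi by (rule mult_left_mono[OF _ Cg0])
    moreover have "?N / \<gamma> * (\<Phi> ?k - \<Phi> (?k + B)) \<le> (?N * (L + Lm)) / (\<gamma> * \<tau>) * b"
    proof (rule mult_mono)
      have "?N * \<tau> \<le> ?N * (L + Lm)"
        using tau by simp
      then have "?N * \<tau> / (\<gamma> * \<tau>) \<le> ?N * (L + Lm) / (\<gamma> * \<tau>)"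
        using gt by (intro divide_right_mono) auto
      then show "?N / \<gamma> \<le> ?N * (L + Lm) / (\<gamma> * \<tau>)"
        using tau_pos by simp
      show "\<Phi> ?k - \<Phi> (?k + B) \<le> b"
        using mono[of k ?k] unfolding idx b_Phi[symmetric] by simp
      show "0 \<le> ?N * (L + Lm) / (\<gamma> * \<tau>)"
        using T0 gt by (intro divide_nonneg_nonneg) auto
      show "0 \<le> \<Phi> ?k - \<Phi> (?k + B)"
        using mono[of ?k "?k + B"] by simp
    qed
    moreover have "C6 / (\<gamma> * \<tau>) * b
        = C_gap (R \<kappa>) * (2 / (\<gamma> * \<tau>) * b) + (?N * (L + Lm)) / (\<gamma> * \<tau>) * b"
      by (simp add: C6_def add_divide_distrib distrib_right)
    ultimately have "a ?k \<le> C6 / (\<gamma> * \<tau>) * b"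
      by linarith
    moreover have "a (k + 2 * B) \<le> a ?k"
      using mono[of ?k "k + 2 * B"] by (simp add: a_def)
    ultimately have "a (k + 2 * B) \<le> C6 / (\<gamma> * \<tau>) * b"
      by simp
    then have "\<gamma> * \<tau> / C6 * a (k + 2 * B) \<le> b"
      using gt C6 by (simp add: field_simps)
    then have "(1 + \<gamma> * \<tau> / C6) * a (k + 2 * B) \<le> a k"
      by (simp add: b_def algebra_simps)
    moreover have "0 < 1 + \<gamma> * \<tau> / C6"
      using gt C6 by (intro add_pos_pos divide_pos_pos) auto
    ultimately have "a (k + 2 * B) \<le> 1 / (1 + \<gamma> * \<tau> / C6) * a k"
      by (simp add: field_simps)
    also have "\<dots> \<le> lam ^ (2 * B) * a k"
      using rate a0 unfolding C6_def by (intro mult_right_mono) auto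
    finally show ?thesis .
  qed
  have B2: "0 < 2 * B"
    using card_le_B zero_less_card_finite[where 'a = 'a] by linarith
  obtain C where C: "0 \<le> C" "\<And>k. K \<le> k \<Longrightarrow> a k \<le> C * lam ^ k"
    using geometric_decay[OF a_Suc a0 lam contraction B2] by blast
  have step: "norm (x (Suc k) - x k) \<le> sqrt (2 / (\<gamma> * \<tau>) * C) * (sqrt lam) ^ k" if "K \<le> k" for k
  proof -
    have "\<gamma> * \<tau> / 2 * (m k)\<^sup>2 \<le> a k"
      using Phi_step[OF good small, of k] a0[of "Suc k"] by (simp add: a_def)
    then have "(m k)\<^sup>2 \<le> 2 / (\<gamma> * \<tau>) * a k"
      using gt by (simp add: field_simps)
    also have "\<dots> \<le> 2 / (\<gamma> * \<tau>) * (C * lam ^ k)"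
      using C(2)[OF that] gt by (intro mult_left_mono) auto
    finally have "m k \<le> sqrt (2 / (\<gamma> * \<tau>) * C * lam ^ k)"
      by (intro real_le_rsqrt) (simp add: mult.assoc)
    moreover have "norm (x (Suc k) - x k) \<le> m k"
      using gamma_bounds by (simp add: step_properties(2) m_def mult_left_le_one_le)
    moreover have "sqrt (2 / (\<gamma> * \<tau>) * C * lam ^ k) = sqrt (2 / (\<gamma> * \<tau>) * C) * (sqrt lam) ^ k"
      by (simp only: real_sqrt_mult real_sqrt_power)
    ultimately show ?thesis
      by linarith
  qed
  have sq: "0 \<le> sqrt lam" "sqrt lam < 1" and Cs: "0 \<le> sqrt (2 / (\<gamma> * \<tau>) * C)"
    using lam C(1) gt by simp_all
  obtain xs where xs: "x \<longlonglongrightarrow> xs"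
    and xs_rate: "\<And>k. K \<le> k \<Longrightarrow> norm (x k - xs) \<le> sqrt (2 / (\<gamma> * \<tau>) * C) / (1 - sqrt lam) * (sqrt lam) ^ k"
    by (rule geometric_steps_converge[OF sq Cs step]) auto
  have "(\<lambda>k. x k - (x k - xb k)) \<longlonglongrightarrow> xs - 0"
    by (intro tendsto_intros xs xb_lim)
  then have xb_xs: "xb \<longlonglongrightarrow> xs"
    by simp
  then have stat: "xs \<in> stationary P"
    using closed_sequentially[OF closed_stationary] xb by blast
  have "V P xs = Vs"
  proof -
    have "\<forall>\<^sub>F k in sequentially. dist (xb k) xs < \<epsilon>"
      using xb_xs separated(1) by (rule tendstoD)
    then have "\<forall>\<^sub>F k in sequentially. dist (xb k) xs < \<epsilon> \<and> K \<le> k"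
      by (intro eventually_conj eventually_ge_at_top)
    then obtain k where "dist (xb k) xs < \<epsilon>" "K \<le> k"
      using eventually_happens'[OF sequentially_bot] by blast
    then show ?thesis
      using separated(2)[OF xb stat, of k] V_xb by (force simp: dist_norm)
  qed
  \<comment> \<open>The gap bounds \<open>V\<close> from above only. From below, the squared displacements do, and they
    are controlled by the gap at the beginning of the window, \<open>B\<close> steps earlier.\<close>
  define C1 where "C1 = ?N * A * (R \<kappa>)\<^sup>2 * (2 * B * (2 / (\<gamma> * \<tau>) * (C / lam ^ B)))"
  define C2 where "C2 = sqrt (2 / (\<gamma> * \<tau>) * C) / (1 - sqrt lam)"
  have V_rate: "\<bar>V P (x k) - V P xs\<bar> \<le> (C + C1) * lam ^ k" if k: "K + B \<le> k" for k
  proof -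
    have kK: "K \<le> k" "K \<le> k - B" "B \<le> k"
      using k by auto
    have "E k \<le> 2 / (\<gamma> * \<tau>) * (\<Phi> (k - B) - \<Phi> (k + B))"
      by (rule E_le')
    also have "\<dots> \<le> 2 / (\<gamma> * \<tau>) * a (k - B)"
      using a0[of "k + B"] gt by (intro mult_left_mono) (auto simp: a_def)
    also have "\<dots> \<le> 2 / (\<gamma> * \<tau>) * (C * lam ^ (k - B))"
      using C(2)[OF kK(2)] gt by (intro mult_left_mono) auto
    also have "lam ^ (k - B) = lam ^ k / lam ^ B"
      using lam kK(3) by (simp add: power_diff)
    finally have "2 * B * E k \<le> 2 * B * (2 / (\<gamma> * \<tau>) * (C * (lam ^ k / lam ^ B)))"
      by (intro mult_left_mono) auto
    then have "(M k)\<^sup>2 \<le> 2 * B * (2 / (\<gamma> * \<tau>) * (C * (lam ^ k / lam ^ B)))"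
      using M_squared_le[of k] by simp
    then have "?N * A * (R \<kappa>)\<^sup>2 * (M k)\<^sup>2 \<le> ?N * A * (R \<kappa>)\<^sup>2 * (2 * B * (2 / (\<gamma> * \<tau>) * (C * (lam ^ k / lam ^ B))))"
      using A_nonneg by (intro mult_left_mono) auto
    then have "Vs - V P (x k) \<le> C1 * lam ^ k"
      using lower[OF kK(1)] by (simp add: C1_def mult_ac)
    moreover have "V P (x k) - Vs \<le> C * lam ^ k"
      using C(2)[OF kK(1)] V_le_Phi[of k] by (simp add: a_def)
    moreover have "0 \<le> C * lam ^ k" "0 \<le> C1 * lam ^ k"
      using C(1) lam A_nonneg gt by (simp_all add: C1_def)
    ultimately show ?thesis
      unfolding \<open>V P xs = Vs\<close> distrib_right by linarith
  qed
  have "\<bar>V P (x k) - V P xs\<bar> \<le> max (C + C1) C2 * lam ^ k \<and> norm (x k - xs) \<le> max (C + C1) C2 * sqrt (lam ^ k)"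
    if k: "K + B \<le> k" for k
  proof
    have "(C + C1) * lam ^ k \<le> max (C + C1) C2 * lam ^ k"
      using lam by (intro mult_right_mono) auto
    then show "\<bar>V P (x k) - V P xs\<bar> \<le> max (C + C1) C2 * lam ^ k"
      using V_rate[OF k] by simp
    have "C2 * sqrt (lam ^ k) \<le> max (C + C1) C2 * sqrt (lam ^ k)"
      using lam by (intro mult_right_mono) auto
    then show "norm (x k - xs) \<le> max (C + C1) C2 * sqrt (lam ^ k)"
      using xs_rate[of k] k by (simp add: C2_def real_sqrt_power)
  qed
  then show ?thesis
    using stat by blast
qed

end


section \<open>The rate and the step size threshold\<close>

context
  fixes N \<rho> B D L Lm \<kappa> \<tau> \<gamma> :: real
begin

text \<open>
  The constant of the contraction over \<open>2 * B\<close> steps, spelled out in the problem data: the threshold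
  for the step size has to be fixed before surrogates and run are given.
\<close>

definition contraction_const :: real where
  "contraction_const = (let A = \<rho> * L; Q = 2 * A + Lm; R = \<kappa> * (N * (2 + Q)) in
     2 * (N * (A * R\<^sup>2 + Q * (R + 1) + 2 * A) * (2 * B) + N * (A * D) + A * D) + N * (L + Lm))"

text \<open>
  The four entries serve, in this order, the decrease of \<open>\<Phi>\<close>, the closeness of stale data,
  the comparison of the contraction with the asserted rate, and the positivity of the numerator in
  the rate.
\<close>

definition step_threshold :: real where
  "step_threshold = Min {1 / (2 * (\<rho> * L) * (D + 1)), 1 / ((L + Lm) * (D + 1)),
     N * (\<rho> * L) / (2 * B * contraction_const * (L + Lm)), 1 / (L * (B * D * \<rho>\<^sup>2 + 2))}"

context
  assumes const: "1 \<le> N" "N \<le> B" "1 \<le> \<rho>" "0 \<le> D" "0 < L" "0 \<le> Lm" "0 < \<kappa>"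
begin

lemma contraction_const_ge: "L + Lm \<le> contraction_const"
proof -
  define A Q R where "A = \<rho> * L" and "Q = 2 * A + Lm" and "R = \<kappa> * (N * (2 + Q))"
  have nn: "0 \<le> A" "0 \<le> Q" "0 \<le> R" "0 \<le> N" "0 \<le> B"
    using const by (auto simp: A_def Q_def R_def)
  have "0 \<le> 2 * (N * (A * R\<^sup>2 + Q * (R + 1) + 2 * A) * (2 * B) + N * (A * D) + A * D)"
    using nn const(4) by (intro add_nonneg_nonneg mult_nonneg_nonneg) auto
  moreover have "1 * (L + Lm) \<le> N * (L + Lm)"
    using const by (intro mult_right_mono) auto
  ultimately show ?thesis
    unfolding contraction_const_def Let_def A_def Q_def R_def by simp
qed

lemma contraction_const_pos: "0 < contraction_const"
  using contraction_const_ge const by simp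

lemma step_threshold_pos: "0 < step_threshold"
proof -
  have "0 < B * D * \<rho>\<^sup>2 + 2"
    using const by (intro add_nonneg_pos mult_nonneg_nonneg) auto
  then show ?thesis
    unfolding step_threshold_def using const contraction_const_pos
    by (auto intro!: divide_pos_pos mult_pos_pos add_nonneg_pos)
qed

context
  assumes step: "0 < \<tau>" "0 < \<gamma>" "\<gamma> \<le> 1" "\<gamma> / \<tau> \<le> step_threshold"
begin

lemma step_size_conditions:
  "\<gamma> * (\<rho> * L) * (D + 1) \<le> \<tau> / 2"
  "\<gamma> * L * (B * D * \<rho>\<^sup>2 + 2) \<le> \<tau>"
  "\<tau> \<le> L + Lm \<Longrightarrow> \<gamma> * D \<le> 1"
  "\<tau> \<le> L + Lm \<Longrightarrow> \<gamma> * (2 * B * contraction_const) \<le> N * (\<rho> * L)"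
proof -
  have thr: "\<gamma> / \<tau> \<le> 1 / (2 * (\<rho> * L) * (D + 1))" "\<gamma> / \<tau> \<le> 1 / ((L + Lm) * (D + 1))"
    "\<gamma> / \<tau> \<le> N * (\<rho> * L) / (2 * B * contraction_const * (L + Lm))"
    "\<gamma> / \<tau> \<le> 1 / (L * (B * D * \<rho>\<^sup>2 + 2))"
    using step(4) by (auto simp: step_threshold_def)
  have cross: "\<gamma> * b \<le> a * \<tau>" if "\<gamma> / \<tau> \<le> a / b" "0 < b" for a b
    using that step(1) by (simp add: field_simps)
  have pos: "0 < \<rho> * L" "0 < L + Lm" "0 < D + 1" "0 < B" "0 < B * D * \<rho>\<^sup>2 + 2"
    using const by (auto intro!: add_nonneg_pos mult_nonneg_nonneg)
  have "\<gamma> * (2 * (\<rho> * L) * (D + 1)) \<le> 1 * \<tau>"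
    by (rule cross[OF thr(1)]) (intro mult_pos_pos pos, simp)
  then show "\<gamma> * (\<rho> * L) * (D + 1) \<le> \<tau> / 2"
    by (simp add: algebra_simps)
  show "\<gamma> * L * (B * D * \<rho>\<^sup>2 + 2) \<le> \<tau>"
    using cross[OF thr(4)] pos const(5) by (simp add: mult.assoc)
  assume T: "\<tau> \<le> L + Lm"
  have "\<gamma> * ((L + Lm) * (D + 1)) \<le> 1 * \<tau>"
    by (rule cross[OF thr(2)]) (intro mult_pos_pos pos)
  also have "\<dots> \<le> 1 * (L + Lm)"
    using T by simp
  finally have "\<gamma> * (D + 1) * (L + Lm) \<le> 1 * (L + Lm)"
    by (simp add: mult_ac)
  then have "\<gamma> * (D + 1) \<le> 1"
    using pos(2) by (rule mult_right_le_imp_le)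
  then show "\<gamma> * D \<le> 1"
    using step(2) by (simp add: algebra_simps)
  have "\<gamma> * (2 * B * contraction_const * (L + Lm)) \<le> N * (\<rho> * L) * \<tau>"
    by (rule cross[OF thr(3)]) (intro mult_pos_pos pos contraction_const_pos, simp)
  also have "\<dots> \<le> N * (\<rho> * L) * (L + Lm)"
    using T const pos by (intro mult_left_mono) auto
  finally have "\<gamma> * (2 * B * contraction_const) * (L + Lm) \<le> N * (\<rho> * L) * (L + Lm)"
    by (simp only: mult.assoc)
  then show "\<gamma> * (2 * B * contraction_const) \<le> N * (\<rho> * L)"
    using pos(2) by (rule mult_right_le_imp_le)
qed

text \<open>
  Every summand of \<open>alpha1\<close> and \<open>alpha2\<close> is nonnegative, and \<open>\<rho> * L * beta1\<close> and \<open>\<rho> * L * beta2\<close> are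
  at least \<open>\<rho> * L\<close>.
\<close>

lemma alpha_bounds:
  "\<rho> * L \<le> alpha1 N \<rho> B D L Lm \<kappa> \<tau> \<gamma>"
  "0 < alpha2 N \<rho> B D L Lm \<kappa> \<tau> \<gamma>"
proof -
  have sq: "0 \<le> Lm\<^sup>2 + (\<rho> - 1) * L\<^sup>2" "0 \<le> Lm\<^sup>2 + L\<^sup>2 * (\<rho> - 1)"
    using const by auto
  have K: "0 \<le> rK N L Lm \<kappa>"
    using const by (simp add: rK_def)
  have C: "0 \<le> rC2 N \<rho> B D L Lm \<tau> \<gamma>"
    unfolding rC2_def using const step sq
    by (intro divide_nonneg_nonneg mult_nonneg_nonneg) auto
  have pos: "0 < \<rho> * L"
    using const by simp
  have b1: "1 \<le> beta1 N \<rho> B D L Lm \<kappa> \<tau> \<gamma>"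
  proof -
    have "0 \<le> rC2 N \<rho> B D L Lm \<tau> \<gamma> * (rK N L Lm \<kappa> * (2 * N + 1) + N * (1 + \<gamma>\<^sup>2)) + rK N L Lm \<kappa> + \<gamma>\<^sup>2 * (B - N + 2)"
      using C K const by (intro add_nonneg_nonneg mult_nonneg_nonneg) auto
    then show ?thesis
      by (simp add: beta1_def)
  qed
  have b2: "1 \<le> beta2 N \<rho> B D L Lm \<kappa> \<tau> \<gamma>"
  proof -
    have "0 \<le> rC2 N \<rho> B D L Lm \<tau> \<gamma> * (3 * rK N L Lm \<kappa> * (2 * N + 1) + N * (3 + \<gamma>\<^sup>2)) + 6 * rK N L Lm \<kappa>
        + \<gamma>\<^sup>2 / 2 * (3 * B - 3 * N + 5)"
      using C K const by (intro add_nonneg_nonneg mult_nonneg_nonneg) auto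
    then show ?thesis
      by (simp add: beta2_def)
  qed
  have b3: "0 \<le> beta3 N \<rho> B D L Lm \<tau> \<gamma>"
    unfolding beta3_def using C const by (intro add_nonneg_nonneg mult_nonneg_nonneg) auto
  have b4: "0 \<le> beta4 N \<rho> B D L Lm \<kappa> \<tau> \<gamma>"
    unfolding beta4_def using C K sq const by (intro add_nonneg_nonneg mult_nonneg_nonneg) auto
  have b5: "0 \<le> beta5 N \<rho> B D L Lm \<tau> \<gamma>"
    unfolding beta5_def using C sq const by (intro add_nonneg_nonneg mult_nonneg_nonneg) auto
  have r: "0 \<le> (1 - \<gamma>) * (beta3 N \<rho> B D L Lm \<tau> \<gamma> + (L * \<gamma> * (\<rho>\<^sup>2 * L * D\<^sup>2 * \<gamma> + 1) + 1) / 2)"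
    using b3 const step by (intro mult_nonneg_nonneg add_nonneg_nonneg divide_nonneg_nonneg) auto
  have "\<rho> * L * 1 \<le> \<rho> * L * beta1 N \<rho> B D L Lm \<kappa> \<tau> \<gamma>" "\<rho> * L * 1 \<le> \<rho> * L * beta2 N \<rho> B D L Lm \<kappa> \<tau> \<gamma>"
    using pos b1 b2 by (intro mult_left_mono; simp)+
  then show "\<rho> * L \<le> alpha1 N \<rho> B D L Lm \<kappa> \<tau> \<gamma>" "0 < alpha2 N \<rho> B D L Lm \<kappa> \<tau> \<gamma>"
    unfolding alpha1_def alpha2_def using r b4 b5 pos by linarith+
qed

lemma rate_bounds:
  "0 < rate N \<rho> B D L Lm \<kappa> \<tau> \<gamma>" "rate N \<rho> B D L Lm \<kappa> \<tau> \<gamma> < 1"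
  "1 - rate N \<rho> B D L Lm \<kappa> \<tau> \<gamma> \<le> \<gamma>\<^sup>2 * \<tau> / (2 * N * (\<rho> * L))"
proof -
  define Y where "Y = 2 * \<tau> - \<gamma> * L * (B * D * \<rho>\<^sup>2 + 2)"
  define den where "den = 2 * N * alpha1 N \<rho> B D L Lm \<kappa> \<tau> \<gamma> + 2 * (B - N) * alpha2 N \<rho> B D L Lm \<kappa> \<tau> \<gamma>
     + \<gamma> * (2 - \<gamma>) * Y"
  have rate: "1 - rate N \<rho> B D L Lm \<kappa> \<tau> \<gamma> = \<gamma>\<^sup>2 / 2 * (Y / den)"
    by (simp add: rate_def Y_def den_def)
  have "0 \<le> \<gamma> * L * (B * D * \<rho>\<^sup>2 + 2)"
    using const step by (intro mult_nonneg_nonneg add_nonneg_nonneg) auto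
  then have Y: "0 < Y" "Y \<le> 2 * \<tau>"
    using step_size_conditions(2) step(1) by (auto simp: Y_def)
  have pos: "0 < 2 * N * (\<rho> * L)"
    using const by simp
  have "2 * N * (\<rho> * L) \<le> 2 * N * alpha1 N \<rho> B D L Lm \<kappa> \<tau> \<gamma>"
    using const alpha_bounds(1) by (intro mult_left_mono) auto
  moreover have "0 \<le> 2 * (B - N) * alpha2 N \<rho> B D L Lm \<kappa> \<tau> \<gamma>"
    using const alpha_bounds(2) by (intro mult_nonneg_nonneg) auto
  moreover have "\<gamma> * \<gamma> * Y \<le> \<gamma> * (2 - \<gamma>) * Y"
    using step Y by (intro mult_right_mono mult_left_mono) auto
  moreover have "0 < \<gamma> * \<gamma> * Y"
    using step Y by simp
  ultimately have den: "2 * N * (\<rho> * L) \<le> den" "\<gamma>\<^sup>2 * Y < den"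
    using pos unfolding den_def power2_eq_square by linarith+
  then have "0 < den"
    using pos by linarith
  then have "0 < \<gamma>\<^sup>2 / 2 * (Y / den)" "\<gamma>\<^sup>2 / 2 * (Y / den) < 1"
    using den(2) step Y \<open>0 < \<gamma> * \<gamma> * Y\<close> by (simp_all add: field_simps power2_eq_square)
  then show "0 < rate N \<rho> B D L Lm \<kappa> \<tau> \<gamma>" "rate N \<rho> B D L Lm \<kappa> \<tau> \<gamma> < 1"
    unfolding rate[symmetric] by simp_all
  have "Y / den \<le> 2 * \<tau> / (2 * N * (\<rho> * L))"
    using Y den pos step(1) by (intro frac_le) auto
  then have "\<gamma>\<^sup>2 / 2 * (Y / den) \<le> \<gamma>\<^sup>2 / 2 * (2 * \<tau> / (2 * N * (\<rho> * L)))"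
    by (rule mult_left_mono) simp
  then show "1 - rate N \<rho> B D L Lm \<kappa> \<tau> \<gamma> \<le> \<gamma>\<^sup>2 * \<tau> / (2 * N * (\<rho> * L))"
    unfolding rate by simp
qed

text \<open>
  By Bernoulli's inequality, \<open>2 * B\<close> steps at the asserted rate gain at most
  \<open>2 * B * (1 - rate)\<close>, which is of order \<open>\<gamma>\<^sup>2 * \<tau>\<close>; the contraction gains about
  \<open>\<gamma> * \<tau> / contraction_const\<close>.
\<close>

lemma contraction_le_rate_power:
  assumes T: "\<tau> \<le> L + Lm" and n: "real n = 2 * B"
  shows "1 / (1 + \<gamma> * \<tau> / contraction_const) \<le> rate N \<rho> B D L Lm \<kappa> \<tau> \<gamma> ^ n"
proof -
  define \<theta> where "\<theta> = \<gamma> * \<tau> / contraction_const"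
  let ?r = "rate N \<rho> B D L Lm \<kappa> \<tau> \<gamma>"
  have "\<gamma> * \<tau> \<le> \<tau>"
    using step by (simp add: mult_left_le_one_le)
  then have "\<gamma> * \<tau> \<le> contraction_const"
    using T contraction_const_ge by linarith
  then have th: "0 \<le> \<theta>" "\<theta> \<le> 1"
    using contraction_const_pos step by (auto simp: \<theta>_def)
  have pos: "0 < N * (\<rho> * L)"
    using const by simp
  have "2 * B * (\<gamma>\<^sup>2 * \<tau> / (2 * N * (\<rho> * L))) = \<gamma> * \<tau> * (B * \<gamma> / (N * (\<rho> * L)))"
    by (simp add: power2_eq_square)
  also have "\<dots> \<le> \<gamma> * \<tau> * (1 / (2 * contraction_const))"
    using step_size_conditions(4)[OF T] pos contraction_const_pos step
    by (intro mult_left_mono) (auto simp: field_simps)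
  also have "\<dots> = \<theta> / 2"
    by (simp add: \<theta>_def)
  finally have "2 * B * (1 - ?r) \<le> \<theta> / 2"
    using mult_left_mono[OF rate_bounds(3), of "2 * B"] const by linarith
  moreover have "1 + real n * (?r - 1) \<le> (1 + (?r - 1)) ^ n"
    using rate_bounds(1) by (intro Bernoulli_inequality) simp
  ultimately have "1 - \<theta> / 2 \<le> ?r ^ n"
    by (simp add: n algebra_simps)
  moreover have "1 / (1 + \<theta>) \<le> 1 - \<theta> / 2"
  proof -
    have "0 \<le> \<theta> * (1 - \<theta>)"
      using th by simp
    then have "1 \<le> (1 - \<theta> / 2) * (1 + \<theta>)"
      by (simp add: algebra_simps)
    then show ?thesis
      using th by (simp add: pos_divide_le_eq)
  qed
  ultimately show ?thesis
    by (simp add: \<theta>_def)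
qed

end

end

end


section \<open>The two cases of the Lipschitz constant\<close>

lemma infnorm_le_cart:
  fixes z :: "real ^ 'n"
  assumes "\<And>c. \<bar>z $ c\<bar> \<le> U"
  shows "infnorm z \<le> U"
  unfolding infnorm_cart using assms by (intro cSup_least) auto

context composite_problem
begin

lemma block_lipschitzI:
  assumes "max_lipschitz P T L" "0 \<le> L" "S \<subseteq> X" "\<And>i. restr P (nbr P i) ` S \<subseteq> T i"
  shows "block_lipschitz S L"
  unfolding block_lipschitz_def
proof (intro conjI allI ballI assms(2,3))
  fix i j u v assume j: "j \<in> nbr P i" and uv: "u \<in> S" "v \<in> S"
  obtain \<Lambda> where \<Lambda>: "\<And>i j. j \<in> nbr P i \<Longrightarrow> (\<Lambda> i j)-lipschitz_on (T i) (pgrad P {j} (floc P i))"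
    and L: "L = Max {\<Lambda> i j |i j. j \<in> nbr P i}"
    using assms(1) by (auto simp: max_lipschitz_def)
  have "{\<Lambda> i j |i j. j \<in> nbr P i} \<subseteq> (\<lambda>(i, j). \<Lambda> i j) ` UNIV"
    by auto
  then have "finite {\<Lambda> i j |i j. j \<in> nbr P i}"
    by (rule finite_subset) simp
  then have "\<Lambda> i j \<le> L"
    unfolding L using j by (intro Max_ge) auto
  have "norm (pgrad P {j} (floc P i) (restr P (nbr P i) u) - pgrad P {j} (floc P i) (restr P (nbr P i) v))
      \<le> \<Lambda> i j * norm (restr P (nbr P i) u - restr P (nbr P i) v)"
    using lipschitz_onD[OF \<Lambda>[OF j], of "restr P (nbr P i) u" "restr P (nbr P i) v"] assms(4)[of i] uv
    by (auto simp: dist_norm)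
  also have "\<dots> \<le> L * norm (restr P (nbr P i) u - restr P (nbr P i) v)"
    using \<open>\<Lambda> i j \<le> L\<close> by (rule mult_right_mono) simp
  also have "\<dots> \<le> L * norm (u - v)"
    using norm_restr_le[of P "nbr P i" "u - v"] assms(2) by (intro mult_left_mono) (auto simp: restr_diff)
  finally show "norm (pgrad P {j} (floc P i) (restr P (nbr P i) u) - pgrad P {j} (floc P i) (restr P (nbr P i) v))
      \<le> L * norm (u - v)" .
qed

end

lemma level0_barI:
  assumes "z \<in> level0 P x0" "v \<in> Xprod P UNIV" "norm (v - z) \<le> psi P ft U"
  shows "v \<in> level0_bar P ft x0 U"
proof -
  define b where "b = (v - z) /\<^sub>R psi P ft U"
  have v: "v = z + psi P ft U *\<^sub>R b"
    using assms(3) by (cases "psi P ft U = 0") (auto simp: b_def)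
  have "0 \<le> psi P ft U"
    using order_trans[OF norm_ge_zero assms(3)] .
  then have "norm b = norm (v - z) / psi P ft U"
    unfolding b_def norm_scaleR by (simp add: divide_inverse mult.commute)
  then have "b \<in> cball 0 1"
    using assms(3) \<open>0 \<le> psi P ft U\<close> by (auto simp: divide_le_eq_1)
  then show ?thesis
    using assms(1,2) v by (auto simp: level0_bar_def)
qed

context asynchronous_run
begin

text \<open>
  While the iterates stay in the initial level set, also the stale data lie in the cube, so that
  the displacement is one of those over which \<open>psi\<close> takes the supremum.
\<close>

lemma m_le_psi:
  assumes cube: "level0 P x0 \<subseteq> Cube P U" and lev: "\<And>s. s \<le> k \<Longrightarrow> x s \<in> level0 P x0"
  shows "m k \<le> psi P ft U"
proof -
  have comp: "\<bar>x s $ c\<bar> \<le> U" if "s \<le> k" for s c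
    using lev[OF that] cube component_le_infnorm_cart[of "x s" c] by (force simp: Cube_def)
  have "infnorm (stale k j) \<le> U" for j
    by (rule infnorm_le_cart) (auto simp: stale_def intro: comp)
  then have "stale k j \<in> Cube P U" for j
    by (simp add: Cube_def stale_mem_X)
  moreover have "best_response P ft (act k) (\<lambda>j. restr P (nbr P j) (stale k j)) (y k)"
    using step_properties(1) by (simp add: restr_stale)
  moreover have "m k = norm (y k - restr P {act k} (stale k (act k)))"
    by (simp add: m_def \<delta>_def restr_stale_active)
  ultimately show ?thesis
    unfolding psi_def by (intro cSup_upper best_responses_bounded) blast
qed

lemma x_eq_x0_before_first_move:
  assumes "\<And>s. s < k \<Longrightarrow> \<delta> s = 0"
  shows "x k = x0"
  using x_diff[of 0 k] assms algorithm by (simp add: DAsyFLEXA_def)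

end

text \<open>
  The Lyapunov function keeps the iterates in the initial level set, and a small relaxation keeps the
  stale data within \<open>psi\<close> of the current iterate.
\<close>

lemma (in lipschitz_run) stays_in_level0:
  assumes cube: "level0 P x0 \<subseteq> Cube P U" and S: "S = level0_bar P ft x0 U"
    and small: "\<gamma> * A * (D + 1) \<le> \<tau> / 2" and lag1: "\<gamma> * D \<le> 1"
  shows "x k \<in> level0 P x0 \<and> compared_in_region k"
proof (induction k rule: less_induct)
  case (less k)
  have "\<Phi> j \<le> \<Phi> 0" if "j \<le> k" for j
    using that
  proof (induction j)
    case (Suc j)
    have "0 \<le> \<gamma> * \<tau> / 2 * (m j)\<^sup>2"
      using gamma_bounds tau_pos by simp
    then show ?case
      using Suc Phi_step[OF _ small, of j] less.IH[of j] by simp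
  qed simp
  from this[of k] have "V P (x k) \<le> V P (x 0)"
    using V_le_Phi[of k] Phi_0 by simp
  then have xk: "x k \<in> level0 P x0"
    using x_mem algorithm by (simp add: level0_def DAsyFLEXA_def)
  have lev: "x s \<in> level0 P x0" if "s \<le> k" for s
    using that xk less.IH[of s] by (cases "s = k") auto
  have m: "m s \<le> psi P ft U" if "s \<le> k" for s
    using that by (intro m_le_psi[OF cube] lev) simp
  have "compared_in_region k"
    unfolding step_within_def S
  proof (intro conjI ballI allI impI)
    fix j assume j: "j \<in> nbr P (act k)"
    have psi0: "0 \<le> psi P ft U"
      using m[of k] m_nonneg[of k] by simp
    have "lag k \<le> (\<Sum>s\<in>{k - D..<k}. psi P ft U)"
      unfolding lag_def by (intro sum_mono m) simp
    also have "\<dots> \<le> D * psi P ft U"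
      unfolding sum_constant using psi0 by (intro mult_right_mono of_nat_mono) auto
    finally have "\<gamma> * lag k \<le> \<gamma> * (D * psi P ft U)"
      using gamma_bounds by (intro mult_left_mono) auto
    also have "\<dots> \<le> 1 * psi P ft U"
      using lag1 psi0 unfolding mult.assoc[symmetric] by (rule mult_right_mono)
    finally have "norm (stale k j - x k) \<le> psi P ft U"
      using norm_stale_diff_le[OF j] by simp
    then show "stale k j \<in> level0_bar P ft x0 U"
      by (intro level0_barI[OF xk stale_mem_X])
  next
    fix t :: real assume t: "0 \<le> t" "t \<le> 1"
    have "t * m k \<le> m k"
      using t m_nonneg by (simp add: mult_left_le_one_le)
    then show "x k + t *\<^sub>R \<delta> k \<in> level0_bar P ft x0 U"
      using t m[of k] by (intro level0_barI[OF xk step_mem_X[OF x_mem t]]) (simp add: m_def)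
  qed
  then show ?case
    using xk by simp
qed

lemma (in lipschitz_run) contraction_const_eq:
  "contraction_const CARD('a) (rho P) B D L Lm \<kappa> = 2 * C_gap (R \<kappa>) + CARD('a) * (L + Lm)"
  by (simp add: contraction_const_def C_gap_def R_def Q_def A_def Let_def)

text \<open>
  The region \<open>S\<close> is the feasible set or the enlarged level set. Two conditions on \<open>\<gamma>\<close> are only
  assumed when \<open>\<tau> \<le> L + Lm\<close>. The first move of a run provides this bound: all data are
  still equal to \<open>x0\<close> then, so the points compared lie in \<open>S\<close> before it is known that later ones do.
\<close>

theorem (in asynchronous_run) linear_convergence_of_run:
  fixes L :: real
  assumes L: "L_const P ft x0 L" and small: "\<gamma> * (rho P * L) * (D + 1) \<le> \<tau> / 2"
    and lag1: "\<tau> \<le> L + Lm \<Longrightarrow> \<gamma> * D \<le> 1" and kappa: "0 < \<kappa>"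
    and eb: "\<forall>\<^sub>F k in sequentially. infdist (x k) (stationary P) \<le> \<kappa> * residual P (x k)"
    and separated: "0 < \<epsilon>" "\<And>u v. u \<in> stationary P \<Longrightarrow> v \<in> stationary P \<Longrightarrow> V P u \<noteq> V P v \<Longrightarrow> \<epsilon> \<le> norm (u - v)"
    and minimum: "x\<^sub>m \<in> X" "\<And>z. z \<in> X \<Longrightarrow> V P x\<^sub>m \<le> V P z"
    and lam: "0 < lam" "lam < 1"
    and rate: "\<tau> \<le> L + Lm \<Longrightarrow>
      1 / (1 + \<gamma> * \<tau> / contraction_const CARD('a) (rho P) B D L Lm \<kappa>) \<le> lam ^ (2 * B)"
  shows "\<exists>xs\<in>stationary P. \<exists>C K. \<forall>k\<ge>K. \<bar>V P (x k) - V P xs\<bar> \<le> C * lam ^ k \<and>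
    norm (x k - xs) \<le> C * sqrt (lam ^ k)"
proof -
  have x0: "x 0 = x0" "x0 \<in> X"
    using algorithm by (auto simp: DAsyFLEXA_def)
  have L0: "0 \<le> L"
    using L by (simp add: L_const_def)
  have stays: ?thesis if S: "block_lipschitz S L" "x0 \<in> S" and zero: "\<And>k. \<delta> k = 0" for S
  proof -
    interpret lipschitz_run P ft \<tau> Ls \<gamma> B D act d x0 x S L
      using S by unfold_locales
    have "x k = x0" "x0 \<in> stationary P" for k
      using zero_steps_stationary[OF S(2) zero] by auto
    then show ?thesis
      by (intro bexI[of _ x0] exI[of _ 0]) auto
  qed
  have moves: ?thesis if S: "block_lipschitz S L" and good: "\<And>k. step_within S k" and tau: "\<tau> \<le> L + Lm"
    and near: "0 < r" "\<And>k z. z \<in> X \<Longrightarrow> norm (z - x k) \<le> r \<Longrightarrow> z \<in> S" for S r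
  proof -
    interpret lipschitz_run P ft \<tau> Ls \<gamma> B D act d x0 x S L
      using S by unfold_locales
    show ?thesis
      using small rate[OF tau]
      by (intro linear_convergence[OF good _ tau kappa eb near separated minimum lam])
        (simp_all add: A_def contraction_const_eq)
  qed
  consider "\<And>k. \<delta> k = 0" | k where "\<delta> k \<noteq> 0" "\<And>s. s < k \<Longrightarrow> \<delta> s = 0"
    using exists_least_iff[of "\<lambda>k. \<delta> k \<noteq> 0"] by blast
  then show ?thesis
  proof cases
    case 1
    show ?thesis
    proof (cases "A2b P \<and> max_lipschitz P (\<lambda>i. Xprod P (nbr P i)) L")
      case True
      then show ?thesis
        using L0 x0 by (intro stays[OF block_lipschitzI[of "\<lambda>i. Xprod P (nbr P i)" L X] _ 1]) (auto intro: restr_nbr_mem)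
    next
      case False
      then obtain U where U: "level0 P x0 \<subseteq> Cube P U"
        "max_lipschitz P (\<lambda>i. restr P (nbr P i) ` level0_bar P ft x0 U) L"
        using L by (auto simp: L_const_def)
      have "x0 \<in> level0 P x0"
        using x0 by (simp add: level0_def)
      moreover have "m 0 \<le> psi P ft U"
        using calculation x0 by (intro m_le_psi[OF U(1)]) auto
      ultimately have "x0 \<in> level0_bar P ft x0 U"
        using x0 m_nonneg[of 0] by (intro level0_barI[of x0]) auto
      then show ?thesis
        by (intro stays[OF block_lipschitzI[OF U(2) L0, of "level0_bar P ft x0 U"] _ 1]) (auto simp: level0_bar_def)
    qed
  next
    case (2 k)
    show ?thesis
    proof (cases "A2b P \<and> max_lipschitz P (\<lambda>i. Xprod P (nbr P i)) L")
      case True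
      then have S: "block_lipschitz X L"
        using L0 by (intro block_lipschitzI[of _ L X]) (auto intro: restr_nbr_mem)
      interpret lipschitz_run P ft \<tau> Ls \<gamma> B D act d x0 x X L
        using S by unfold_locales
      have "\<tau> \<le> L + Lm"
        using tau_le[OF x_mem _ 2(1)] step_mem_X[OF x_mem, of 1 k] by simp
      then show ?thesis
        by (intro moves[OF S, of 1]) (auto simp: step_within_def stale_mem_X step_mem_X x_mem)
    next
      case False
      then obtain U where U: "level0 P x0 \<subseteq> Cube P U"
        "max_lipschitz P (\<lambda>i. restr P (nbr P i) ` level0_bar P ft x0 U) L"
        using L by (auto simp: L_const_def)
      have S: "block_lipschitz (level0_bar P ft x0 U) L"
        by (rule block_lipschitzI[OF U(2) L0]) (auto simp: level0_bar_def)
      interpret lipschitz_run P ft \<tau> Ls \<gamma> B D act d x0 x "level0_bar P ft x0 U" L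
        using S by unfold_locales
      have lev0: "x0 \<in> level0 P x0"
        using x0 by (simp add: level0_def)
      have x_first: "x s = x0" if "s \<le> k" for s
        using that 2(2) by (intro x_eq_x0_before_first_move) simp
      have mk: "m k \<le> psi P ft U"
        using x_first lev0 by (intro m_le_psi[OF U(1)]) simp
      moreover have "0 < m k"
        using 2(1) by (simp add: m_def)
      ultimately have psi: "0 < psi P ft U"
        by linarith
      have tau: "\<tau> \<le> L + Lm"
      proof (rule tau_le[OF _ _ 2(1)])
        have lev: "x k \<in> level0 P x0"
          using x_first[of k] lev0 by simp
        show "x k \<in> level0_bar P ft x0 U"
          using psi by (intro level0_barI[OF lev x_mem]) simp
        show "x k + \<delta> k \<in> level0_bar P ft x0 U"
          using mk step_mem_X[OF x_mem, of 1 k] by (intro level0_barI[OF lev]) (simp_all add: m_def)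
      qed
      have stay: "x k \<in> level0 P x0 \<and> step_within (level0_bar P ft x0 U) k" for k
        using small by (intro stays_in_level0[OF U(1) refl _ lag1[OF tau]]) (simp add: A_def)
      show ?thesis
        using stay psi by (intro moves[OF S _ tau, of "psi P ft U"]) (auto intro: level0_barI)
    qed
  qed
qed

theorem theorem3:
  fixes P :: "('a::finite, 'n::finite) problem"
    and x0 :: "real ^ 'n"
    and Ls :: "'a \<Rightarrow> real"
    and L \<eta> \<epsilon> \<kappa> :: real
    and B D :: nat
  assumes "neighborhoods P"
    and "assumption_A P x0"
    and "prox_well_defined P"
    and "assumption_B P"
    and "\<eta> > (INF x\<in>Xprod P UNIV. V P x)" and "\<epsilon> > 0" and "\<kappa> > 0"
    and "error_bound P \<eta> \<epsilon> \<kappa>"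
  shows "\<exists>c>0. \<forall>ft \<tau> \<gamma> act d x.
    assumption_C P ft \<tau> Ls \<and> L_const P ft x0 L \<and>
    DAsyFLEXA P ft x0 \<gamma> act d x \<and> assumption_D P B D act d \<and>
    (\<forall>\<^sub>F k in sequentially. V P (x k) \<le> \<eta> \<and> residual P (x k) \<le> \<epsilon>) \<and>
    \<gamma> / \<tau> \<le> c \<longrightarrow>
    (let N = real CARD('a); \<rho> = real (rho P); Lm = Max (range Ls);
         lam = rate N \<rho> (real B) (real D) L Lm \<kappa> \<tau> \<gamma>
     in 0 < alpha1 N \<rho> (real B) (real D) L Lm \<kappa> \<tau> \<gamma> \<and>
        0 < alpha2 N \<rho> (real B) (real D) L Lm \<kappa> \<tau> \<gamma> \<and>
        0 < lam \<and> lam < 1 \<and>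
        (\<exists>xs\<in>stationary P. \<forall>t<B.
           (\<lambda>k. V P (x (t + k * B)) - V P xs) \<in> O(\<lambda>k. lam ^ (t + k * B)) \<and>
           (\<lambda>k. norm (x (t + k * B) - xs)) \<in> O(\<lambda>k. sqrt (lam ^ (t + k * B)))))"
proof -
  let ?N = "real CARD('a)" and ?\<rho> = "real (rho P)" and ?Lm = "Max (range Ls)"
  \<comment> \<open>If the condition fails, no run satisfies the hypotheses, and any positive number will do.\<close>
  define c where "c = (if 0 < L \<and> 0 \<le> ?Lm \<and> CARD('a) \<le> B then step_threshold ?N ?\<rho> B D L ?Lm \<kappa> else 1)"
  interpret composite_problem P
  proof
    show "C1_on P (nbr P i) (Xprod P (nbr P i)) (floc P i)" for i
      using assms(2) by (auto simp: assumption_A_def A2a_def A2b_def block_LC1_on_def)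
  qed (use assms in \<open>auto simp: assumption_A_def\<close>)
  obtain x\<^sub>m where xm: "x\<^sub>m \<in> X" "\<And>z. z \<in> X \<Longrightarrow> V P x\<^sub>m \<le> V P z"
    using assms(2) by (auto simp: assumption_A_def)
  obtain e where e: "0 < e" "\<And>u v. u \<in> stationary P \<Longrightarrow> v \<in> stationary P \<Longrightarrow> V P u \<noteq> V P v \<Longrightarrow> e \<le> norm (u - v)"
    using assms(4) by (auto simp: assumption_B_def)
  have N: "1 \<le> ?N" and rho: "1 \<le> ?\<rho>"
    using rho_ge_1 zero_less_card_finite[where 'a = 'a] by simp_all
  have "0 < c"
    using N rho assms(7) by (auto simp: c_def intro!: step_threshold_pos)
  moreover have "0 < alpha1 ?N ?\<rho> (real B) (real D) L ?Lm \<kappa> \<tau> \<gamma> \<and>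
      0 < alpha2 ?N ?\<rho> (real B) (real D) L ?Lm \<kappa> \<tau> \<gamma> \<and> 0 < lam \<and> lam < 1 \<and>
      (\<exists>xs\<in>stationary P. \<forall>t<B.
         (\<lambda>k. V P (x (t + k * B)) - V P xs) \<in> O(\<lambda>k. lam ^ (t + k * B)) \<and>
         (\<lambda>k. norm (x (t + k * B) - xs)) \<in> O(\<lambda>k. sqrt (lam ^ (t + k * B))))"
    if run: "assumption_C P ft \<tau> Ls" "DAsyFLEXA P ft x0 \<gamma> act d x" "assumption_D P B D act d"
      and L: "L_const P ft x0 L" and ev: "\<forall>\<^sub>F k in sequentially. V P (x k) \<le> \<eta> \<and> residual P (x k) \<le> \<epsilon>"
      and small: "\<gamma> / \<tau> \<le> c" and lam_eq: "lam = rate ?N ?\<rho> (real B) (real D) L ?Lm \<kappa> \<tau> \<gamma>"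
    for ft \<tau> \<gamma> act d x lam
  proof -
    interpret asynchronous_run P ft \<tau> Ls \<gamma> B D act d x0 x
      using run by unfold_locales
    have NB: "CARD('a) \<le> B"
      using schedule by (simp add: assumption_D_def)
    have L0: "0 < L"
      using L by (simp add: L_const_def)
    have const: "1 \<le> ?N" "?N \<le> real B" "1 \<le> ?\<rho>" "0 \<le> real D" "0 < L" "0 \<le> Lm" "0 < \<kappa>"
      using N rho NB L0 Lm_nonneg assms(7) by simp_all
    have thr: "\<gamma> / \<tau> \<le> step_threshold ?N ?\<rho> (real B) (real D) L Lm \<kappa>"
      using small L0 NB Lm_nonneg by (simp add: c_def Lm_def)
    note step = tau_pos gamma_bounds thr
    note alpha = alpha_bounds[OF const step]
    have "0 < ?\<rho> * L"
      using const by simp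
    then have alpha1: "0 < alpha1 ?N ?\<rho> (real B) (real D) L Lm \<kappa> \<tau> \<gamma>"
      using alpha(1) by linarith
    have lam: "0 < lam" "lam < 1"
      unfolding lam_eq by (rule rate_bounds[OF const step, unfolded Lm_def])+
    have "\<forall>\<^sub>F k in sequentially. infdist (x k) (stationary P) \<le> \<kappa> * residual P (x k)"
      using ev by eventually_elim (use assms(8) x_mem in \<open>auto simp: error_bound_def\<close>)
    then have "\<exists>xs\<in>stationary P. \<exists>C K. \<forall>k\<ge>K. \<bar>V P (x k) - V P xs\<bar> \<le> C * lam ^ k \<and>
        norm (x k - xs) \<le> C * sqrt (lam ^ k)"
      using step_size_conditions[OF const step] contraction_le_rate_power[OF const step, of "2 * B"]
      by (intro linear_convergence_of_run[OF L _ _ assms(7) _ e xm lam]) (auto simp: lam_eq Lm_def add.commute)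
    then obtain xs C K where xs: "xs \<in> stationary P"
      and bound: "\<And>k. K \<le> k \<Longrightarrow> \<bar>V P (x k) - V P xs\<bar> \<le> C * lam ^ k"
        "\<And>k. K \<le> k \<Longrightarrow> norm (x k - xs) \<le> C * sqrt (lam ^ k)"
      by blast
    have "1 \<le> B"
      using NB zero_less_card_finite[where 'a = 'a] by linarith
    then have "K \<le> t + k * B" if "K \<le> k" for t k
      using that mult_le_mono[of K k 1 B] by simp
    then have ev_ge: "\<forall>\<^sub>F k in sequentially. K \<le> t + k * B" for t
      unfolding eventually_sequentially by blast
    have "(\<lambda>k. V P (x (t + k * B)) - V P xs) \<in> O(\<lambda>k. lam ^ (t + k * B))"
      "(\<lambda>k. norm (x (t + k * B) - xs)) \<in> O(\<lambda>k. sqrt (lam ^ (t + k * B)))" for t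
      by (rule bigoI[of _ C], rule eventually_mono[OF ev_ge[of t]], use bound lam in auto)+
    then show ?thesis
      using xs lam alpha1 alpha(2) unfolding Lm_def by blast
  qed
  ultimately show ?thesis
    unfolding Let_def by (intro exI[of _ c]) blast
qed

end
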